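(* Let $\mathfrak A\subset\mathcal A^{\mathbb Z^D}$ be a subshift of finite type, let $(\mathcal G,+)$ be an abelian group, and let $\Phi:\mathcal A^{\mathbb Z^D}\to\mathcal A^{\mathbb Z^D}$ be a cellular automaton with $\Phi(\mathfrak A)\subseteq\mathfrak A$. (a) For all $d\in\{0,\dots,D\}$, $\Phi$ induces an endomorphism $\mathcal H^d_{\mathrm{inv}}\Phi:\mathcal H^d_{\mathrm{inv}}(\mathfrak A,\mathcal G)\to\mathcal H^d_{\mathrm{inv}}(\mathfrak A,\mathcal G)$. (b) Let $d\in\{0,\dots,D\}$ and suppose $\mathcal H^d_{\mathrm{inv}}\Phi$ is an epimorphism. [i] If $\mathbf a\in\widetilde{\mathfrak A}$ has a projective $(\mathcal G,d)$-pole, $\mathbf b:=\Phi(\mathbf a)$, and $\mathrm{Ext}\big(\mathcal H_{d-1}[\mathbb G_r(\mathbf b)],\mathcal G\big)=0$ for all large $r\in\mathbb N$, then $\mathbf b$ also has a projective $(\mathcal G,d)$-pole. [ii] In particular, any projective $1$-pole or $D$-pole (i.e. any projective $(\mathcal G,d)$-pole, when $d=1$ or $d=D$) is $\Phi$-persistent. [iii] If $\mathcal G$ is the additive group of a field (e.g. $\mathcal G=\mathbb Z/p$ for $p$ prime), then all projective $\mathcal G$-poles (i.e. projective $(\mathcal G,d)$-poles) are $\Phi$-persistent.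
   Context: **Subshifts and defects.** $\mathcal A$ is a finite alphabet, $D\ge1$; $\mathcal A^{\mathbb Z^D}$ carries the product topology; $\sigma^{\mathsf v}(\mathbf a)_{\mathsf z}=a_{\mathsf z+\mathsf v}$; a subshift is a closed shift-invariant subset. $\mathbb B(r)=\{-r,\dots,r\}^D$, $\mathbb B(\mathsf z,r)=\mathsf z+\mathbb B(r)$; $\mathfrak A_{\mathbb U}=\{\mathbf a_{\mathbb U}:\mathbf a\in\mathfrak A\}$, patterns on translates of $\mathbb U$ being identified with patterns on $\mathbb U$; $\mathfrak A_{(r)}=\mathfrak A_{\mathbb B(r)}$. $\mathfrak A$ is a subshift of finite type of radius $R>0$ if $\mathfrak A=\{\mathbf a:\mathbf a_{\mathbb B(\mathsf z,R)}\in\mathfrak A_{(R)}\ \forall\mathsf z\}$. A cellular automaton is a continuous shift-commuting self-map; it has radius $q$ if $\Phi(\mathbf a)_{\mathsf z}=\phi(\mathbf a_{\mathbb B(\mathsf z,q)})$ for a local rule $\phi$. $\mathcal F_{\mathbf a}(\mathsf z)=\max\{r\in\mathbb N:\mathbf a_{\mathbb B(\mathsf z,r)}\in\mathfrak A_{(r)}\}\in\mathbb N\cup\{\infty\}$; $\widetilde{\mathfrak A}=\{\mathbf a:\sup_{\mathsf z}\mathcal F_{\mathbf a}(\mathsf z)=\infty\}$; $\mathbb G_r(\mathbf a)=\{\mathsf z:\mathcal F_{\mathbf a}(\mathsf z)\ge r\}$. $\mathbf a$ is defective if $\mathbf a\in\widetilde{\mathfrak A}\setminus\mathfrak A$; its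 defect is $\Phi$-persistent if $\Phi^t(\mathbf a)$ is defective for all $t\in\mathbb N$. $\mathcal H_{d-1}[\mathbb G_r(\mathbf b)]$ is the homology with coefficients in $\mathbb Z$ of the smallest closed set containing $\mathbb G_r(\mathbf b)$ and all unit cubes $\mathsf z+[0,1]^D$ whose corners are all in $\mathbb G_r(\mathbf b)$; $\mathrm{Ext}$ is the usual $\mathrm{Ext}^1_{\mathbb Z}$ of abelian groups. **Equivariant cocycles and poles.** $\mathbf Y$ is the canonical cell decomposition of $\mathbb R^D$ with vertex set $\mathbb Z^D$ and top cells the unit cubes $\mathsf z+[0,1]^D$; $\mathbf Y^d$ is its set of (oriented) $d$-cells, $\mathbb Z[\mathbf Y^d]$ the group of $d$-chains (with $\mathbb Z[\mathbf Y^{-1}]=\mathbb Z[\mathbf Y^{D+1}]=\{0\}$), $\partial_d$ the cubical boundary, $\Upsilon_d^{\mathsf z}$ translation by $\mathsf z$. $\mathcal Z^d_{\mathrm{eq}}(\mathfrak A,\mathcal G)$ is the group of continuous $C:\mathbb Z[\mathbf Y^d]\times\mathfrak A\to\mathcal G$, additive in the first variable, with $C(\zeta,\sigma^{\mathsf z}(\mathbf a))=C(\Upsilon_d^{\mathsf z}(\zeta),\mathbf a)$ and $C(\partial_{d+1}\beta,\mathbf a)=0$ for all $\beta\in\mathbb Z[\mathbf Y^{d+1}]$. Let $\mathbf Y_0^d$ be the set of $d$-cells $x=\{t\in[0,1]^D:t_i=0\ \forall i\in I\}$, $I\subset\{1,\dots,D\}$, $|I|=D-d$; for such $x$ put $\partial_x\mathbb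 B(r)=\{\mathsf u\in\mathbb B(r):u_i<r\ \forall i\in I\}$. Every $y\in\mathbf Y^d$ is uniquely $\Upsilon_d^{\mathsf z}(x)$ with $x\in\mathbf Y^d_0$, $\mathsf z\in\mathbb Z^D$. $C$ is locally determined with radius $r$ if for each $x\in\mathbf Y_0^d$ there is $c_x:\mathfrak A_{\partial_x\mathbb B(r)}\to\mathcal G$ with $C(\Upsilon^{\mathsf z}_d(x),\mathbf a)=c_x(\mathbf a_{\mathsf z+\partial_x\mathbb B(r)})$ for $\mathbf a\in\mathfrak A$; then the same formula defines $C(y,\mathbf a)$ for $\mathbf a\in\widetilde{\mathfrak A}$ and $d$-cells $y$ with all vertices in $\mathbb G_r(\mathbf a)$. If $C$ is locally determined with radius $r$, $\mathbf a\in\widetilde{\mathfrak A}$ has a $C$-pole of range $r$ if there is a $d$-cycle $\zeta$ ($\partial_d\zeta=0$) consisting of $d$-cells with all vertices in $\mathbb G_r(\mathbf a)$ with $C(\zeta,\mathbf a)\neq0$. It has a projective $C$-pole if it has a $C$-pole of range $r$ for all large enough $r$, and a projective $(\mathcal G,d)$-pole if it has a projective $C$-pole for some $C\in\mathcal Z^d_{\mathrm{eq}}(\mathfrak A,\mathcal G)$; this is called a $d$-pole or a $\mathcal G$-pole when the other datum is clear. "A pole is $\Phi$-persistent" means the defect of every $\mathbf a$ having such a pole is $\Phi$-persistent. **Invariant cohomology.** For $1\le i\le D$ let $\partial_i^+\mathbb B(r)=\{\mathsf u\in\mathbb B(r):u_i>-r\}$, $\partial_i^-\mathbb B(r)=\{\mathsf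 u\in\mathbb B(r):u_i<r\}$. For $r\ge R$ the tile complex $\mathbf X_r$ is obtained from the disjoint union of unit $D$-cubes $\square_{\mathsf z}\mathbf c$ ($\mathsf z\in\mathbb Z^D$, $\mathbf c\in\mathfrak A_{(r)}$), $\square_{\mathsf z}\mathbf c$ a copy of $\mathsf z+[0,1]^D$, by gluing the upper face of $\square_{\mathsf z}\mathbf c$ orthogonal to the unit vector $\mathsf e_i$ to the lower face of $\square_{\mathsf z+\mathsf e_i}\mathbf c'$ orthogonal to $\mathsf e_i$ if and only if $\mathbf c_{\partial_i^+\mathbb B(r)}=\mathbf c'_{\partial_i^-\mathbb B(r)}$ (index sets identified by translation). $\mathbb Z^D$ acts on $\mathbf X_r$ by cellular homeomorphisms $\Xi^{\mathsf z}:\square_{\mathsf x}\mathbf c\to\square_{\mathsf x+\mathsf z}\mathbf c$. Let $\mathcal C^d_{\mathrm{inv}}(\mathbf X_r,\mathcal G)$ be the group of cellular $\mathcal G$-valued $d$-cochains $C$ with $C\circ\Xi^{\mathsf z}=C$ for all $\mathsf z$; with the cellular coboundary these form a complex whose cohomology is $\mathcal H^d_{\mathrm{inv}}(\mathbf X_r,\mathcal G)$. The cellular maps $\zeta_r:\mathbf X_{r+1}\to\mathbf X_r$, $\square_{\mathsf z}\mathbf c\mapsto\square_{\mathsf z}\mathbf c_{\mathbb B(r)}$, induce $\mathcal H^d_{\mathrm{inv}}(\mathbf X_r,\mathcal G)\to\mathcal H^d_{\mathrm{inv}}(\mathbf X_{r+1},\mathcal G)$, and $\mathcal H^d_{\mathrm{inv}}(\mathfrak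 A,\mathcal G):=\varinjlim_{r\ge R}\mathcal H^d_{\mathrm{inv}}(\mathbf X_r,\mathcal G)$. If $\Phi$ has radius $q$, $\mathcal H^d_{\mathrm{inv}}\Phi$ is the map induced in the limit by $C\mapsto C\circ\Phi_*$, where $\Phi_*:\mathbf X_{r+q}\to\mathbf X_r$ is the cellular map $\square_{\mathsf z}\mathbf c\mapsto\square_{\mathsf z}\Phi(\mathbf c)$ (with $\Phi(\mathbf c)\in\mathfrak A_{(r)}$ for $\mathbf c\in\mathfrak A_{(r+q)}$).
   Formalization: In [iii] with d=0, persistence is stated only for projective 0-poles detected by 0-cycles with coefficient sum zero; for arbitrary 0-cycles the claim is false, since a nonzero constant cocycle gives a 0-pole even in elements of the subshift. *)

theory Defs
  imports "HOL-Homology.Homology" "HOL-Library.Extended_Nat"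
begin

section \<open>Subshifts and defects\<close>

text \<open>
  The dimension \<open>D\<close> is \<open>CARD('n)\<close>. The linear order on the index type
  \<open>'n\<close> plays the role of the order of the coordinates \<open>1, \<dots>, D\<close>; it is used only
  to orient cells.
\<close>

type_synonym ('n, 'a) config = "int ^ 'n \<Rightarrow> 'a"

definition config_topology :: "('n::finite, 'a) config topology" where
  "config_topology = product_topology (\<lambda>_. discrete_topology UNIV) UNIV"

definition shift :: "int ^ 'n \<Rightarrow> ('n::finite, 'a) config \<Rightarrow> ('n, 'a) config" where
  "shift v a = (\<lambda>z. a (z + v))"

definition subshift :: "('n::finite, 'a) config set \<Rightarrow> bool" where
  "subshift \<AA> \<longleftrightarrow> closedin config_topology \<AA> \<and> (\<forall>v. shift v ` \<AA> = \<AA>)"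

definition lattice_box :: "nat \<Rightarrow> (int ^ 'n::finite) set" where
  "lattice_box r = {u. \<forall>i. \<bar>u $ i\<bar> \<le> int r}"

text \<open>
  A pattern on a translate \<open>z + U\<close> is identified with a pattern on \<open>U\<close>, and is
  represented by a function that is \<^const>\<open>undefined\<close> outside \<open>U\<close>.
\<close>

definition pattern :: "('n::finite, 'a) config \<Rightarrow> int ^ 'n \<Rightarrow> (int ^ 'n) set \<Rightarrow> ('n, 'a) config" where
  "pattern a z U = (\<lambda>u\<in>U. a (z + u))"

definition patterns :: "('n::finite, 'a) config set \<Rightarrow> (int ^ 'n) set \<Rightarrow> ('n, 'a) config set" where
  "patterns \<AA> U = (\<lambda>a. restrict a U) ` \<AA>"

definition subshift_of_finite_type :: "nat \<Rightarrow> ('n::finite, 'a) config set \<Rightarrow> bool" where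
  "subshift_of_finite_type R \<AA> \<longleftrightarrow> subshift \<AA> \<and> R > 0 \<and>
     \<AA> = {a. \<forall>z. pattern a z (lattice_box R) \<in> patterns \<AA> (lattice_box R)}"

definition cellular_automaton :: "(('n::finite, 'a) config \<Rightarrow> ('n, 'a) config) \<Rightarrow> bool" where
  "cellular_automaton \<Phi> \<longleftrightarrow> continuous_map config_topology config_topology \<Phi> \<and>
     (\<forall>v a. \<Phi> (shift v a) = shift v (\<Phi> a))"

definition has_radius :: "(('n::finite, 'a) config \<Rightarrow> ('n, 'a) config) \<Rightarrow> nat \<Rightarrow> bool" where
  "has_radius \<Phi> q \<longleftrightarrow> (\<exists>\<phi>. \<forall>a z. \<Phi> a z = \<phi> (pattern a z (lattice_box q)))"

text \<open>
  The set below is an initial segment of the naturals, so for a nonempty set the supremum in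
  \<^typ>\<open>enat\<close> is its maximum, or infinity. If even the letter at \<open>z\<close> does not
  occur in \<open>\<AA>\<close>, the value is \<open>0\<close>.
\<close>

definition admissibility_radius :: "('n::finite, 'a) config set \<Rightarrow> ('n, 'a) config \<Rightarrow> int ^ 'n \<Rightarrow> enat" where
  "admissibility_radius \<AA> a z =
     Sup {enat r | r. pattern a z (lattice_box r) \<in> patterns \<AA> (lattice_box r)}"

definition tilde :: "('n::finite, 'a) config set \<Rightarrow> ('n, 'a) config set" where
  "tilde \<AA> = {a. (SUP z. admissibility_radius \<AA> a z) = \<infinity>}"

definition good_set :: "('n::finite, 'a) config set \<Rightarrow> nat \<Rightarrow> ('n, 'a) config \<Rightarrow> (int ^ 'n) set" where
  "good_set \<AA> r a = {z. admissibility_radius \<AA> a z \<ge> enat r}"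

definition defective :: "('n::finite, 'a) config set \<Rightarrow> ('n, 'a) config \<Rightarrow> bool" where
  "defective \<AA> a \<longleftrightarrow> a \<in> tilde \<AA> - \<AA>"

definition persistent_defect ::
    "(('n::finite, 'a) config \<Rightarrow> ('n, 'a) config) \<Rightarrow> ('n, 'a) config set \<Rightarrow> ('n, 'a) config \<Rightarrow> bool" where
  "persistent_defect \<Phi> \<AA> a \<longleftrightarrow> (\<forall>t. defective \<AA> ((\<Phi> ^^ t) a))"


section \<open>Cubical chains of Euclidean space\<close>

text \<open>
  The cell \<open>(w, J)\<close> is the cube with lowest corner \<open>w\<close> and free directions
  \<open>J\<close>, that is, all points \<open>t\<close> with \<open>t\<^sub>i = w\<^sub>i\<close> for \<open>i \<notin> J\<close> and
  \<open>w\<^sub>i \<le> t\<^sub>i \<le> w\<^sub>i + 1\<close> for \<open>i \<in> J\<close>; its dimension is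
  \<open>card J\<close>. It is the translate by \<open>w\<close> of the cell at the origin whose set of
  constrained directions is \<open>I = - J\<close>.
\<close>

type_synonym 'n cell = "(int ^ 'n) \<times> 'n set"

definition cells :: "nat \<Rightarrow> 'n::finite cell set" where
  "cells d = {(w, J). card J = d}"

definition vertices :: "'n::finite cell \<Rightarrow> (int ^ 'n) set" where
  "vertices y = (case y of (w, J) \<Rightarrow>
     {v. \<forall>i. if i \<in> J then v $ i \<in> {w $ i, w $ i + 1} else v $ i = w $ i})"

definition translate_cell :: "int ^ 'n \<Rightarrow> 'n::finite cell \<Rightarrow> 'n cell" where
  "translate_cell z y = (case y of (w, J) \<Rightarrow> (w + z, J))"

definition cubical_chains :: "nat \<Rightarrow> ('n::finite cell \<Rightarrow>\<^sub>0 int) set" where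
  "cubical_chains d = {\<zeta>. Poly_Mapping.keys \<zeta> \<subseteq> cells d}"

definition translate_chain :: "int ^ 'n \<Rightarrow> ('n::finite cell \<Rightarrow>\<^sub>0 int) \<Rightarrow> ('n cell \<Rightarrow>\<^sub>0 int)" where
  "translate_chain z = frag_extend (\<lambda>y. frag_of (translate_cell z y))"

definition cell_boundary :: "'n::{finite,linorder} cell \<Rightarrow> ('n cell \<Rightarrow>\<^sub>0 int)" where
  "cell_boundary y = (case y of (w, J) \<Rightarrow>
     (\<Sum>j\<in>J. frag_cmul ((- 1) ^ card {k \<in> J. k < j})
               (frag_of (w + axis j 1, J - {j}) - frag_of (w, J - {j}))))"

definition cubical_boundary ::
    "('n::{finite,linorder} cell \<Rightarrow>\<^sub>0 int) \<Rightarrow> ('n cell \<Rightarrow>\<^sub>0 int)" where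
  "cubical_boundary = frag_extend cell_boundary"

definition additive_group :: "'g::ab_group_add monoid" where
  "additive_group = \<lparr>carrier = UNIV, monoid.mult = (+), one = 0\<rparr>"

text \<open>The additive extension to chains of a function given on cells.\<close>

definition chain_eval :: "('x \<Rightarrow> 'g::ab_group_add) \<Rightarrow> ('x \<Rightarrow>\<^sub>0 int) \<Rightarrow> 'g" where
  "chain_eval v \<zeta> =
     (\<Sum>y\<in>Poly_Mapping.keys \<zeta>. v y [^]\<^bsub>additive_group\<^esub> Poly_Mapping.lookup \<zeta> y)"


section \<open>Equivariant cocycles and poles\<close>

text \<open>The coefficient group is discrete, and so is the group of chains.\<close>

definition equivariant_cocycles ::
    "('n::{finite,linorder}, 'a) config set \<Rightarrow> nat \<Rightarrow>
     (('n cell \<Rightarrow>\<^sub>0 int) \<Rightarrow> ('n, 'a) config \<Rightarrow> 'g::ab_group_add) set" where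
  "equivariant_cocycles \<AA> d = {C.
     continuous_map
       (prod_topology (discrete_topology (cubical_chains d)) (subtopology config_topology \<AA>))
       (discrete_topology UNIV) (\<lambda>(\<zeta>, a). C \<zeta> a) \<and>
     (\<forall>\<zeta>\<in>cubical_chains d. \<forall>\<xi>\<in>cubical_chains d. \<forall>a\<in>\<AA>. C (\<zeta> + \<xi>) a = C \<zeta> a + C \<xi> a) \<and>
     (\<forall>\<zeta>\<in>cubical_chains d. \<forall>a\<in>\<AA>. \<forall>z. C \<zeta> (shift z a) = C (translate_chain z \<zeta>) a) \<and>
     (\<forall>\<beta>\<in>cubical_chains (Suc d). \<forall>a\<in>\<AA>. C (cubical_boundary \<beta>) a = 0)}"

definition cell_box :: "'n::finite set \<Rightarrow> nat \<Rightarrow> (int ^ 'n) set" where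
  "cell_box J r = {u \<in> lattice_box r. \<forall>i. i \<notin> J \<longrightarrow> u $ i < int r}"

definition is_local_rule ::
    "('n::finite, 'a) config set \<Rightarrow> nat \<Rightarrow> nat \<Rightarrow>
     (('n cell \<Rightarrow>\<^sub>0 int) \<Rightarrow> ('n, 'a) config \<Rightarrow> 'g) \<Rightarrow> ('n set \<Rightarrow> ('n, 'a) config \<Rightarrow> 'g) \<Rightarrow> bool" where
  "is_local_rule \<AA> d r C c \<longleftrightarrow>
     (\<forall>J z. card J = d \<longrightarrow> (\<forall>a\<in>\<AA>. C (frag_of (z, J)) a = c J (pattern a z (cell_box J r))))"

text \<open>
  \<open>\<zeta>\<close> witnesses a \<open>C\<close>-pole of range \<open>r\<close> in \<open>a\<close>: \<open>C\<close> is locally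
  determined with radius \<open>r\<close> (a local rule \<open>c\<close> exists), and
  \<open>C(\<zeta>, a)\<close>, computed by means of \<open>c\<close>, is nonzero. The choice of \<open>c\<close>
  is immaterial since only its values on patterns of \<open>\<AA>\<close> enter.
\<close>

definition pole_cycle ::
    "('n::{finite,linorder}, 'a) config set \<Rightarrow> nat \<Rightarrow>
     (('n cell \<Rightarrow>\<^sub>0 int) \<Rightarrow> ('n, 'a) config \<Rightarrow> 'g::ab_group_add) \<Rightarrow> nat \<Rightarrow> ('n, 'a) config \<Rightarrow>
     ('n cell \<Rightarrow>\<^sub>0 int) \<Rightarrow> bool" where
  "pole_cycle \<AA> d C r a \<zeta> \<longleftrightarrow>
     \<zeta> \<in> cubical_chains d \<and> cubical_boundary \<zeta> = 0 \<and>
     (\<forall>y\<in>Poly_Mapping.keys \<zeta>. vertices y \<subseteq> good_set \<AA> r a) \<and>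
     (\<exists>c. is_local_rule \<AA> d r C c \<and>
          chain_eval (\<lambda>(z, J). c J (pattern a z (cell_box J r))) \<zeta> \<noteq> 0)"

definition has_pole ::
    "('n::{finite,linorder}, 'a) config set \<Rightarrow> nat \<Rightarrow>
     (('n cell \<Rightarrow>\<^sub>0 int) \<Rightarrow> ('n, 'a) config \<Rightarrow> 'g::ab_group_add) \<Rightarrow> nat \<Rightarrow> ('n, 'a) config \<Rightarrow> bool" where
  "has_pole \<AA> d C r a \<longleftrightarrow> a \<in> tilde \<AA> \<and> (\<exists>\<zeta>. pole_cycle \<AA> d C r a \<zeta>)"

definition has_projective_pole ::
    "'g::ab_group_add itself \<Rightarrow> ('n::{finite,linorder}, 'a) config set \<Rightarrow> nat \<Rightarrow> ('n, 'a) config \<Rightarrow> bool" where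
  "has_projective_pole (T :: 'g itself) \<AA> d a \<longleftrightarrow>
     (\<exists>C :: ('n cell \<Rightarrow>\<^sub>0 int) \<Rightarrow> ('n, 'a) config \<Rightarrow> 'g.
        C \<in> equivariant_cocycles \<AA> d \<and> (\<forall>\<^sub>F r in sequentially. has_pole \<AA> d C r a))"

text \<open>
  Projective 0-poles that are detected by 0-cycles of augmentation zero. Every 0-chain is a
  0-cycle, so a nonzero constant 0-cocycle gives a 0-pole in every \<open>a \<in> tilde \<AA>\<close>,
  elements of \<open>\<AA>\<close> included; the condition on the augmentation excludes these.
\<close>

definition has_reduced_projective_0_pole ::
    "'g::ab_group_add itself \<Rightarrow> ('n::{finite,linorder}, 'a) config set \<Rightarrow> ('n, 'a) config \<Rightarrow> bool" where
  "has_reduced_projective_0_pole (T :: 'g itself) \<AA> a \<longleftrightarrow>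
     (\<exists>C :: ('n cell \<Rightarrow>\<^sub>0 int) \<Rightarrow> ('n, 'a) config \<Rightarrow> 'g.
        C \<in> equivariant_cocycles \<AA> 0 \<and>
        (\<forall>\<^sub>F r in sequentially. a \<in> tilde \<AA> \<and>
           (\<exists>\<zeta>. pole_cycle \<AA> 0 C r a \<zeta> \<and>
                (\<Sum>y\<in>Poly_Mapping.keys \<zeta>. Poly_Mapping.lookup \<zeta> y) = 0)))"


section \<open>Direct limits of sequences of abelian groups\<close>

primrec iterate_maps :: "(nat \<Rightarrow> 'b \<Rightarrow> 'b) \<Rightarrow> nat \<Rightarrow> nat \<Rightarrow> 'b \<Rightarrow> 'b" where
  "iterate_maps f r 0 x = x"
| "iterate_maps f r (Suc k) x = f (r + k) (iterate_maps f r k x)"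

definition transition :: "(nat \<Rightarrow> 'b \<Rightarrow> 'b) \<Rightarrow> nat \<Rightarrow> nat \<Rightarrow> 'b \<Rightarrow> 'b" where
  "transition f r t = iterate_maps f r (t - r)"

definition limit_relation ::
    "nat \<Rightarrow> (nat \<Rightarrow> 'b monoid) \<Rightarrow> (nat \<Rightarrow> 'b \<Rightarrow> 'b) \<Rightarrow> ((nat \<times> 'b) \<times> (nat \<times> 'b)) set" where
  "limit_relation R G f =
     {((r, x), (s, y)). r \<ge> R \<and> s \<ge> R \<and> x \<in> carrier (G r) \<and> y \<in> carrier (G s) \<and>
        (\<exists>t\<ge>max r s. transition f r t x = transition f s t y)}"

definition limit_class ::
    "nat \<Rightarrow> (nat \<Rightarrow> 'b monoid) \<Rightarrow> (nat \<Rightarrow> 'b \<Rightarrow> 'b) \<Rightarrow> nat \<Rightarrow> 'b \<Rightarrow> (nat \<times> 'b) set" where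
  "limit_class R G f r x = limit_relation R G f `` {(r, x)}"

text \<open>
  The limit of \<open>G R \<rightarrow> G (R + 1) \<rightarrow> \<dots>\<close>, where \<open>f r\<close> maps \<open>G r\<close> to
  \<open>G (r + 1)\<close>. In the product, and in \<open>limit_map\<close>, all members of the union coincide.
\<close>

definition direct_limit ::
    "nat \<Rightarrow> (nat \<Rightarrow> 'b monoid) \<Rightarrow> (nat \<Rightarrow> 'b \<Rightarrow> 'b) \<Rightarrow> (nat \<times> 'b) set monoid" where
  "direct_limit R G f =
     \<lparr>carrier = (SIGMA r:{R..}. carrier (G r)) // limit_relation R G f,
      monoid.mult = (\<lambda>A B. \<Union>(r, x)\<in>A. \<Union>(s, y)\<in>B.
        limit_class R G f (max r s)
          (transition f r (max r s) x \<otimes>\<^bsub>G (max r s)\<^esub> transition f s (max r s) y)),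
      one = limit_class R G f R \<one>\<^bsub>G R\<^esub>\<rparr>"

definition limit_map ::
    "nat \<Rightarrow> (nat \<Rightarrow> 'b monoid) \<Rightarrow> (nat \<Rightarrow> 'b \<Rightarrow> 'b) \<Rightarrow> nat \<Rightarrow> (nat \<Rightarrow> 'b \<Rightarrow> 'b) \<Rightarrow>
     (nat \<times> 'b) set \<Rightarrow> (nat \<times> 'b) set" where
  "limit_map R G f q h A = (\<Union>(r, x)\<in>A. limit_class R G f (r + q) (h r x))"


section \<open>Tile complexes and invariant cohomology\<close>

text \<open>
  \<open>(z, c, y)\<close> is the face \<open>y\<close> of the cube \<open>\<box>\<^sub>z c\<close>, a copy of
  \<open>z + [0,1]\<^sup>D\<close>. Gluing maps preserve the position \<open>y\<close> in Euclidean space, so every cell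
  of the tile complex inherits the orientation of its position.
\<close>

type_synonym ('n, 'a) tile_face = "(int ^ 'n) \<times> ('n, 'a) config \<times> 'n cell"

type_synonym ('n, 'a, 'g) cochain = "('n, 'a) tile_face set \<Rightarrow> 'g"

definition tile_faces :: "('n::finite, 'a) config set \<Rightarrow> nat \<Rightarrow> ('n, 'a) tile_face set" where
  "tile_faces \<AA> r = {(z, c, y). c \<in> patterns \<AA> (lattice_box r) \<and> vertices y \<subseteq> vertices (z, UNIV)}"

text \<open>
  The face \<open>y = (w, J)\<close> lies in the upper facet of \<open>\<box>\<^sub>z c\<close> orthogonal to
  direction \<open>i\<close> iff \<open>w\<^sub>i = z\<^sub>i + 1\<close>. The condition on \<open>c\<close> and
  \<open>c'\<close> is that \<open>c\<close> on \<open>{u. u\<^sub>i > - r}\<close> agrees, up to translation, with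
  \<open>c'\<close> on \<open>{u. u\<^sub>i < r}\<close>.
\<close>

definition glue_step ::
    "('n::finite, 'a) config set \<Rightarrow> nat \<Rightarrow> (('n, 'a) tile_face \<times> ('n, 'a) tile_face) set" where
  "glue_step \<AA> r = {((z, c, y), (z', c', y')).
     (z, c, y) \<in> tile_faces \<AA> r \<and> (z', c', y') \<in> tile_faces \<AA> r \<and> y' = y \<and>
     (\<exists>i. z' = z + axis i 1 \<and> fst y $ i = z $ i + 1 \<and>
          (\<forall>u\<in>lattice_box r. u $ i < int r \<longrightarrow> c (u + axis i 1) = c' u))}"

definition glue :: "('n::finite, 'a) config set \<Rightarrow> nat \<Rightarrow> (('n, 'a) tile_face \<times> ('n, 'a) tile_face) set" where
  "glue \<AA> r = (glue_step \<AA> r \<union> (glue_step \<AA> r)\<inverse>)\<^sup>* \<inter> tile_faces \<AA> r \<times> tile_faces \<AA> r"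

definition tile_cells :: "('n::finite, 'a) config set \<Rightarrow> nat \<Rightarrow> nat \<Rightarrow> ('n, 'a) tile_face set set" where
  "tile_cells \<AA> r d = {(z, c, y) \<in> tile_faces \<AA> r. y \<in> cells d} // glue \<AA> r"

definition tile_translate :: "int ^ 'n \<Rightarrow> ('n::finite, 'a) tile_face set \<Rightarrow> ('n, 'a) tile_face set" where
  "tile_translate x K = (\<lambda>(z, c, y). (z + x, c, translate_cell x y)) ` K"

definition inv_cochains ::
    "('n::finite, 'a) config set \<Rightarrow> nat \<Rightarrow> nat \<Rightarrow> ('n, 'a, 'g::ab_group_add) cochain set" where
  "inv_cochains \<AA> r d = {C. (\<forall>K. K \<notin> tile_cells \<AA> r d \<longrightarrow> C K = 0) \<and>
     (\<forall>x. \<forall>K\<in>tile_cells \<AA> r d. C (tile_translate x K) = C K)}"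

definition inv_cochain_group ::
    "('n::finite, 'a) config set \<Rightarrow> nat \<Rightarrow> nat \<Rightarrow> ('n, 'a, 'g::ab_group_add) cochain monoid" where
  "inv_cochain_group \<AA> r d =
     \<lparr>carrier = inv_cochains \<AA> r d, monoid.mult = (\<lambda>C C' K. C K + C' K), one = (\<lambda>K. 0)\<rparr>"

definition tile_coboundary ::
    "('n::{finite,linorder}, 'a) config set \<Rightarrow> nat \<Rightarrow> nat \<Rightarrow>
     ('n, 'a, 'g::ab_group_add) cochain \<Rightarrow> ('n, 'a, 'g) cochain" where
  "tile_coboundary \<AA> r d C = (\<lambda>K. if K \<in> tile_cells \<AA> r (Suc d)
     then (case SOME k. k \<in> K of (z, c, y) \<Rightarrow>
             chain_eval (\<lambda>y'. C (glue \<AA> r `` {(z, c, y')})) (cell_boundary y))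
     else 0)"

definition inv_cocycles ::
    "('n::{finite,linorder}, 'a) config set \<Rightarrow> nat \<Rightarrow> nat \<Rightarrow> ('n, 'a, 'g::ab_group_add) cochain set" where
  "inv_cocycles \<AA> r d = {C \<in> inv_cochains \<AA> r d. tile_coboundary \<AA> r d C = (\<lambda>K. 0)}"

definition inv_coboundaries ::
    "('n::{finite,linorder}, 'a) config set \<Rightarrow> nat \<Rightarrow> nat \<Rightarrow> ('n, 'a, 'g::ab_group_add) cochain set" where
  "inv_coboundaries \<AA> r d =
     (if d = 0 then {\<lambda>K. 0} else tile_coboundary \<AA> r (d - 1) ` inv_cochains \<AA> r (d - 1))"

definition tile_inv_cohomology ::
    "('n::{finite,linorder}, 'a) config set \<Rightarrow> nat \<Rightarrow> nat \<Rightarrow> ('n, 'a, 'g::ab_group_add) cochain set monoid" where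
  "tile_inv_cohomology \<AA> d r =
     (inv_cochain_group \<AA> r d)\<lparr>carrier := inv_cocycles \<AA> r d\<rparr> Mod inv_coboundaries \<AA> r d"

definition inv_cohomology_class ::
    "('n::{finite,linorder}, 'a) config set \<Rightarrow> nat \<Rightarrow> nat \<Rightarrow>
     ('n, 'a, 'g::ab_group_add) cochain \<Rightarrow> ('n, 'a, 'g) cochain set" where
  "inv_cohomology_class \<AA> d r C = inv_coboundaries \<AA> r d #>\<^bsub>inv_cochain_group \<AA> r d\<^esub> C"

text \<open>
  The pullback of a cochain of the complex of radius \<open>r\<close> along the cellular map from the
  complex of radius \<open>s\<close> that sends \<open>\<box>\<^sub>z c\<close> to \<open>\<box>\<^sub>z (\<psi> c)\<close>, and
  the map it induces on cohomology.
\<close>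

definition tile_pullback ::
    "('n::finite, 'a) config set \<Rightarrow> nat \<Rightarrow> nat \<Rightarrow> nat \<Rightarrow> (('n, 'a) config \<Rightarrow> ('n, 'a) config) \<Rightarrow>
     ('n, 'a, 'g::ab_group_add) cochain \<Rightarrow> ('n, 'a, 'g) cochain" where
  "tile_pullback \<AA> d s r \<psi> C = (\<lambda>K. if K \<in> tile_cells \<AA> s d
     then (case SOME k. k \<in> K of (z, c, y) \<Rightarrow> C (glue \<AA> r `` {(z, \<psi> c, y)}))
     else 0)"

definition cohomology_pullback ::
    "('n::{finite,linorder}, 'a) config set \<Rightarrow> nat \<Rightarrow> nat \<Rightarrow> nat \<Rightarrow> (('n, 'a) config \<Rightarrow> ('n, 'a) config) \<Rightarrow>
     ('n, 'a, 'g::ab_group_add) cochain set \<Rightarrow> ('n, 'a, 'g) cochain set" where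
  "cohomology_pullback \<AA> d s r \<psi> S =
     (\<Union>C\<in>S. inv_cohomology_class \<AA> d s (tile_pullback \<AA> d s r \<psi> C))"

definition restriction_map ::
    "('n::{finite,linorder}, 'a) config set \<Rightarrow> nat \<Rightarrow> nat \<Rightarrow>
     ('n, 'a, 'g::ab_group_add) cochain set \<Rightarrow> ('n, 'a, 'g) cochain set" where
  "restriction_map \<AA> d r = cohomology_pullback \<AA> d (Suc r) r (\<lambda>c. restrict c (lattice_box r))"

definition inv_cohomology ::
    "'g::ab_group_add itself \<Rightarrow> nat \<Rightarrow> ('n::{finite,linorder}, 'a) config set \<Rightarrow> nat \<Rightarrow>
     (nat \<times> ('n, 'a, 'g) cochain set) set monoid" where
  "inv_cohomology T R \<AA> d = direct_limit R (tile_inv_cohomology \<AA> d) (restriction_map \<AA> d)"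

definition inv_limit_class ::
    "nat \<Rightarrow> ('n::{finite,linorder}, 'a) config set \<Rightarrow> nat \<Rightarrow> nat \<Rightarrow>
     ('n, 'a, 'g::ab_group_add) cochain \<Rightarrow> (nat \<times> ('n, 'a, 'g) cochain set) set" where
  "inv_limit_class R \<AA> d r C =
     limit_class R (tile_inv_cohomology \<AA> d) (restriction_map \<AA> d) r (inv_cohomology_class \<AA> d r C)"

text \<open>
  If \<open>\<Phi>\<close> has radius \<open>q\<close> and \<open>c\<close> is a pattern on the box of radius
  \<open>r + q\<close>, then \<open>\<Phi> c\<close> on the box of radius \<open>r\<close> does not depend on the
  (here \<^const>\<open>undefined\<close>) values of \<open>c\<close> outside its domain.
\<close>

definition ca_tile_map ::
    "(('n::finite, 'a) config \<Rightarrow> ('n, 'a) config) \<Rightarrow> nat \<Rightarrow> ('n, 'a) config \<Rightarrow> ('n, 'a) config" where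
  "ca_tile_map \<Phi> r c = restrict (\<Phi> c) (lattice_box r)"

definition inv_cohomology_map ::
    "'g::ab_group_add itself \<Rightarrow> nat \<Rightarrow> ('n::{finite,linorder}, 'a) config set \<Rightarrow> nat \<Rightarrow>
     (('n, 'a) config \<Rightarrow> ('n, 'a) config) \<Rightarrow>
     (nat \<times> ('n, 'a, 'g) cochain set) set \<Rightarrow> (nat \<times> ('n, 'a, 'g) cochain set) set" where
  "inv_cohomology_map T R \<AA> d \<Phi> =
     (let q = SOME q. has_radius \<Phi> q
      in limit_map R (tile_inv_cohomology \<AA> d) (restriction_map \<AA> d) q
           (\<lambda>r. cohomology_pullback \<AA> d (r + q) r (ca_tile_map \<Phi> r)))"


section \<open>The cubical hull of a set of lattice points, and Ext\<close>

definition real_point :: "int ^ 'n \<Rightarrow> real ^ 'n::finite" where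
  "real_point z = (\<chi> i. real_of_int (z $ i))"

definition cubical_hull :: "(int ^ 'n::finite) set \<Rightarrow> (real ^ 'n) set" where
  "cubical_hull S = closure (real_point ` S \<union>
     (\<Union>z\<in>{z. vertices (z, UNIV) \<subseteq> S}. cbox (real_point z) (real_point z + 1)))"

definition hom_group :: "('x, 'c) monoid_scheme \<Rightarrow> ('y, 'e) monoid_scheme \<Rightarrow> ('x \<Rightarrow> 'y) monoid" where
  "hom_group A G =
     \<lparr>carrier = hom A G \<inter> extensional (carrier A),
      monoid.mult = (\<lambda>f g. \<lambda>x\<in>carrier A. f x \<otimes>\<^bsub>G\<^esub> g x),
      one = (\<lambda>x\<in>carrier A. \<one>\<^bsub>G\<^esub>)\<rparr>"

text \<open>
  The first Ext group of abelian groups, by means of the free resolution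
  \<open>0 \<rightarrow> K \<rightarrow> F \<rightarrow> A \<rightarrow> 0\<close>, where \<open>F\<close> is the free abelian group on the carrier of
  \<open>A\<close>: the cokernel of the restriction \<open>Hom(F, G) \<rightarrow> Hom(K, G)\<close>.
\<close>

definition relation_group :: "('x, 'c) monoid_scheme \<Rightarrow> ('x \<Rightarrow>\<^sub>0 int) monoid" where
  "relation_group A = (free_Abelian_group (carrier A))
     \<lparr>carrier := kernel (free_Abelian_group (carrier A)) A
        (\<lambda>\<zeta>. finprod A (\<lambda>x. x [^]\<^bsub>A\<^esub> Poly_Mapping.lookup \<zeta> x) (Poly_Mapping.keys \<zeta>))\<rparr>"

definition Ext :: "('x, 'c) monoid_scheme \<Rightarrow> ('y, 'e) monoid_scheme \<Rightarrow> (('x \<Rightarrow>\<^sub>0 int) \<Rightarrow> 'y) set monoid" where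
  "Ext A G = hom_group (relation_group A) G Mod
     ((\<lambda>f. restrict f (carrier (relation_group A))) ` hom (free_Abelian_group (carrier A)) G)"

end

theory Submission
  imports Defs
begin

text \<open>
  An equivariant cocycle on the subshift is locally determined, by compactness, and hence is the same
  thing as an invariant cocycle of a tile complex of sufficiently large radius. If \<open>\<Phi>\<close> acts
  surjectively on the limit of the invariant cohomology groups, then for each cocycle \<open>C\<close> there are a
  cocycle \<open>C'\<close> and a cochain \<open>b\<close> with \<open>C = \<Phi>\<^sup>*C' + \<delta>b\<close> at some finite radius, and so
  \<open>C(\<zeta>, a) = C'(\<zeta>, \<Phi> a) + b(\<partial>\<zeta>, a) = C'(\<zeta>, \<Phi> a)\<close> for each cycle \<open>\<zeta>\<close> in the
  region where \<open>a\<close> is admissible at that radius. The very same cycle therefore detects a pole of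
  \<open>\<Phi> a\<close>. A configuration in the subshift is good everywhere, and there every cycle (of augmentation
  zero, in dimension 0) bounds because the cubical complex of Euclidean space is acyclic; so a configuration
  with such a pole is defective.
\<close>

section \<open>Direct limits\<close>

text \<open>The obstacle is that a pole lives in a configuration outside the subshift, where a
  cocycle has no values. So every identity is carried by patterns: a cochain of the tile complex of
  radius \<open>s\<close> can be evaluated at a cell of any configuration whose
  \<open>s\<close>-pattern at the lowest corner of the cell is admissible, and at good cells of
  large enough range this returns the value of a local rule of the cocycle. An identity between
  cochains then holds verbatim wherever the configuration is good. Stokes' formula survives this
  reading because patterns of one configuration at neighbouring vertices overlap and hence give
  glued tiles; for this the vertices of a cell, not only its lowest corner, are taken to be good.
  Conversely, an invariant cocycle of any tile complex defines an equivariant cocycle, so what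
  \<open>\<Phi> a\<close> carries is again a pole. The new cocycle and all radii are fixed before
  the range, the configuration and the cycle: one cocycle serves all large ranges, as a projective
  pole requires. Keeping the cycle also keeps its augmentation, which matters in dimension
  0.\<close>

locale direct_system =
  fixes R :: nat and G :: "nat \<Rightarrow> 'b monoid" and f :: "nat \<Rightarrow> 'b \<Rightarrow> 'b"
  assumes comm: "R \<le> r \<Longrightarrow> comm_group (G r)"
    and hom: "R \<le> r \<Longrightarrow> f r \<in> hom (G r) (G (Suc r))"
begin

lemma transition_refl [simp]: "transition f r r x = x"
  by (simp add: transition_def)

lemma transition_Suc: "r \<le> t \<Longrightarrow> transition f r (Suc t) x = f t (transition f r t x)"
  by (simp add: transition_def Suc_diff_le)

lemma transition_trans:
  assumes "r \<le> s" "s \<le> t"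
  shows "transition f s t (transition f r s x) = transition f r t x"
  using assms(2)
proof (induction t rule: dec_induct)
  case (step t)
  then show ?case using assms(1) by (simp add: transition_Suc)
qed simp

lemma transition_hom:
  assumes "R \<le> r" "r \<le> t"
  shows "transition f r t \<in> hom (G r) (G t)"
  using assms(2)
proof (induction t rule: dec_induct)
  case base
  show ?case by (auto simp: hom_def)
next
  case (step t)
  have "f t \<circ> transition f r t \<in> hom (G r) (G (Suc t))"
    using step assms(1) by (intro hom_compose) (auto intro: hom)
  moreover have "transition f r (Suc t) = f t \<circ> transition f r t"
    using step by (auto simp: transition_Suc)
  ultimately show ?case by (simp only:)
qed

lemma transition_closed:
  "R \<le> r \<Longrightarrow> r \<le> t \<Longrightarrow> x \<in> carrier (G r) \<Longrightarrow> transition f r t x \<in> carrier (G t)"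
  using transition_hom by (meson hom_in_carrier)

lemma transition_mult:
  assumes "R \<le> r" "r \<le> t" "x \<in> carrier (G r)" "y \<in> carrier (G r)"
  shows "transition f r t (x \<otimes>\<^bsub>G r\<^esub> y) = transition f r t x \<otimes>\<^bsub>G t\<^esub> transition f r t y"
  using assms by (intro hom_mult transition_hom)

lemma transition_one:
  assumes "R \<le> r" "r \<le> t"
  shows "transition f r t \<one>\<^bsub>G r\<^esub> = \<one>\<^bsub>G t\<^esub>"
  using assms transition_hom comm comm_group.axioms(2) hom_one le_trans by metis

lemma transition_eq_mono:
  assumes "transition f r t x = transition f s t y" "r \<le> t" "s \<le> t" "t \<le> u"
  shows "transition f r u x = transition f s u y"
  using assms transition_trans by metis

abbreviation "base \<equiv> SIGMA r:{R..}. carrier (G r)"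
abbreviation "cls \<equiv> limit_class R G f"

lemma equiv_limit_relation: "equiv base (limit_relation R G f)"
proof (rule equivI)
  show "limit_relation R G f \<subseteq> base \<times> base"
    by (auto simp: limit_relation_def)
  show "refl_on base (limit_relation R G f)"
    by (rule refl_onI) (auto simp: limit_relation_def)
  show "sym (limit_relation R G f)"
    by (rule symI) (auto simp: limit_relation_def) 
  show "trans (limit_relation R G f)"
  proof (rule transI, clarify)
    fix r x s y t z
    assume 1: "((r, x), (s, y)) \<in> limit_relation R G f" and 2: "((s, y), (t, z)) \<in> limit_relation R G f"
    from 1 obtain u where u: "max r s \<le> u" "transition f r u x = transition f s u y"
      by (auto simp: limit_relation_def)
    from 2 obtain v where v: "max s t \<le> v" "transition f s v y = transition f t v z"
      by (auto simp: limit_relation_def)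
    have "transition f r (max u v) x = transition f t (max u v) z"
      using u v transition_eq_mono[of r u x s y "max u v"] transition_eq_mono[of s v y t z "max u v"]
      by auto
    moreover have "max r t \<le> max u v" using u v by auto
    ultimately show "((r, x), (t, z)) \<in> limit_relation R G f"
      using 1 2 unfolding limit_relation_def by blast
  qed
qed

lemma limit_class_eq_iff:
  assumes "R \<le> r" "R \<le> s" "x \<in> carrier (G r)" "y \<in> carrier (G s)"
  shows "cls r x = cls s y \<longleftrightarrow> (\<exists>t\<ge>max r s. transition f r t x = transition f s t y)"
  using eq_equiv_class_iff[OF equiv_limit_relation, of "(r, x)" "(s, y)"] assms
  by (simp add: limit_class_def limit_relation_def)

lemma limit_class_transition:
  assumes "R \<le> r" "r \<le> t" "x \<in> carrier (G r)"
  shows "cls t (transition f r t x) = cls r x"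
  using assms by (subst limit_class_eq_iff) (auto intro!: transition_closed exI[of _ t])

lemma limit_carrier: "carrier (direct_limit R G f) = {cls r x | r x. R \<le> r \<and> x \<in> carrier (G r)}"
  by (auto simp: direct_limit_def quotient_def limit_class_def)

lemma limit_carrierE:
  assumes "A \<in> carrier (direct_limit R G f)"
  obtains r x where "R \<le> r" "x \<in> carrier (G r)" "A = cls r x"
  using assms limit_carrier by auto

lemma limit_class_closed: "R \<le> r \<Longrightarrow> x \<in> carrier (G r) \<Longrightarrow> cls r x \<in> carrier (direct_limit R G f)"
  using limit_carrier by auto

lemma in_limit_class: "R \<le> r \<Longrightarrow> x \<in> carrier (G r) \<Longrightarrow> (r, x) \<in> cls r x"
  using equiv_limit_relation by (auto simp: limit_class_def limit_relation_def)

lemma limit_class_memD: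
  assumes "(s, y) \<in> cls r x"
  shows "R \<le> s" "y \<in> carrier (G s)" "cls s y = cls r x"
proof -
  have *: "((r, x), (s, y)) \<in> limit_relation R G f"
    using assms by (simp add: limit_class_def)
  show "R \<le> s" "y \<in> carrier (G s)"
    using * by (auto simp: limit_relation_def)
  show "cls s y = cls r x"
    using equiv_class_eq[OF equiv_limit_relation *] by (simp add: limit_class_def)
qed

text \<open>Beyond some stage \<open>v\<close> the representatives agree pairwise. This
  \<open>v\<close> also lies beyond both maxima, and the transition maps are homomorphisms, so the
  two products have the same image at \<open>v\<close>.\<close>

lemma limit_mult_wd:
  assumes "R \<le> r" "x \<in> carrier (G r)" "R \<le> s" "y \<in> carrier (G s)"
    and "R \<le> r'" "x' \<in> carrier (G r')" "R \<le> s'" "y' \<in> carrier (G s')"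
    and eq: "cls r x = cls r' x'" "cls s y = cls s' y'"
  shows "cls (max r s) (transition f r (max r s) x \<otimes>\<^bsub>G (max r s)\<^esub> transition f s (max r s) y)
     = cls (max r' s') (transition f r' (max r' s') x' \<otimes>\<^bsub>G (max r' s')\<^esub> transition f s' (max r' s') y')"
proof -
  interpret A: comm_group "G (max r s)" using assms by (intro comm) auto
  interpret B: comm_group "G (max r' s')" using assms by (intro comm) auto
  obtain t where t: "max r r' \<le> t" "transition f r t x = transition f r' t x'"
    using eq(1) assms limit_class_eq_iff by auto
  obtain u where u: "max s s' \<le> u" "transition f s u y = transition f s' u y'"
    using eq(2) assms limit_class_eq_iff by auto
  define v where "v = max t u"
  have 1: "transition f r v x = transition f r' v x'"
    using t transition_eq_mono[of r t x r' x' v] by (auto simp: v_def)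
  have 2: "transition f s v y = transition f s' v y'"
    using u transition_eq_mono[of s u y s' y' v] by (auto simp: v_def)
  have le: "max r s \<le> v" "max r' s' \<le> v" "R \<le> max r s" "R \<le> max r' s'"
    using t u assms by (auto simp: v_def)
  have cl: "transition f r (max r s) x \<in> carrier (G (max r s))" "transition f s (max r s) y \<in> carrier (G (max r s))"
     "transition f r' (max r' s') x' \<in> carrier (G (max r' s'))" "transition f s' (max r' s') y' \<in> carrier (G (max r' s'))"
    using assms by (auto intro!: transition_closed)
  show ?thesis
    using le cl 1 2
    by (subst limit_class_eq_iff) (auto simp: transition_mult transition_trans intro!: exI[of _ v])
qed

lemma limit_mult:
  assumes "R \<le> r" "x \<in> carrier (G r)" "R \<le> s" "y \<in> carrier (G s)"
  shows "cls r x \<otimes>\<^bsub>direct_limit R G f\<^esub> cls s y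
     = cls (max r s) (transition f r (max r s) x \<otimes>\<^bsub>G (max r s)\<^esub> transition f s (max r s) y)"
proof -
  have *: "cls (max r' s') (transition f r' (max r' s') x' \<otimes>\<^bsub>G (max r' s')\<^esub> transition f s' (max r' s') y')
     = cls (max r s) (transition f r (max r s) x \<otimes>\<^bsub>G (max r s)\<^esub> transition f s (max r s) y)"
    if "(r', x') \<in> cls r x" "(s', y') \<in> cls s y" for r' x' s' y'
    by (rule limit_mult_wd[OF limit_class_memD(1,2)[OF that(1)] limit_class_memD(1,2)[OF that(2)] assms
          limit_class_memD(3)[OF that(1)] limit_class_memD(3)[OF that(2)]])
  let ?X = "cls (max r s) (transition f r (max r s) x \<otimes>\<^bsub>G (max r s)\<^esub> transition f s (max r s) y)"
  \<comment> \<open>By well-definedness the double union is over a constant family with value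
    \<open>?X\<close>; both classes are nonempty, so the union is \<open>?X\<close>.\<close>
  have "cls r x \<otimes>\<^bsub>direct_limit R G f\<^esub> cls s y = (\<Union>p\<in>cls r x. \<Union>p'\<in>cls s y. ?X)"
    unfolding direct_limit_def monoid.simps
    by (rule SUP_cong[OF refl], clarify, rule SUP_cong[OF refl], clarify, rule *)
  moreover have "cls r x \<noteq> {}" "cls s y \<noteq> {}"
    using in_limit_class[OF assms(1,2)] in_limit_class[OF assms(3,4)] by auto
  ultimately show ?thesis by simp
qed

lemma limit_mult_same:
  assumes "R \<le> r" "x \<in> carrier (G r)" "y \<in> carrier (G r)"
  shows "cls r x \<otimes>\<^bsub>direct_limit R G f\<^esub> cls r y = cls r (x \<otimes>\<^bsub>G r\<^esub> y)"
  using limit_mult[OF assms(1,2) assms(1,3)] by simp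

lemma limit_one: "R \<le> r \<Longrightarrow> \<one>\<^bsub>direct_limit R G f\<^esub> = cls r \<one>\<^bsub>G r\<^esub>"
proof -
  assume r: "R \<le> r"
  interpret A: comm_group "G R" by (intro comm) auto
  show ?thesis
    using limit_class_transition[of R r "\<one>\<^bsub>G R\<^esub>"] transition_one[of R r] r
    by (simp add: direct_limit_def)
qed

text \<open>Since elements can be pushed to a common stage, a law that involves two elements of the
  limit reduces to the same law in a single \<open>G r\<close>.\<close>

lemma limit_carrier_common:
  assumes "A \<in> carrier (direct_limit R G f)" "B \<in> carrier (direct_limit R G f)"
  obtains r x y where "R \<le> r" "x \<in> carrier (G r)" "y \<in> carrier (G r)" "A = cls r x" "B = cls r y"
proof -
  obtain r x s y where *: "R \<le> r" "x \<in> carrier (G r)" "A = cls r x" "R \<le> s" "y \<in> carrier (G s)" "B = cls s y"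
    using assms limit_carrierE by metis
  show thesis
    using * limit_class_transition[of r "max r s" x] limit_class_transition[of s "max r s" y]
      transition_closed[of r "max r s" x] transition_closed[of s "max r s" y]
    by (intro that[of "max r s" "transition f r (max r s) x" "transition f s (max r s) y"]) auto
qed

lemma limit_carrier_common3:
  assumes "A \<in> carrier (direct_limit R G f)" "B \<in> carrier (direct_limit R G f)" "C \<in> carrier (direct_limit R G f)"
  obtains r x y z where "R \<le> r" "x \<in> carrier (G r)" "y \<in> carrier (G r)" "z \<in> carrier (G r)"
    "A = cls r x" "B = cls r y" "C = cls r z"
proof -
  obtain r x y where *: "R \<le> r" "x \<in> carrier (G r)" "y \<in> carrier (G r)" "A = cls r x" "B = cls r y"
    using assms limit_carrier_common by metis
  obtain s z where **: "R \<le> s" "z \<in> carrier (G s)" "C = cls s z"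
    using assms limit_carrierE by metis
  let ?t = "max r s"
  show thesis
    using * ** limit_class_transition[of r ?t x] limit_class_transition[of r ?t y] limit_class_transition[of s ?t z]
      transition_closed[of r ?t x] transition_closed[of r ?t y] transition_closed[of s ?t z]
    by (intro that[of ?t "transition f r ?t x" "transition f r ?t y" "transition f s ?t z"]) auto
qed

lemma comm_group_direct_limit: "comm_group (direct_limit R G f)"
proof (rule comm_groupI)
  let ?L = "direct_limit R G f"
  have one: "\<one>\<^bsub>?L\<^esub> = cls r \<one>\<^bsub>G r\<^esub>" if "R \<le> r" for r
    using that by (rule limit_one)
  have one_mem: "\<one>\<^bsub>G r\<^esub> \<in> carrier (G r)" if "R \<le> r" for r
    using comm[OF that] by (simp add: comm_group_def comm_monoid_def monoid.one_closed)
  show "\<one>\<^bsub>?L\<^esub> \<in> carrier ?L"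
    using one[of R] limit_class_closed one_mem by auto
  fix A B assume A: "A \<in> carrier ?L" and B: "B \<in> carrier ?L"
  obtain r x y where *: "R \<le> r" "x \<in> carrier (G r)" "y \<in> carrier (G r)" "A = cls r x" "B = cls r y"
    using A B limit_carrier_common by metis
  interpret G: comm_group "G r" using * comm by auto
  show "A \<otimes>\<^bsub>?L\<^esub> B \<in> carrier ?L"
    using * by (auto simp: limit_mult_same intro!: limit_class_closed)
  show "A \<otimes>\<^bsub>?L\<^esub> B = B \<otimes>\<^bsub>?L\<^esub> A"
    using * by (auto simp: limit_mult_same G.m_comm)
  show "\<one>\<^bsub>?L\<^esub> \<otimes>\<^bsub>?L\<^esub> A = A"
    using * by (auto simp: limit_mult_same one[of r])
  have "cls r (inv\<^bsub>G r\<^esub> x) \<otimes>\<^bsub>?L\<^esub> A = \<one>\<^bsub>?L\<^esub>"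
    using * by (auto simp: limit_mult_same one[of r])
  then show "\<exists>A'\<in>carrier ?L. A' \<otimes>\<^bsub>?L\<^esub> A = \<one>\<^bsub>?L\<^esub>"
    using * by (intro bexI[of _ "cls r (inv\<^bsub>G r\<^esub> x)"] limit_class_closed) auto
  fix C assume C: "C \<in> carrier ?L"
  obtain s x y z where **: "R \<le> s" "x \<in> carrier (G s)" "y \<in> carrier (G s)" "z \<in> carrier (G s)"
    "A = cls s x" "B = cls s y" "C = cls s z"
    using limit_carrier_common3[OF A B C] by metis
  interpret G': comm_group "G s" using ** comm by auto
  show "A \<otimes>\<^bsub>?L\<^esub> B \<otimes>\<^bsub>?L\<^esub> C = A \<otimes>\<^bsub>?L\<^esub> (B \<otimes>\<^bsub>?L\<^esub> C)"
    using ** by (auto simp: limit_mult_same G'.m_assoc)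
qed

end

text \<open>The maps raise the stage by \<open>q\<close> because a cellular automaton of radius
  \<open>q\<close> needs a margin of width \<open>q\<close> to compute a pattern. Compatibility is
  asked for one step of the system; longer transitions follow by induction.\<close>

locale direct_system_endo = direct_system R G f
  for R and G :: "nat \<Rightarrow> 'b monoid" and f +
  fixes q :: nat and h :: "nat \<Rightarrow> 'b \<Rightarrow> 'b"
  assumes h_hom: "R \<le> r \<Longrightarrow> h r \<in> hom (G r) (G (r + q))"
    and h_comm: "R \<le> r \<Longrightarrow> x \<in> carrier (G r) \<Longrightarrow> h (Suc r) (f r x) = f (r + q) (h r x)"
begin

lemma h_closed: "R \<le> r \<Longrightarrow> x \<in> carrier (G r) \<Longrightarrow> h r x \<in> carrier (G (r + q))"
  by (rule hom_in_carrier[OF h_hom])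

lemma h_transition:
  assumes "R \<le> r" "r \<le> t" "x \<in> carrier (G r)"
  shows "h t (transition f r t x) = transition f (r + q) (t + q) (h r x)"
  using assms(2)
proof (induction t rule: dec_induct)
  case (step t)
  then show ?case
    using assms h_comm[of t "transition f r t x"] transition_closed[of r t x]
    by (simp add: transition_Suc)
qed simp

lemma limit_map_class:
  assumes "R \<le> r" "x \<in> carrier (G r)"
  shows "limit_map R G f q h (cls r x) = cls (r + q) (h r x)"
proof -
  have "cls (s + q) (h s y) = cls (r + q) (h r x)" if "(s, y) \<in> cls r x" for s y
  proof -
    note * = limit_class_memD[OF that]
    then obtain t where t: "max s r \<le> t" "transition f s t y = transition f r t x"
      using limit_class_eq_iff[of s r y x] assms by auto
    have "transition f (s + q) (t + q) (h s y) = transition f (r + q) (t + q) (h r x)"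
      using t * assms h_transition[of s t y] h_transition[of r t x] by simp
    then show ?thesis
      using t * assms h_closed by (subst limit_class_eq_iff) (auto intro!: exI[of _ "t + q"])
  qed
  then have "limit_map R G f q h (cls r x) = (\<Union>p\<in>cls r x. cls (r + q) (h r x))"
    unfolding limit_map_def by (intro SUP_cong[OF refl]) auto
  then show ?thesis
    using in_limit_class[OF assms] by auto
qed

lemma limit_map_hom: "limit_map R G f q h \<in> hom (direct_limit R G f) (direct_limit R G f)"
proof (rule homI)
  fix A assume "A \<in> carrier (direct_limit R G f)"
  then obtain r x where "R \<le> r" "x \<in> carrier (G r)" "A = cls r x" by (rule limit_carrierE)
  then show "limit_map R G f q h A \<in> carrier (direct_limit R G f)"
    by (auto simp: limit_map_class intro!: limit_class_closed h_closed)
next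
  fix A B assume A: "A \<in> carrier (direct_limit R G f)" and B: "B \<in> carrier (direct_limit R G f)"
  obtain r x y where *: "R \<le> r" "x \<in> carrier (G r)" "y \<in> carrier (G r)" "A = cls r x" "B = cls r y"
    using A B limit_carrier_common by metis
  interpret G: comm_group "G r" using * comm by auto
  show "limit_map R G f q h (A \<otimes>\<^bsub>direct_limit R G f\<^esub> B)
     = limit_map R G f q h A \<otimes>\<^bsub>direct_limit R G f\<^esub> limit_map R G f q h B"
    using * hom_mult[OF h_hom[OF *(1)] *(2,3)] by (simp add: limit_mult_same limit_map_class h_closed)
qed

end

section \<open>Cubical chains\<close>

abbreviation zpow :: "'g::ab_group_add \<Rightarrow> int \<Rightarrow> 'g" where
  "zpow x n \<equiv> x [^]\<^bsub>additive_group\<^esub> n"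

lemma comm_group_additive_group: "comm_group (additive_group :: 'g::ab_group_add monoid)"
proof (rule comm_groupI)
  fix x :: 'g
  show "\<exists>y\<in>carrier additive_group. y \<otimes>\<^bsub>additive_group\<^esub> x = \<one>\<^bsub>additive_group\<^esub>"
    by (rule bexI[of _ "- x"]) (simp_all add: additive_group_def)
qed (simp_all add: additive_group_def ac_simps)

text \<open>The rewrites undo the multiplicative notation of \<open>additive_group\<close>: products
  become sums and powers become multiples, so \<open>zpow x n\<close> is n times
  \<open>x\<close>.\<close>

interpretation AG: comm_group "additive_group :: 'g::ab_group_add monoid"
  rewrites "carrier (additive_group :: 'g monoid) = UNIV"
    and "\<one>\<^bsub>(additive_group :: 'g monoid)\<^esub> = 0"
    and "\<And>x y. x \<otimes>\<^bsub>(additive_group :: 'g monoid)\<^esub> y = x + y"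
  by (rule comm_group_additive_group) (simp_all add: additive_group_def)

lemma inv_additive_group [simp]: "inv\<^bsub>additive_group\<^esub> x = - (x :: 'g::ab_group_add)"
  by (rule AG.inv_equality) auto

lemma one_additive_group [simp]: "\<one>\<^bsub>additive_group\<^esub> = (0 :: 'g::ab_group_add)"
  by (simp add: additive_group_def)

lemma zpow_0 [simp]: "zpow x 0 = 0"
  by simp

lemma zpow_add: "zpow x (m + n) = zpow x m + zpow x n"
  using AG.int_pow_mult[of x m n] by simp

lemma zpow_minus: "zpow x (- n) = - zpow x n"
  using AG.int_pow_neg[of x n] by simp

lemma zpow_1 [simp]: "zpow x 1 = x"
  using AG.int_pow_1[of x] by simp

lemma zpow_plus: "zpow (x + y) n = zpow x n + zpow y n"
  using AG.int_pow_distrib[of x y n] by simp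

lemma zpow_zero [simp]: "zpow 0 n = 0"
  using AG.int_pow_one[of n] by simp

lemma zpow_uminus: "zpow (- x) n = - zpow x n"
  using zpow_plus[of x "- x" n] by (simp add: eq_neg_iff_add_eq_0 add.commute)

lemma zpow_int_one [simp]: "zpow (1::int) n = n"
proof (induction n rule: int_induct[of _ 0])
  case (step1 i) then show ?case by (simp add: zpow_add)
next
  case (step2 i) then show ?case using zpow_add[of "1::int" i "-1"] by (simp add: zpow_minus)
qed simp

text \<open>Padding with zero coefficients lets chains with different supports be summed over one
  index set.\<close>

lemma chain_eval_superset:
  assumes "finite S" "Poly_Mapping.keys \<zeta> \<subseteq> S"
  shows "chain_eval v \<zeta> = (\<Sum>y\<in>S. zpow (v y) (Poly_Mapping.lookup \<zeta> y))"
  unfolding chain_eval_def using assms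
  by (intro sum.mono_neutral_left) (auto simp: in_keys_iff)

lemma chain_eval_0 [simp]: "chain_eval v 0 = 0"
  by (simp add: chain_eval_def)

lemma chain_eval_of [simp]: "chain_eval v (frag_of y) = v y"
  by (simp add: chain_eval_def)

lemma chain_eval_cong: "(\<And>y. y \<in> Poly_Mapping.keys \<zeta> \<Longrightarrow> v y = v' y) \<Longrightarrow> chain_eval v \<zeta> = chain_eval v' \<zeta>"
  by (simp add: chain_eval_def)

lemma chain_eval_add: "chain_eval v (a + b) = chain_eval v a + chain_eval v b"
proof -
  let ?S = "Poly_Mapping.keys a \<union> Poly_Mapping.keys b"
  show ?thesis
    using keys_add[of a b]
    by (simp add: chain_eval_superset[of ?S] lookup_add zpow_add sum.distrib)
qed

lemma chain_eval_minus: "chain_eval v (- a) = - chain_eval v a"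
  using chain_eval_add[of v a "- a"] by (simp add: eq_neg_iff_add_eq_0 add.commute)

lemma chain_eval_diff: "chain_eval v (a - b) = chain_eval v a - chain_eval v b"
  using chain_eval_add[of v a "- b"] by (simp add: chain_eval_minus)

lemma chain_eval_sum: "chain_eval v (sum g I) = (\<Sum>i\<in>I. chain_eval v (g i))"
  by (induction I rule: infinite_finite_induct) (auto simp: chain_eval_add)

lemma chain_eval_cmul: "chain_eval v (frag_cmul n a) = zpow (chain_eval v a) n"
proof (induction n rule: int_induct[of _ 0])
  case (step1 i) then show ?case by (simp add: frag_cmul_distrib chain_eval_add zpow_add)
next
  case (step2 i)
  then show ?case using zpow_add[of "chain_eval v a" i "-1"]
    by (simp add: frag_cmul_diff_distrib chain_eval_diff zpow_minus)
qed simp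

text \<open>Transposition of a linear map of chains. For \<open>g\<close> the boundary of a cell,
  evaluation on a boundary becomes evaluation of a coboundary, which is the source of Stokes'
  formula below.\<close>

lemma chain_eval_extend: "chain_eval v (frag_extend g \<zeta>) = chain_eval (\<lambda>y. chain_eval v (g y)) \<zeta>"
  by (simp add: frag_extend_def chain_eval_sum chain_eval_cmul) (simp add: chain_eval_def)

lemma chain_eval_fun_add: "chain_eval (\<lambda>y. v y + v' y) \<zeta> = chain_eval v \<zeta> + chain_eval v' \<zeta>"
  by (simp add: chain_eval_def zpow_plus sum.distrib)

lemma chain_eval_fun_uminus: "chain_eval (\<lambda>y. - v y) \<zeta> = - chain_eval v \<zeta>"
  by (simp add: chain_eval_def zpow_uminus sum_negf)

lemma chain_eval_fun_zero [simp]: "chain_eval (\<lambda>y. 0) \<zeta> = 0"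
  by (simp add: chain_eval_def)

text \<open>The augmentation as an instance of \<open>chain_eval\<close>, whose additivity it
  thereby inherits.\<close>

lemma chain_eval_one: "chain_eval (\<lambda>y. 1::int) \<zeta> = (\<Sum>y\<in>Poly_Mapping.keys \<zeta>. Poly_Mapping.lookup \<zeta> y)"
  by (simp add: chain_eval_def)

lemma frag_cmul_diff: "frag_cmul n (a - b) = frag_cmul n a - frag_cmul n b"
  by (simp add: poly_mapping_eqI lookup_minus right_diff_distrib)

lemma frag_additive_sum:
  assumes "F 0 = 0" "\<And>x y. F (x + y) = F x + F y"
  shows "F (sum g I) = (\<Sum>i\<in>I. F (g i))"
  using assms by (induction I rule: infinite_finite_induct) auto

subsection \<open>The boundary\<close>

text \<open>The count ignores \<open>j\<close> itself, so one symbol serves both for removing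
  \<open>j\<close> from \<open>J\<close> and for inserting it.\<close>

definition cell_sign :: "'n::linorder \<Rightarrow> 'n set \<Rightarrow> int" where
  "cell_sign j J = (- 1) ^ card {k \<in> J. k < j}"

lemma cell_boundary_eq:
  "cell_boundary (w, J) = (\<Sum>j\<in>J. frag_cmul (cell_sign j J)
     (frag_of (w + axis j 1, J - {j}) - frag_of (w, J - {j})))"
  by (simp add: cell_boundary_def cell_sign_def)

lemma cell_sign_square [simp]: "cell_sign j J * cell_sign j J = 1"
  by (simp add: cell_sign_def flip: power_mult_distrib)

lemma cell_sign_remove_self [simp]: "cell_sign j (J - {j}) = cell_sign j J"
  unfolding cell_sign_def by (rule arg_cong[where f="\<lambda>A. (- 1) ^ card A"]) auto

lemma cell_sign_insert_self [simp]: "cell_sign j (insert j J) = cell_sign j J"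
  unfolding cell_sign_def by (rule arg_cong[where f="\<lambda>A. (- 1) ^ card A"]) auto

lemma cell_sign_insert:
  fixes J :: "'n::{finite,linorder} set"
  assumes "i \<notin> J"
  shows "cell_sign j (insert i J) = (if i < j then - cell_sign j J else cell_sign j J)"
proof (cases "i < j")
  case True
  then have "{k \<in> insert i J. k < j} = insert i {k \<in> J. k < j}" by auto
  then show ?thesis using True assms by (simp add: cell_sign_def)
next
  case False
  then have "{k \<in> insert i J. k < j} = {k \<in> J. k < j}" by auto
  then show ?thesis using False by (simp add: cell_sign_def)
qed

lemma cell_sign_remove:
  fixes J :: "'n::{finite,linorder} set"
  assumes "i \<in> J"
  shows "cell_sign j (J - {i}) = (if i < j then - cell_sign j J else cell_sign j J)"
  using cell_sign_insert[of i "J - {i}" j] assms by (auto simp: insert_absorb split: if_splits)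

text \<open>Removing \<open>j\<close> flips the sign of \<open>i\<close> only if
  \<open>j < i\<close>, and removing \<open>i\<close> flips that of \<open>j\<close> only if
  \<open>i < j\<close>; exactly one of the two occurs.\<close>

lemma cell_sign_anticommute:
  fixes J :: "'n::{finite,linorder} set"
  assumes "i \<in> J" "j \<in> J" "i \<noteq> j"
  shows "cell_sign j J * cell_sign i (J - {j}) = - (cell_sign i J * cell_sign j (J - {i}))"
  using assms by (cases "i < j") (auto simp: cell_sign_remove)

lemma cubical_boundary_of [simp]: "cubical_boundary (frag_of y) = cell_boundary y"
  by (simp add: cubical_boundary_def)

lemma cubical_boundary_0 [simp]: "cubical_boundary 0 = 0"
  by (simp add: cubical_boundary_def)

lemma cubical_boundary_add: "cubical_boundary (a + b) = cubical_boundary a + cubical_boundary b"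
  by (simp add: cubical_boundary_def frag_extend_add)

lemma cubical_boundary_diff: "cubical_boundary (a - b) = cubical_boundary a - cubical_boundary b"
  by (simp add: cubical_boundary_def frag_extend_diff)

lemma cubical_boundary_cmul: "cubical_boundary (frag_cmul n a) = frag_cmul n (cubical_boundary a)"
  by (simp add: cubical_boundary_def frag_extend_cmul)

lemma cubical_boundary_sum: "cubical_boundary (sum g I) = (\<Sum>i\<in>I. cubical_boundary (g i))"
  by (rule frag_additive_sum) (simp_all add: cubical_boundary_add)

lemma boundary_cell_boundary: "cubical_boundary (cell_boundary (w, J)) = 0"
proof -
  \<comment> \<open>The four faces of codimension two that arise from removing \<open>j\<close> and
    then \<open>k\<close>, with their sign. Exchanging \<open>j\<close> and \<open>k\<close> keeps
    the faces and flips the sign.\<close>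
  define f where "f j k = frag_cmul (cell_sign j J * cell_sign k (J - {j}))
    (frag_of (w + axis j 1 + axis k 1, J - {j} - {k}) - frag_of (w + axis j 1, J - {j} - {k})
     - (frag_of (w + axis k 1, J - {j} - {k}) - frag_of (w, J - {j} - {k})))" for j k
  have anti: "f k j = - f j k" if "j \<in> J" "k \<in> J" "j \<noteq> k" for j k
  proof -
    have "J - {j} - {k} = J - {k} - {j}" by auto
    then show ?thesis
      unfolding f_def using cell_sign_anticommute[OF that]
      by (simp add: algebra_simps)
  qed
  have "cubical_boundary (cell_boundary (w, J)) = (\<Sum>j\<in>J. \<Sum>k\<in>J - {j}. f j k)"
    by (simp add: cell_boundary_eq cubical_boundary_sum cubical_boundary_cmul cubical_boundary_diff
        frag_cmul_sum f_def frag_cmul_diff frag_cmul_distrib2 sum.distrib sum_subtractf algebra_simps)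
  also have "\<dots> = (\<Sum>j\<in>J. \<Sum>k\<in>J. if j = k then 0 else f j k)"
    by (intro sum.cong refl sum.mono_neutral_cong_left) auto
  finally have 1: "cubical_boundary (cell_boundary (w, J)) = (\<Sum>j\<in>J. \<Sum>k\<in>J. if j = k then 0 else f j k)" .
  have "(\<Sum>j\<in>J. \<Sum>k\<in>J. if j = k then 0 else f j k) = (\<Sum>j\<in>J. \<Sum>k\<in>J. if k = j then 0 else f k j)"
    by (rule sum.swap)
  also have "\<dots> = (\<Sum>j\<in>J. \<Sum>k\<in>J. - (if j = k then 0 else f j k))"
  proof (intro sum.cong refl)
    fix j k assume "j \<in> J" "k \<in> J"
    then show "(if k = j then 0 else f k j) = - (if j = k then 0 else f j k)"
      using anti[of j k] by auto
  qed
  also have "\<dots> = - (\<Sum>j\<in>J. \<Sum>k\<in>J. if j = k then 0 else f j k)"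
    by (simp only: sum_negf)
  finally have 2: "(\<Sum>j\<in>J. \<Sum>k\<in>J. if j = k then 0 else f j k) = - (\<Sum>j\<in>J. \<Sum>k\<in>J. if j = k then 0 else f j k)" .
  \<comment> \<open>Antisymmetry yields only X = -X; integer coefficients have no 2-torsion.\<close>
  have "X = 0" if "X = - X" for X :: "'c \<Rightarrow>\<^sub>0 int"
  proof (rule poly_mapping_eqI)
    fix k have "Poly_Mapping.lookup X k = Poly_Mapping.lookup (- X) k" using that by simp
    then show "Poly_Mapping.lookup X k = Poly_Mapping.lookup 0 k" by simp
  qed
  from this[OF 2] 1 show ?thesis by simp
qed

lemma boundary_boundary: "cubical_boundary (cubical_boundary a) = 0"
proof -
  have "cubical_boundary (cubical_boundary a) = 0" if "Poly_Mapping.keys a \<subseteq> UNIV"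
    using that by (induction a rule: frag_induction) (auto simp: cubical_boundary_diff boundary_cell_boundary)
  then show ?thesis by simp
qed

lemma keys_cell_boundary:
  "Poly_Mapping.keys (cell_boundary (w, J)) \<subseteq> (\<Union>j\<in>J. {(w + axis j 1, J - {j}), (w, J - {j})})"
proof -
  have "Poly_Mapping.keys (frag_cmul c (frag_of x - frag_of y)) \<subseteq> {x, y}" for c and x y :: "'a cell"
    using keys_cmul[of c "frag_of x - frag_of y"] keys_diff[of "frag_of x" "frag_of y"]
    by (auto simp: keys_frag_of)
  then show ?thesis
    unfolding cell_boundary_eq by (rule order_trans[OF keys_sum UN_mono[OF order_refl]])
qed

lemma keys_cell_boundaryE:
  assumes "y \<in> Poly_Mapping.keys (cell_boundary (w, J))"
  obtains j where "j \<in> J" "y = (w + axis j 1, J - {j})" | j where "j \<in> J" "y = (w, J - {j})"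
  using assms keys_cell_boundary[of w J] by blast

lemma cell_boundary_cubical_chains: "card J = Suc d \<Longrightarrow> cell_boundary (w, J) \<in> cubical_chains d"
  using keys_cell_boundary[of w J] by (fastforce simp: cubical_chains_def cells_def)

subsection \<open>Acyclicity of the cubical decomposition of Euclidean space\<close>

text \<open>The discrete integral of \<open>g\<close> from 0 to \<open>n\<close>, counted negatively
  for \<open>n < 0\<close>. The recursion \<open>oriented_sum_Suc\<close> thus holds over all
  integers, as is needed for coordinates of either sign.\<close>

definition oriented_sum :: "(int \<Rightarrow> 'g::ab_group_add) \<Rightarrow> int \<Rightarrow> 'g" where
  "oriented_sum g n = sum g {0..<n} - sum g {n..<0}"

lemma oriented_sum_0 [simp]: "oriented_sum g 0 = 0"
  by (simp add: oriented_sum_def)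

lemma oriented_sum_Suc: "oriented_sum g (n + 1) = oriented_sum g n + g n"
proof (cases "0 \<le> n")
  case True
  then have "{0..<n + 1} = insert n {0..<n}" by auto
  then show ?thesis using True by (simp add: oriented_sum_def)
next
  case False
  then have "{n..<0} = insert n {n + 1..<0}" by auto
  then show ?thesis using False by (simp add: oriented_sum_def)
qed

lemma oriented_sum_pred: "oriented_sum g (n - 1) = oriented_sum g n - g (n - 1)"
  using oriented_sum_Suc[of g "n - 1"] by simp

lemma oriented_sum_telescope: "oriented_sum (\<lambda>k. g (k + 1) - g k) n = g n - g 0"
proof (induction n rule: int_induct[of _ 0])
  case (step1 i) then show ?case by (simp add: oriented_sum_Suc)
next
  case (step2 i)
  then show ?case by (simp add: oriented_sum_pred)
qed simp

lemma oriented_sum_additive: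
  assumes "F 0 = 0" "\<And>x y. F (x + y) = F x + F y"
  shows "F (oriented_sum g n) = oriented_sum (\<lambda>k. F (g k)) n"
proof (induction n rule: int_induct[of _ 0])
  case base show ?case using assms by simp
next
  case (step1 i) then show ?case using assms by (simp add: oriented_sum_Suc)
next
  case (step2 i)
  have "F (x - y) = F x - F y" for x y
    using assms(2)[of "x - y" y] by simp
  then show ?case using step2 by (simp add: oriented_sum_pred)
qed

lemma oriented_sum_add: "oriented_sum (\<lambda>k. g k + h k) n = oriented_sum g n + oriented_sum h n"
  by (simp add: oriented_sum_def sum.distrib)

lemma oriented_sum_diff: "oriented_sum (\<lambda>k. g k - h k) n = oriented_sum g n - oriented_sum h n"
  by (simp add: oriented_sum_def sum_subtractf)

lemma oriented_sum_sum: "oriented_sum (\<lambda>k. \<Sum>j\<in>J. g j k) n = (\<Sum>j\<in>J. oriented_sum (g j) n)"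
  by (induction J rule: infinite_finite_induct) (auto simp: oriented_sum_add, (simp add: oriented_sum_def)+)

lemma oriented_sum_cmul: "oriented_sum (\<lambda>k. frag_cmul c (g k)) n = frag_cmul c (oriented_sum g n)"
  by (rule oriented_sum_additive[symmetric]) (simp_all add: frag_cmul_distrib2)

definition set_coord :: "int ^ 'n \<Rightarrow> 'n::finite \<Rightarrow> int \<Rightarrow> int ^ 'n" where
  "set_coord w i k = (\<chi> j. if j = i then k else w $ j)"

lemma set_coord_nth: "set_coord w i k $ j = (if j = i then k else w $ j)"
  by (simp add: set_coord_def)

lemma set_coord_add_axis: "j \<noteq> i \<Longrightarrow> set_coord (w + axis j 1) i k = set_coord w i k + axis j 1"
  by (auto simp: vec_eq_iff set_coord_nth axis_def)

lemma set_coord_add_axis_self: "set_coord (w + axis i 1) i k = set_coord w i k"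
  by (auto simp: vec_eq_iff set_coord_nth axis_def)

lemma set_coord_id [simp]: "set_coord w i (w $ i) = w"
  by (auto simp: vec_eq_iff set_coord_nth)

lemma set_coord_plus_axis: "set_coord w i k + axis i 1 = set_coord w i (k + 1)"
  by (auto simp: vec_eq_iff set_coord_nth axis_def)

text \<open>The chain map induced by projecting coordinate \<open>i\<close> to 0. A cell that
  extends in direction \<open>i\<close> is flattened to lower dimension, hence the value 0.\<close>

definition collapse_cell :: "'n::finite \<Rightarrow> 'n cell \<Rightarrow> ('n cell \<Rightarrow>\<^sub>0 int)" where
  "collapse_cell i y = (case y of (w, J) \<Rightarrow> if i \<in> J then 0 else frag_of (set_coord w i 0, J))"

text \<open>The prism operator: the cells swept when a cell moves from coordinate 0 to its position
  in direction \<open>i\<close>. The sign cancels the one that the boundary attaches to direction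
  \<open>i\<close>, so the ends of the prism occur as target minus source.\<close>

definition homotopy_cell :: "'n::{finite,linorder} \<Rightarrow> 'n cell \<Rightarrow> ('n cell \<Rightarrow>\<^sub>0 int)" where
  "homotopy_cell i y = (case y of (w, J) \<Rightarrow> if i \<in> J then 0
     else frag_cmul (cell_sign i J) (oriented_sum (\<lambda>k. frag_of (set_coord w i k, insert i J)) (w $ i)))"

lemma cubical_boundary_oriented_sum:
  "cubical_boundary (oriented_sum g n) = oriented_sum (\<lambda>k. cubical_boundary (g k)) n"
  by (rule oriented_sum_additive) (simp_all add: cubical_boundary_add)

text \<open>A chain homotopy between the collapse and the identity. If \<open>i\<close> is free, the
  sweeps up to \<open>w $ i + 1\<close> and up to \<open>w $ i\<close> differ by the cell itself.
  Otherwise the ends of the prism telescope to the cell minus its projection, and the lateral faces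
  cancel the prisms over the faces of the cell.\<close>

lemma homotopy_cell_identity:
  fixes i :: "'n::{finite,linorder}"
  shows "cubical_boundary (homotopy_cell i (w, J)) + frag_extend (homotopy_cell i) (cell_boundary (w, J))
    = frag_of (w, J) - collapse_cell i (w, J)"
proof (cases "i \<in> J")
  case True
  let ?g = "\<lambda>k. frag_of (set_coord w i k, J)"
  have "frag_extend (homotopy_cell i) (cell_boundary (w, J)) =
      (\<Sum>j\<in>J. frag_cmul (cell_sign j J)
         (homotopy_cell i (w + axis j 1, J - {j}) - homotopy_cell i (w, J - {j})))"
    by (simp add: cell_boundary_eq frag_extend_sum frag_extend_cmul frag_extend_diff)
  \<comment> \<open>Faces orthogonal to \<open>j \<noteq> i\<close> still extend in direction
    \<open>i\<close>, and the homotopy vanishes on them.\<close>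
  also have "\<dots> = (\<Sum>j\<in>{i}. frag_cmul (cell_sign j J)
         (homotopy_cell i (w + axis j 1, J - {j}) - homotopy_cell i (w, J - {j})))"
    using True by (intro sum.mono_neutral_right) (auto simp: homotopy_cell_def)
  also have "\<dots> = frag_cmul (cell_sign i J) (frag_cmul (cell_sign i J) (oriented_sum ?g (w $ i + 1))
        - frag_cmul (cell_sign i J) (oriented_sum ?g (w $ i)))"
    using True by (simp add: homotopy_cell_def insert_absorb set_coord_add_axis_self)
  also have "\<dots> = ?g (w $ i)"
    by (simp add: oriented_sum_Suc flip: frag_cmul_diff)
  finally show ?thesis
    using True by (simp add: homotopy_cell_def collapse_cell_def)
next
  case False
  let ?s = "\<lambda>j. cell_sign j J * cell_sign i (J - {j})"
  let ?A = "\<lambda>j k. frag_of (set_coord w i k + axis j 1, insert i (J - {j}))"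
  let ?B = "\<lambda>j k. frag_of (set_coord w i k, insert i (J - {j}))"
  let ?T = "\<Sum>j\<in>J. frag_cmul (?s j) (oriented_sum (?A j) (w $ i) - oriented_sum (?B j) (w $ i))"
  have ne: "j \<noteq> i" if "j \<in> J" for j using that False by auto
  \<comment> \<open>Inserting \<open>i\<close> flips a sign if \<open>i < j\<close>, removing
    \<open>j\<close> flips one if \<open>j < i\<close>; exactly one happens, and the resulting minus
    makes the lateral faces cancel.\<close>
  have sgn: "cell_sign i J * cell_sign j (insert i J) = - ?s j" if "j \<in> J" for j
    using that ne[OF that] cell_sign_insert[OF False, of j] cell_sign_remove[OF that, of i]
    by (cases "i < j") auto
  have "cell_boundary (set_coord w i k, insert i J)
      = frag_cmul (cell_sign i J) (frag_of (set_coord w i (k + 1), J) - frag_of (set_coord w i k, J))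
        + (\<Sum>j\<in>J. frag_cmul (cell_sign j (insert i J)) (?A j k - ?B j k))" for k
  proof -
    have "(\<Sum>j\<in>J. frag_cmul (cell_sign j (insert i J))
         (frag_of (set_coord w i k + axis j 1, insert i J - {j}) - frag_of (set_coord w i k, insert i J - {j})))
       = (\<Sum>j\<in>J. frag_cmul (cell_sign j (insert i J)) (?A j k - ?B j k))"
      using ne by (intro sum.cong refl) (auto simp: insert_Diff_if)
    then show ?thesis
      using False by (simp add: cell_boundary_eq set_coord_plus_axis)
  qed
  then have "cubical_boundary (homotopy_cell i (w, J)) =
      frag_cmul (cell_sign i J)
        (frag_cmul (cell_sign i J) (oriented_sum (\<lambda>k. frag_of (set_coord w i (k + 1), J) - frag_of (set_coord w i k, J)) (w $ i))
        + (\<Sum>j\<in>J. frag_cmul (cell_sign j (insert i J)) (oriented_sum (?A j) (w $ i) - oriented_sum (?B j) (w $ i))))"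
    using False
    by (simp add: homotopy_cell_def cubical_boundary_cmul cubical_boundary_oriented_sum oriented_sum_add
        oriented_sum_sum oriented_sum_cmul oriented_sum_diff)
  also have "\<dots> = frag_of (w, J) - frag_of (set_coord w i 0, J)
       + (\<Sum>j\<in>J. frag_cmul (cell_sign i J * cell_sign j (insert i J)) (oriented_sum (?A j) (w $ i) - oriented_sum (?B j) (w $ i)))"
    by (simp add: oriented_sum_telescope[of "\<lambda>k. frag_of (set_coord w i k, J)"] frag_cmul_distrib2 frag_cmul_sum)
  also have "(\<Sum>j\<in>J. frag_cmul (cell_sign i J * cell_sign j (insert i J)) (oriented_sum (?A j) (w $ i) - oriented_sum (?B j) (w $ i))) = - ?T"
    by (simp add: sgn flip: sum_negf)
  finally have 1: "cubical_boundary (homotopy_cell i (w, J)) = frag_of (w, J) - frag_of (set_coord w i 0, J) - ?T"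
    by simp
  have "frag_extend (homotopy_cell i) (cell_boundary (w, J)) =
      (\<Sum>j\<in>J. frag_cmul (cell_sign j J)
         (homotopy_cell i (w + axis j 1, J - {j}) - homotopy_cell i (w, J - {j})))"
    by (simp add: cell_boundary_eq frag_extend_sum frag_extend_cmul frag_extend_diff)
  also have "\<dots> = ?T"
  proof (intro sum.cong refl)
    fix j assume j: "j \<in> J"
    then have "axis j (1::int) $ i = 0"
      using ne[OF j] by (auto simp: axis_def)
    with j show "frag_cmul (cell_sign j J) (homotopy_cell i (w + axis j 1, J - {j}) - homotopy_cell i (w, J - {j}))
      = frag_cmul (?s j) (oriented_sum (?A j) (w $ i) - oriented_sum (?B j) (w $ i))"
      using False ne[of j] by (simp add: homotopy_cell_def set_coord_add_axis frag_cmul_diff)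
  qed
  finally show ?thesis
    using 1 False by (simp add: collapse_cell_def)
qed

lemma homotopy_identity:
  "cubical_boundary (frag_extend (homotopy_cell i) \<zeta>) + frag_extend (homotopy_cell i) (cubical_boundary \<zeta>)
    = \<zeta> - frag_extend (collapse_cell i) \<zeta>"
proof -
  have "cubical_boundary (frag_extend (homotopy_cell i) \<zeta>) + frag_extend (homotopy_cell i) (cubical_boundary \<zeta>)
    = \<zeta> - frag_extend (collapse_cell i) \<zeta>" if "Poly_Mapping.keys \<zeta> \<subseteq> UNIV"
    using that
  proof (induction \<zeta> rule: frag_induction)
    case (one y) show ?case by (cases y) (simp add: homotopy_cell_identity)
  next
    case (diff a b)
    have "cubical_boundary (frag_extend (homotopy_cell i) (a - b)) + frag_extend (homotopy_cell i) (cubical_boundary (a - b))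
      = (cubical_boundary (frag_extend (homotopy_cell i) a) + frag_extend (homotopy_cell i) (cubical_boundary a))
      - (cubical_boundary (frag_extend (homotopy_cell i) b) + frag_extend (homotopy_cell i) (cubical_boundary b))"
      by (simp add: frag_extend_diff cubical_boundary_diff)
    then show ?case by (simp add: diff frag_extend_diff)
  qed simp
  then show ?thesis by simp
qed

lemma cubical_chains_add: "a \<in> cubical_chains d \<Longrightarrow> b \<in> cubical_chains d \<Longrightarrow> a + b \<in> cubical_chains d"
  using keys_add[of a b] by (auto simp: cubical_chains_def)

lemma keys_oriented_sum: "Poly_Mapping.keys (oriented_sum g n) \<subseteq> (\<Union>k. Poly_Mapping.keys (g k))"
  using keys_diff[of "sum g {0..<n}" "sum g {n..<0}"] keys_sum[of g "{0..<n}"] keys_sum[of g "{n..<0}"]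
  unfolding oriented_sum_def by blast

lemma homotopy_cubical_chains:
  fixes i :: "'n::{finite,linorder}"
  assumes "\<zeta> \<in> cubical_chains d"
  shows "frag_extend (homotopy_cell i) \<zeta> \<in> cubical_chains (Suc d)"
proof -
  have "Poly_Mapping.keys (homotopy_cell i y) \<subseteq> cells (Suc d)" if y: "y \<in> cells d" for y
  proof (cases y)
    case (Pair w J)
    show ?thesis
    proof (cases "i \<in> J")
      case False
      then have "Poly_Mapping.keys (homotopy_cell i y) \<subseteq> (\<Union>k. {(set_coord w i k, insert i J)})"
        unfolding homotopy_cell_def Pair
        using keys_oriented_sum[of "\<lambda>k. frag_of (set_coord w i k, insert i J)" "w $ i"]
        by (auto simp: keys_frag_of)
      then show ?thesis using y False Pair by (auto simp: cells_def)
    qed (simp add: homotopy_cell_def Pair)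
  qed
  then show ?thesis
    using assms keys_frag_extend[of "homotopy_cell i" \<zeta>] by (fastforce simp: cubical_chains_def)
qed

text \<open>On a cycle the homotopy identity says that collapsing one direction changes it by a
  boundary. Collapsing \<open>i\<close> alters coordinate \<open>i\<close> alone, so directions
  collapsed earlier stay collapsed.\<close>

lemma cubical_cycle_collapse:
  fixes \<zeta> :: "'n::{finite,linorder} cell \<Rightarrow>\<^sub>0 int"
  assumes "\<zeta> \<in> cubical_chains d" "cubical_boundary \<zeta> = 0" "finite I"
  shows "\<exists>\<zeta>' \<beta>. \<beta> \<in> cubical_chains (Suc d) \<and> \<zeta> = \<zeta>' + cubical_boundary \<beta> \<and>
    Poly_Mapping.keys \<zeta>' \<subseteq> {(w, J). card J = d \<and> (\<forall>i\<in>I. i \<notin> J \<and> w $ i = 0)}"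
  using assms(3)
proof (induction I rule: finite_induct)
  case empty
  show ?case
    using assms(1) by (intro exI[of _ \<zeta>] exI[of _ 0]) (auto simp: cubical_chains_def cells_def)
next
  case (insert i I)
  then obtain \<zeta>' \<beta> where IH: "\<beta> \<in> cubical_chains (Suc d)" "\<zeta> = \<zeta>' + cubical_boundary \<beta>"
    "Poly_Mapping.keys \<zeta>' \<subseteq> {(w, J). card J = d \<and> (\<forall>i\<in>I. i \<notin> J \<and> w $ i = 0)}" by blast
  have cyc: "cubical_boundary \<zeta>' = 0"
    using assms(2) IH(2) by (simp add: cubical_boundary_add boundary_boundary)
  have ch: "\<zeta>' \<in> cubical_chains d"
    using IH(3) by (auto simp: cubical_chains_def cells_def)
  let ?h = "frag_extend (homotopy_cell i) \<zeta>'"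
  let ?z = "frag_extend (collapse_cell i) \<zeta>'"
  have eq: "\<zeta>' = ?z + cubical_boundary ?h"
    using homotopy_identity[of i \<zeta>'] cyc by (simp add: algebra_simps)
  have "Poly_Mapping.keys ?z \<subseteq> {(w, J). card J = d \<and> (\<forall>i\<in>insert i I. i \<notin> J \<and> w $ i = 0)}"
  proof (rule order_trans[OF keys_frag_extend], rule UN_least)
    fix y assume "y \<in> Poly_Mapping.keys \<zeta>'"
    then have y: "y \<in> {(w, J). card J = d \<and> (\<forall>i\<in>I. i \<notin> J \<and> w $ i = 0)}" using IH(3) by blast
    then show "Poly_Mapping.keys (collapse_cell i y) \<subseteq> {(w, J). card J = d \<and> (\<forall>i\<in>insert i I. i \<notin> J \<and> w $ i = 0)}"
      by (cases y) (auto simp: collapse_cell_def keys_frag_of set_coord_nth)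
  qed
  moreover have "\<zeta> = ?z + cubical_boundary (?h + \<beta>)"
    using eq IH(2) by (simp add: cubical_boundary_add add.assoc)
  moreover have "?h + \<beta> \<in> cubical_chains (Suc d)"
    using IH(1) ch by (intro cubical_chains_add homotopy_cubical_chains)
  ultimately show ?case by blast
qed

text \<open>With all directions collapsed, only a multiple of the vertex at the origin survives, and
  a nonzero multiple forces d = 0. It then equals the augmentation of the cycle, since boundaries
  have augmentation zero.\<close>

theorem cubical_cycle_is_boundary:
  fixes \<zeta> :: "'n::{finite,linorder} cell \<Rightarrow>\<^sub>0 int"
  assumes "\<zeta> \<in> cubical_chains d" "cubical_boundary \<zeta> = 0"
    and aug: "d = 0 \<Longrightarrow> (\<Sum>y\<in>Poly_Mapping.keys \<zeta>. Poly_Mapping.lookup \<zeta> y) = 0"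
  shows "\<exists>\<beta>\<in>cubical_chains (Suc d). cubical_boundary \<beta> = \<zeta>"
proof -
  obtain \<zeta>' \<beta> where *: "\<beta> \<in> cubical_chains (Suc d)" "\<zeta> = \<zeta>' + cubical_boundary \<beta>"
    and K: "Poly_Mapping.keys \<zeta>' \<subseteq> {(w, J). card J = d \<and> (\<forall>i\<in>UNIV. i \<notin> J \<and> w $ i = 0)}"
    using cubical_cycle_collapse[OF assms(1,2) finite_class.finite_UNIV] by blast
  have "{(w, J). card J = d \<and> (\<forall>i\<in>(UNIV :: 'n set). i \<notin> J \<and> w $ i = (0::int))} \<subseteq> {(0, {})} \<inter> {y. d = 0}"
  proof clarify
    fix w J
    assume "d = card J" "\<forall>i\<in>(UNIV :: 'n set). i \<notin> J \<and> w $ i = (0::int)"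
    moreover from this(2) have "J = {}" "w = 0" by (auto simp: vec_eq_iff)
    ultimately show "(w, J) \<in> {(0, {})} \<inter> {y. card J = 0}" by auto
  qed
  with K have K': "Poly_Mapping.keys \<zeta>' \<subseteq> {(0, {})} \<inter> {y. d = 0}" by (rule order_trans)
  then have keys: "Poly_Mapping.keys \<zeta>' \<subseteq> {(0, {})}" by blast
  have card: "d = 0" if "Poly_Mapping.keys \<zeta>' \<noteq> {}" using K' that by blast
  have "Poly_Mapping.keys \<zeta>' = {}"
  proof (rule ccontr)
    assume ne: "Poly_Mapping.keys \<zeta>' \<noteq> {}"
    then have d: "d = 0" by (rule card)
    have "chain_eval (\<lambda>_. 1::int) (cell_boundary y) = 0" for y :: "'n cell"
      by (cases y) (simp add: cell_boundary_eq chain_eval_sum chain_eval_cmul chain_eval_diff)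
    then have "chain_eval (\<lambda>_. 1::int) (cubical_boundary \<beta>) = 0"
      by (simp add: cubical_boundary_def chain_eval_extend)
    then have "chain_eval (\<lambda>_. 1::int) \<zeta>' = 0"
      using aug[OF d] unfolding *(2) chain_eval_one[symmetric] by (simp add: chain_eval_add)
    moreover have "chain_eval (\<lambda>_. 1::int) \<zeta>' = Poly_Mapping.lookup \<zeta>' (0, {})"
      using keys by (simp add: chain_eval_superset[of "{(0, {})}"])
    moreover have "(0, {}) \<in> Poly_Mapping.keys \<zeta>'"
      using keys ne by blast
    ultimately show False by (simp add: in_keys_iff)
  qed
  then show ?thesis using * by auto
qed

section \<open>Tile complexes\<close>

subsection \<open>Faces, cells and cochains\<close>

lemma face_of_cube_iff:
  "vertices (w, J) \<subseteq> vertices (z, UNIV) \<longleftrightarrow>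
    (\<forall>i. (i \<in> J \<longrightarrow> w $ i = z $ i) \<and> w $ i \<in> {z $ i, z $ i + 1})" (is "?L \<longleftrightarrow> ?R")
proof
  assume L: ?L
  show ?R
  proof
    fix i
    have "w \<in> vertices (w, J)" by (simp add: vertices_def)
    then have 1: "w $ i \<in> {z $ i, z $ i + 1}" using L by (auto simp: vertices_def)
    \<comment> \<open>In a free direction the neighbour of \<open>w\<close> is a vertex too; that
      both lie in the cube leaves only \<open>w $ i = z $ i\<close>.\<close>
    have "w + axis i 1 \<in> vertices (w, J)" if "i \<in> J"
      using that by (auto simp: vertices_def axis_def)
    then have "w + axis i 1 \<in> vertices (z, UNIV)" if "i \<in> J" using L that by blast
    then have "(w + axis i 1) $ i \<in> {z $ i, z $ i + 1}" if "i \<in> J"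
      using that unfolding vertices_def prod.case mem_Collect_eq by (metis UNIV_I)
    with 1 show "(i \<in> J \<longrightarrow> w $ i = z $ i) \<and> w $ i \<in> {z $ i, z $ i + 1}"
      by (auto simp: axis_def)
  qed
next
  assume R: ?R
  show ?L
  proof
    fix v assume v: "v \<in> vertices (w, J)"
    have "v $ i \<in> {z $ i, z $ i + 1}" for i
      using v R[rule_format, of i] by (cases "i \<in> J") (auto simp: vertices_def dest!: spec[of _ i])
    then show "v \<in> vertices (z, UNIV)" by (auto simp: vertices_def)
  qed
qed

lemma tile_faces_iff:
  "(z, c, w, J) \<in> tile_faces \<AA> r \<longleftrightarrow> c \<in> patterns \<AA> (lattice_box r) \<and>
    (\<forall>i. (i \<in> J \<longrightarrow> w $ i = z $ i) \<and> w $ i \<in> {z $ i, z $ i + 1})"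
  by (simp add: tile_faces_def face_of_cube_iff del: insert_iff)

lemma tile_faces_lowest:
  "c \<in> patterns \<AA> (lattice_box r) \<Longrightarrow> (z, c, z, J) \<in> tile_faces \<AA> r"
  by (simp add: tile_faces_iff)

lemma tile_faces_boundary:
  assumes "(z, c, y) \<in> tile_faces \<AA> r" "y' \<in> Poly_Mapping.keys (cell_boundary y)"
  shows "(z, c, y') \<in> tile_faces \<AA> r"
proof (cases y)
  case (Pair w J)
  show ?thesis
    using assms(2) assms(1) unfolding Pair
    by (elim keys_cell_boundaryE) (auto simp: tile_faces_iff axis_def)
qed

lemma cells_boundary:
  assumes "y \<in> cells (Suc d)" "y' \<in> Poly_Mapping.keys (cell_boundary y)"
  shows "y' \<in> cells d"
  using assms cell_boundary_cubical_chains[of "snd y" d "fst y"]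
  by (auto simp: cubical_chains_def cells_def)

lemma glue_step_faces:
  "(p, p') \<in> glue_step \<AA> r \<Longrightarrow> p \<in> tile_faces \<AA> r \<and> p' \<in> tile_faces \<AA> r"
  by (auto simp: glue_step_def)

lemma glue_step_cell:
  "((z, c, y), (z', c', y')) \<in> glue_step \<AA> r \<Longrightarrow> y' = y"
  by (auto simp: glue_step_def)

lemma equiv_glue: "equiv (tile_faces \<AA> r) (glue \<AA> r)"
proof (rule equivI)
  show "sym (glue \<AA> r)"
    unfolding glue_def by (intro sym_Int sym_rtrancl sym_Un_converse) (auto simp: sym_def)
  show "trans (glue \<AA> r)"
    unfolding glue_def by (intro trans_Int trans_rtrancl) (auto simp: trans_def)
qed (auto simp: glue_def refl_on_def)

lemma glue_step_glue: "(p, p') \<in> glue_step \<AA> r \<Longrightarrow> (p, p') \<in> glue \<AA> r"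
  using glue_step_faces unfolding glue_def by blast

lemma glue_class_step:
  "(p, p') \<in> glue_step \<AA> r \<Longrightarrow> glue \<AA> r `` {p} = glue \<AA> r `` {p'}"
  by (intro equiv_class_eq[OF equiv_glue] glue_step_glue)

lemma glue_class_iff:
  "p \<in> tile_faces \<AA> r \<Longrightarrow> p' \<in> tile_faces \<AA> r \<Longrightarrow>
    glue \<AA> r `` {p} = glue \<AA> r `` {p'} \<longleftrightarrow> (p, p') \<in> glue \<AA> r"
  by (rule eq_equiv_class_iff[OF equiv_glue])

text \<open>Single gluing steps are enough: such a function is constant on the generated equivalence
  classes. This is the criterion by which cochains are defined on cells of a tile complex.\<close>

definition glue_invariant :: "('n::finite, 'a) config set \<Rightarrow> nat \<Rightarrow> (('n, 'a) tile_face \<Rightarrow> 'b) \<Rightarrow> bool" where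
  "glue_invariant \<AA> r F \<longleftrightarrow> (\<forall>p p'. (p, p') \<in> glue_step \<AA> r \<longrightarrow> F p = F p')"

lemma glue_invariantI:
  assumes "\<And>z c y i c'. (z, c, y) \<in> tile_faces \<AA> r \<Longrightarrow> (z + axis i 1, c', y) \<in> tile_faces \<AA> r \<Longrightarrow>
     fst y $ i = z $ i + 1 \<Longrightarrow> (\<And>u. u \<in> lattice_box r \<Longrightarrow> u $ i < int r \<Longrightarrow> c (u + axis i 1) = c' u) \<Longrightarrow>
     F (z, c, y) = F (z + axis i 1, c', y)"
  shows "glue_invariant \<AA> r F"
  unfolding glue_invariant_def glue_step_def by (auto intro: assms)

lemma glue_invariantD:
  assumes "glue_invariant \<AA> r F" "(p, p') \<in> glue \<AA> r"
  shows "F p = F p'"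
proof -
  have "(p, p') \<in> (glue_step \<AA> r \<union> (glue_step \<AA> r)\<inverse>)\<^sup>*"
    using assms(2) by (simp add: glue_def)
  then show ?thesis
    using assms(1) by (induction rule: rtrancl_induct) (auto simp: glue_invariant_def)
qed

lemma tile_cellI:
  "(z, c, y) \<in> tile_faces \<AA> r \<Longrightarrow> y \<in> cells d \<Longrightarrow> glue \<AA> r `` {(z, c, y)} \<in> tile_cells \<AA> r d"
  unfolding tile_cells_def by (rule quotientI) simp

lemma tile_cellE:
  assumes "K \<in> tile_cells \<AA> r d"
  obtains z c y where "(z, c, y) \<in> tile_faces \<AA> r" "y \<in> cells d" "K = glue \<AA> r `` {(z, c, y)}"
  using assms unfolding tile_cells_def by (auto elim!: quotientE)

text \<open>The common shape of coboundary and pullback: a class is evaluated at an arbitrary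
  representative, which is legitimate when \<open>F\<close> is
  \<open>glue_invariant\<close>.\<close>

definition face_cochain ::
  "('n::finite, 'a) config set \<Rightarrow> nat \<Rightarrow> nat \<Rightarrow> (('n, 'a) tile_face \<Rightarrow> 'g::ab_group_add) \<Rightarrow> ('n, 'a, 'g) cochain" where
  "face_cochain \<AA> r d F = (\<lambda>K. if K \<in> tile_cells \<AA> r d then F (SOME k. k \<in> K) else 0)"

lemma face_cochain_value:
  assumes "glue_invariant \<AA> r F" "(z, c, y) \<in> tile_faces \<AA> r" "y \<in> cells d"
  shows "face_cochain \<AA> r d F (glue \<AA> r `` {(z, c, y)}) = F (z, c, y)"
proof -
  let ?K = "glue \<AA> r `` {(z, c, y)}"
  have "(z, c, y) \<in> ?K" using equiv_class_self[OF equiv_glue assms(2)] .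
  then have "(SOME k. k \<in> ?K) \<in> ?K" by (rule someI[where P="\<lambda>k. k \<in> ?K"])
  then have "F (z, c, y) = F (SOME k. k \<in> ?K)"
    by (intro glue_invariantD[OF assms(1)]) auto
  then show ?thesis
    using tile_cellI[OF assms(2,3)] by (simp add: face_cochain_def)
qed

lemma cochain_eqI:
  assumes "\<And>K. K \<notin> tile_cells \<AA> r d \<Longrightarrow> C K = C' K"
    and "\<And>z c y. (z, c, y) \<in> tile_faces \<AA> r \<Longrightarrow> y \<in> cells d \<Longrightarrow>
       C (glue \<AA> r `` {(z, c, y)}) = C' (glue \<AA> r `` {(z, c, y)})"
  shows "C = C'"
proof
  fix K show "C K = C' K"
    by (cases "K \<in> tile_cells \<AA> r d") (use assms in \<open>auto elim: tile_cellE\<close>)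
qed

definition translate_face :: "int ^ 'n \<Rightarrow> ('n::finite, 'a) tile_face \<Rightarrow> ('n, 'a) tile_face" where
  "translate_face x = (\<lambda>(z, c, y). (z + x, c, translate_cell x y))"

lemma translate_face_faces:
  "translate_face x p \<in> tile_faces \<AA> r \<longleftrightarrow> p \<in> tile_faces \<AA> r"
  by (cases p) (auto simp: translate_face_def translate_cell_def tile_faces_iff)

lemma translate_cell_cells [simp]: "translate_cell x y \<in> cells d \<longleftrightarrow> y \<in> cells d"
  by (cases y) (auto simp: translate_cell_def cells_def)

lemma translate_face_step:
  assumes "(p, p') \<in> glue_step \<AA> r"
  shows "(translate_face x p, translate_face x p') \<in> glue_step \<AA> r"
proof -
  obtain z c y z' c' y' where p: "p = (z, c, y)" "p' = (z', c', y')" by (metis prod_cases3)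
  from assms obtain i where i: "y' = y" "z' = z + axis i 1" "fst y $ i = z $ i + 1"
    "\<forall>u\<in>lattice_box r. u $ i < int r \<longrightarrow> c (u + axis i 1) = c' u"
    unfolding p glue_step_def by auto
  have "translate_face x p \<in> tile_faces \<AA> r" "translate_face x p' \<in> tile_faces \<AA> r"
    using glue_step_faces[OF assms] by (simp_all add: translate_face_faces)
  then show ?thesis
    using i unfolding p glue_step_def translate_face_def
    by (auto simp: translate_cell_def algebra_simps split: prod.splits intro!: exI[of _ i])
qed

text \<open>The class of the translated face is itself a function invariant under gluing steps,
  hence constant on classes; this replaces an induction over sequences of gluings.\<close>

lemma translate_face_glue:
  assumes "(p, p') \<in> glue \<AA> r"
  shows "(translate_face x p, translate_face x p') \<in> glue \<AA> r"
proof -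
  have "glue_invariant \<AA> r (\<lambda>p. glue \<AA> r `` {translate_face x p})"
    unfolding glue_invariant_def by (intro allI impI glue_class_step translate_face_step)
  from glue_invariantD[OF this assms] show ?thesis
    using assms by (subst (asm) glue_class_iff) (auto simp: translate_face_faces glue_def)
qed

lemma translate_face_inverse [simp]: "translate_face x (translate_face (- x) p) = p"
  "translate_face (- x) (translate_face x p) = p"
  by (cases p; auto simp: translate_face_def translate_cell_def split: prod.splits)+

lemma tile_translate_class:
  "tile_translate x (glue \<AA> r `` {p}) = glue \<AA> r `` {translate_face x p}"
proof -
  have eq: "tile_translate x K = translate_face x ` K" for K
    unfolding tile_translate_def translate_face_def ..
  show ?thesis
    unfolding eq
  proof
    show "translate_face x ` (glue \<AA> r `` {p}) \<subseteq> glue \<AA> r `` {translate_face x p}"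
      using translate_face_glue by auto
    show "glue \<AA> r `` {translate_face x p} \<subseteq> translate_face x ` (glue \<AA> r `` {p})"
    proof
      fix p' assume "p' \<in> glue \<AA> r `` {translate_face x p}"
      then have "(p, translate_face (- x) p') \<in> glue \<AA> r"
        using translate_face_glue[of "translate_face x p" p' \<AA> r "- x"] by simp
      moreover have "p' = translate_face x (translate_face (- x) p')" by simp
      ultimately show "p' \<in> translate_face x ` (glue \<AA> r `` {p})" by blast
    qed
  qed
qed

lemma inv_cochains_outside: "C \<in> inv_cochains \<AA> r d \<Longrightarrow> K \<notin> tile_cells \<AA> r d \<Longrightarrow> C K = 0"
  by (simp add: inv_cochains_def)

lemma inv_cochains_translate:
  assumes "C \<in> inv_cochains \<AA> r d" "(z, c, y) \<in> tile_faces \<AA> r" "y \<in> cells d"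
  shows "C (glue \<AA> r `` {(z + x, c, translate_cell x y)}) = C (glue \<AA> r `` {(z, c, y)})"
proof -
  have "C (tile_translate x (glue \<AA> r `` {(z, c, y)})) = C (glue \<AA> r `` {(z, c, y)})"
    using assms(1) tile_cellI[OF assms(2,3)] by (simp add: inv_cochains_def)
  then show ?thesis unfolding tile_translate_class by (simp add: translate_face_def)
qed

lemma inv_cochainsI:
  assumes "\<And>K. K \<notin> tile_cells \<AA> r d \<Longrightarrow> C K = 0"
    and "\<And>x z c y. (z, c, y) \<in> tile_faces \<AA> r \<Longrightarrow> y \<in> cells d \<Longrightarrow>
      C (glue \<AA> r `` {(z + x, c, translate_cell x y)}) = C (glue \<AA> r `` {(z, c, y)})"
  shows "C \<in> inv_cochains \<AA> r d"
proof -
  have "C (tile_translate x K) = C K" if K: "K \<in> tile_cells \<AA> r d" for x K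
  proof -
    obtain z c y where *: "(z, c, y) \<in> tile_faces \<AA> r" "y \<in> cells d" "K = glue \<AA> r `` {(z, c, y)}"
      using K by (rule tile_cellE)
    then show ?thesis
      using assms(2)[OF *(1,2), of x] unfolding *(3) tile_translate_class by (simp add: translate_face_def)
  qed
  then show ?thesis using assms(1) by (simp add: inv_cochains_def)
qed

lemma face_cochain_inv:
  assumes "glue_invariant \<AA> r F"
    and "\<And>x z c y. (z, c, y) \<in> tile_faces \<AA> r \<Longrightarrow> y \<in> cells d \<Longrightarrow> F (z + x, c, translate_cell x y) = F (z, c, y)"
  shows "face_cochain \<AA> r d F \<in> inv_cochains \<AA> r d"
proof (rule inv_cochainsI)
  fix x z c y assume *: "(z, c, y) \<in> tile_faces \<AA> r" "y \<in> cells d"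
  have "(z + x, c, translate_cell x y) \<in> tile_faces \<AA> r"
    using * translate_face_faces[of x "(z, c, y)" \<AA> r] by (simp add: translate_face_def)
  then show "face_cochain \<AA> r d F (glue \<AA> r `` {(z + x, c, translate_cell x y)}) =
     face_cochain \<AA> r d F (glue \<AA> r `` {(z, c, y)})"
    using * assms by (simp add: face_cochain_value)
qed (simp add: face_cochain_def)

subsection \<open>The coboundary\<close>

lemma chain_eval_cell_boundary:
  "chain_eval v (cell_boundary (w, J)) =
    (\<Sum>j\<in>J. zpow (v (w + axis j 1, J - {j}) - v (w, J - {j})) (cell_sign j J))"
  by (simp add: cell_boundary_eq chain_eval_sum chain_eval_cmul chain_eval_diff)

lemma chain_eval_boundary_translate:
  "chain_eval v (cell_boundary (translate_cell x y)) = chain_eval (\<lambda>y'. v (translate_cell x y')) (cell_boundary y)"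
  by (cases y) (simp add: translate_cell_def chain_eval_cell_boundary algebra_simps)

lemma chain_eval_boundary_boundary:
  "chain_eval (\<lambda>y'. chain_eval v (cell_boundary y')) (cell_boundary y) = 0"
proof -
  have "chain_eval (\<lambda>y'. chain_eval v (cell_boundary y')) (cell_boundary y)
      = chain_eval v (cubical_boundary (cubical_boundary (frag_of y)))"
    by (simp only: cubical_boundary_of) (simp add: cubical_boundary_def chain_eval_extend)
  then show ?thesis by (simp only: boundary_boundary chain_eval_0)
qed

definition face_coboundary :: 
  "('n::{finite,linorder}, 'a) config set \<Rightarrow> nat \<Rightarrow> ('n, 'a, 'g::ab_group_add) cochain \<Rightarrow> ('n, 'a) tile_face \<Rightarrow> 'g" where
  "face_coboundary \<AA> r C = (\<lambda>(z, c, y). chain_eval (\<lambda>y'. C (glue \<AA> r `` {(z, c, y')})) (cell_boundary y))"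

lemma tile_coboundary_eq:
  "tile_coboundary \<AA> r d C = face_cochain \<AA> r (Suc d) (face_coboundary \<AA> r C)"
  unfolding tile_coboundary_def face_cochain_def face_coboundary_def by (rule refl)

text \<open>The gluing is across a facet orthogonal to \<open>i\<close> that contains
  \<open>y\<close>. So \<open>i\<close> is not free in \<open>y\<close>, and each boundary face of
  \<open>y\<close> lies in the same facet.\<close>

lemma glue_step_boundary:
  assumes "((z, c, y), (z', c', y)) \<in> glue_step \<AA> r" "y' \<in> Poly_Mapping.keys (cell_boundary y)"
  shows "((z, c, y'), (z', c', y')) \<in> glue_step \<AA> r"
proof -
  have f: "(z, c, y') \<in> tile_faces \<AA> r" "(z', c', y') \<in> tile_faces \<AA> r"
    using assms glue_step_faces[OF assms(1)] tile_faces_boundary by blast+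
  from assms(1) obtain i where i: "z' = z + axis i 1" "fst y $ i = z $ i + 1"
    "\<forall>u\<in>lattice_box r. u $ i < int r \<longrightarrow> c (u + axis i 1) = c' u"
    unfolding glue_step_def by auto
  obtain w J where y: "y = (w, J)" by (cases y)
  have "i \<notin> J" using i(2) glue_step_faces[OF assms(1)] by (auto simp: y tile_faces_iff)
  then have "fst y' $ i = fst y $ i"
    using assms(2) unfolding y by (elim keys_cell_boundaryE) (auto simp: axis_def)
  then show ?thesis using f i unfolding glue_step_def by auto
qed

lemma glue_invariant_coboundary: "glue_invariant \<AA> r (face_coboundary \<AA> r C)"
proof -
  have "face_coboundary \<AA> r C p = face_coboundary \<AA> r C p'" if "(p, p') \<in> glue_step \<AA> r" for p p'
  proof -
    obtain z c y z' c' y' where p: "p = (z, c, y)" "p' = (z', c', y')" by (metis prod_cases3)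
    have y: "y' = y" using that unfolding p by (rule glue_step_cell)
    have "glue \<AA> r `` {(z, c, x)} = glue \<AA> r `` {(z', c', x)}" if "x \<in> Poly_Mapping.keys (cell_boundary y)" for x
      by (rule glue_class_step[OF glue_step_boundary[OF _ that]])
        (use \<open>(p, p') \<in> glue_step \<AA> r\<close> in \<open>simp add: p y\<close>)
    then show ?thesis
      unfolding p y face_coboundary_def by (auto intro: chain_eval_cong)
  qed
  then show ?thesis unfolding glue_invariant_def by blast
qed

lemma tile_coboundary_value:
  assumes "(z, c, y) \<in> tile_faces \<AA> r" "y \<in> cells (Suc d)"
  shows "tile_coboundary \<AA> r d C (glue \<AA> r `` {(z, c, y)})
     = chain_eval (\<lambda>y'. C (glue \<AA> r `` {(z, c, y')})) (cell_boundary y)"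
  unfolding tile_coboundary_eq
  unfolding face_cochain_value[OF glue_invariant_coboundary assms] by (simp add: face_coboundary_def)

lemma tile_coboundary_outside: "K \<notin> tile_cells \<AA> r (Suc d) \<Longrightarrow> tile_coboundary \<AA> r d C K = 0"
  by (simp add: tile_coboundary_def)

lemma tile_coboundary_inv:
  assumes "C \<in> inv_cochains \<AA> r d"
  shows "tile_coboundary \<AA> r d C \<in> inv_cochains \<AA> r (Suc d)"
  unfolding tile_coboundary_eq
proof (rule face_cochain_inv[OF glue_invariant_coboundary])
  fix x z c y assume *: "(z, c, y) \<in> tile_faces \<AA> r" "y \<in> cells (Suc d)"
  show "face_coboundary \<AA> r C (z + x, c, translate_cell x y) = face_coboundary \<AA> r C (z, c, y)"
    unfolding face_coboundary_def prod.case chain_eval_boundary_translate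
    by (intro chain_eval_cong inv_cochains_translate[OF assms] tile_faces_boundary[OF *(1)] cells_boundary[OF *(2)])
qed

text \<open>All faces involved can be read in one tile \<open>(z, c)\<close>, where the claim
  becomes that of the Euclidean boundary.\<close>

lemma tile_coboundary_coboundary: "tile_coboundary \<AA> r (Suc d) (tile_coboundary \<AA> r d C) = (\<lambda>K. 0)"
proof (rule cochain_eqI[of \<AA> r "Suc (Suc d)"])
  fix z c y assume *: "(z, c, y) \<in> tile_faces \<AA> r" "y \<in> cells (Suc (Suc d))"
  have "tile_coboundary \<AA> r (Suc d) (tile_coboundary \<AA> r d C) (glue \<AA> r `` {(z, c, y)})
    = chain_eval (\<lambda>y'. chain_eval (\<lambda>y'. C (glue \<AA> r `` {(z, c, y')})) (cell_boundary y')) (cell_boundary y)"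
    unfolding tile_coboundary_value[OF *]
    by (intro chain_eval_cong tile_coboundary_value tile_faces_boundary[OF *(1)] cells_boundary[OF *(2)])
  then show "tile_coboundary \<AA> r (Suc d) (tile_coboundary \<AA> r d C) (glue \<AA> r `` {(z, c, y)}) = 0"
    by (simp add: chain_eval_boundary_boundary)
qed (simp add: tile_coboundary_outside)

lemma tile_coboundary_add:
  "tile_coboundary \<AA> r d (\<lambda>K. C K + C' K) = (\<lambda>K. tile_coboundary \<AA> r d C K + tile_coboundary \<AA> r d C' K)"
  by (rule cochain_eqI[of \<AA> r "Suc d"])
    (simp_all add: tile_coboundary_outside tile_coboundary_value chain_eval_fun_add)

lemma tile_coboundary_uminus:
  "tile_coboundary \<AA> r d (\<lambda>K. - C K) = (\<lambda>K. - tile_coboundary \<AA> r d C K)"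
  by (rule cochain_eqI[of \<AA> r "Suc d"])
    (simp_all add: tile_coboundary_outside tile_coboundary_value chain_eval_fun_uminus)

lemma tile_coboundary_zero [simp]: "tile_coboundary \<AA> r d (\<lambda>K. 0) = (\<lambda>K. 0)"
  by (rule cochain_eqI[of \<AA> r "Suc d"])
    (simp_all add: tile_coboundary_outside tile_coboundary_value)

subsection \<open>Invariant cohomology groups\<close>

abbreviation cocycle_group ::
  "('n::{finite,linorder}, 'a) config set \<Rightarrow> nat \<Rightarrow> nat \<Rightarrow> ('n, 'a, 'g::ab_group_add) cochain monoid" where
  "cocycle_group \<AA> r d \<equiv> (inv_cochain_group \<AA> r d)\<lparr>carrier := inv_cocycles \<AA> r d\<rparr>"

lemma inv_cochains_add: "C \<in> inv_cochains \<AA> r d \<Longrightarrow> C' \<in> inv_cochains \<AA> r d \<Longrightarrow> (\<lambda>K. C K + C' K) \<in> inv_cochains \<AA> r d"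
  by (simp add: inv_cochains_def)

lemma inv_cochains_uminus: "C \<in> inv_cochains \<AA> r d \<Longrightarrow> (\<lambda>K. - C K) \<in> inv_cochains \<AA> r d"
  by (simp add: inv_cochains_def)

lemma inv_cochains_zero [simp]: "(\<lambda>K. 0) \<in> inv_cochains \<AA> r d"
  by (simp add: inv_cochains_def)

lemma inv_cocycles_add: "C \<in> inv_cocycles \<AA> r d \<Longrightarrow> C' \<in> inv_cocycles \<AA> r d \<Longrightarrow> (\<lambda>K. C K + C' K) \<in> inv_cocycles \<AA> r d"
  by (simp add: inv_cocycles_def inv_cochains_add tile_coboundary_add)

lemma inv_cocycles_uminus: "C \<in> inv_cocycles \<AA> r d \<Longrightarrow> (\<lambda>K. - C K) \<in> inv_cocycles \<AA> r d"
  by (simp add: inv_cocycles_def inv_cochains_uminus tile_coboundary_uminus)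

lemma inv_cocycles_zero [simp]: "(\<lambda>K. 0) \<in> inv_cocycles \<AA> r d"
  by (simp add: inv_cocycles_def)

lemma inv_cocycles_cochains: "C \<in> inv_cocycles \<AA> r d \<Longrightarrow> C \<in> inv_cochains \<AA> r d"
  by (simp add: inv_cocycles_def)

lemma inv_cochain_group_simps [simp]:
  "C \<otimes>\<^bsub>inv_cochain_group \<AA> r d\<^esub> C' = (\<lambda>K. C K + C' K)"
  "\<one>\<^bsub>inv_cochain_group \<AA> r d\<^esub> = (\<lambda>K. 0)"
  by (simp_all add: inv_cochain_group_def)

lemma comm_group_cocycle_group: "comm_group (cocycle_group \<AA> r d :: ('n::{finite,linorder}, 'a, 'g::ab_group_add) cochain monoid)"
proof (rule comm_groupI)
  fix C :: "('n, 'a, 'g) cochain"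
  assume "C \<in> carrier (cocycle_group \<AA> r d)"
  then show "\<exists>C'\<in>carrier (cocycle_group \<AA> r d). C' \<otimes>\<^bsub>cocycle_group \<AA> r d\<^esub> C = \<one>\<^bsub>cocycle_group \<AA> r d\<^esub>"
    by (intro bexI[of _ "\<lambda>K. - C K"]) (simp_all add: inv_cocycles_uminus)
qed (simp_all add: inv_cocycles_add ac_simps)

lemma inv_cocycle_group: "C \<in> inv_cocycles \<AA> r d \<Longrightarrow> inv\<^bsub>cocycle_group \<AA> r d\<^esub> C = (\<lambda>K. - C K)"
  by (rule group.inv_equality[OF comm_group.axioms(2)[OF comm_group_cocycle_group]])
    (simp_all add: inv_cocycles_uminus)

lemma inv_coboundaries_add:
  "C \<in> inv_coboundaries \<AA> r d \<Longrightarrow> C' \<in> inv_coboundaries \<AA> r d \<Longrightarrow> (\<lambda>K. C K + C' K) \<in> inv_coboundaries \<AA> r d"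
  unfolding inv_coboundaries_def
  by (auto split: if_splits simp flip: tile_coboundary_add intro!: imageI inv_cochains_add)

lemma inv_coboundaries_uminus:
  "C \<in> inv_coboundaries \<AA> r d \<Longrightarrow> (\<lambda>K. - C K) \<in> inv_coboundaries \<AA> r d"
  unfolding inv_coboundaries_def
  by (auto split: if_splits simp flip: tile_coboundary_uminus intro!: imageI inv_cochains_uminus)

lemma inv_coboundaries_zero [simp]: "(\<lambda>K. 0) \<in> inv_coboundaries \<AA> r d"
  unfolding inv_coboundaries_def by (auto intro!: image_eqI[of _ _ "\<lambda>K. 0"])

lemma inv_coboundaries_cocycles: "inv_coboundaries \<AA> r d \<subseteq> inv_cocycles \<AA> r d"
proof (cases d)
  case (Suc d')
  then show ?thesis
    by (auto simp: inv_coboundaries_def inv_cocycles_def tile_coboundary_coboundary tile_coboundary_inv)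
qed (auto simp: inv_coboundaries_def)

lemma subgroup_coboundaries: "subgroup (inv_coboundaries \<AA> r d) (cocycle_group \<AA> r d)"
proof (rule subgroup.intro)
  fix C assume C: "C \<in> inv_coboundaries \<AA> r d"
  then have "C \<in> inv_cocycles \<AA> r d" using inv_coboundaries_cocycles by blast
  then show "inv\<^bsub>cocycle_group \<AA> r d\<^esub> C \<in> inv_coboundaries \<AA> r d"
    using C by (simp only: inv_cocycle_group inv_coboundaries_uminus)
qed (use inv_coboundaries_cocycles in \<open>auto simp: inv_coboundaries_add\<close>)

lemma comm_group_tile_inv_cohomology: "comm_group (tile_inv_cohomology \<AA> d r)"
  unfolding tile_inv_cohomology_def
  by (rule comm_group.abelian_FactGroup[OF comm_group_cocycle_group subgroup_coboundaries])

lemma inv_cohomology_class_eq: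
  "inv_cohomology_class \<AA> d r C = inv_coboundaries \<AA> r d #>\<^bsub>cocycle_group \<AA> r d\<^esub> C"
  by (simp add: inv_cohomology_class_def)

lemma carrier_tile_inv_cohomology:
  "carrier (tile_inv_cohomology \<AA> d r) = inv_cohomology_class \<AA> d r ` inv_cocycles \<AA> r d"
  by (auto simp: tile_inv_cohomology_def FactGroup_def RCOSETS_def inv_cohomology_class_eq)

lemma inv_cohomology_class_mult:
  assumes "C \<in> inv_cocycles \<AA> r d" "C' \<in> inv_cocycles \<AA> r d"
  shows "inv_cohomology_class \<AA> d r C \<otimes>\<^bsub>tile_inv_cohomology \<AA> d r\<^esub> inv_cohomology_class \<AA> d r C'
    = inv_cohomology_class \<AA> d r (\<lambda>K. C K + C' K)"
proof -
  have "inv_coboundaries \<AA> r d \<lhd> cocycle_group \<AA> r d"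
    using comm_group.normal_iff_subgroup[OF comm_group_cocycle_group] subgroup_coboundaries by blast
  from normal.rcos_sum[OF this, of C C'] show ?thesis
    using assms by (simp add: tile_inv_cohomology_def FactGroup_def inv_cohomology_class_eq)
qed

lemma inv_cohomology_class_mem_iff:
  "C' \<in> inv_cohomology_class \<AA> d r C \<longleftrightarrow> (\<exists>B\<in>inv_coboundaries \<AA> r d. C' = (\<lambda>K. B K + C K))"
  by (auto simp: inv_cohomology_class_def r_coset_def inv_cochain_group_def)

lemma inv_cohomology_class_self: "C \<in> inv_cohomology_class \<AA> d r C"
  unfolding inv_cohomology_class_mem_iff by (rule bexI[of _ "\<lambda>K. 0"]) auto

lemma inv_cohomology_class_eqI:
  assumes "C' \<in> inv_cohomology_class \<AA> d r C"
  shows "inv_cohomology_class \<AA> d r C' = inv_cohomology_class \<AA> d r C"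
proof (rule Set.set_eqI)
  from assms obtain B where B: "B \<in> inv_coboundaries \<AA> r d" "C' = (\<lambda>K. B K + C K)"
    unfolding inv_cohomology_class_mem_iff by blast
  fix X
  show "X \<in> inv_cohomology_class \<AA> d r C' \<longleftrightarrow> X \<in> inv_cohomology_class \<AA> d r C"
  proof
    assume "X \<in> inv_cohomology_class \<AA> d r C'"
    then obtain B' where B': "B' \<in> inv_coboundaries \<AA> r d" "X = (\<lambda>K. B' K + C' K)"
      unfolding inv_cohomology_class_mem_iff by blast
    then show "X \<in> inv_cohomology_class \<AA> d r C"
      unfolding inv_cohomology_class_mem_iff using inv_coboundaries_add[OF B'(1) B(1)]
      by (intro bexI[of _ "\<lambda>K. B' K + B K"]) (simp_all add: B add.assoc)
  next
    assume "X \<in> inv_cohomology_class \<AA> d r C"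
    then obtain B' where B': "B' \<in> inv_coboundaries \<AA> r d" "X = (\<lambda>K. B' K + C K)"
      unfolding inv_cohomology_class_mem_iff by blast
    then show "X \<in> inv_cohomology_class \<AA> d r C'"
      unfolding inv_cohomology_class_mem_iff using inv_coboundaries_add[OF B'(1) inv_coboundaries_uminus[OF B(1)]]
      by (intro bexI[of _ "\<lambda>K. B' K + - B K"]) (simp_all add: B)
  qed
qed

subsection \<open>Pullbacks along tile maps\<close>

text \<open>The conditions for a cellular map that replaces the pattern of each tile: admissible
  patterns go to admissible ones, and overlapping patterns to overlapping ones. Positions do not
  change, so only patterns are mentioned.\<close>

definition tile_map ::
  "('n::finite, 'a) config set \<Rightarrow> nat \<Rightarrow> nat \<Rightarrow> (('n, 'a) config \<Rightarrow> ('n, 'a) config) \<Rightarrow> bool" where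
  "tile_map \<AA> s r \<psi> \<longleftrightarrow>
     (\<forall>c\<in>patterns \<AA> (lattice_box s). \<psi> c \<in> patterns \<AA> (lattice_box r)) \<and>
     (\<forall>c\<in>patterns \<AA> (lattice_box s). \<forall>c'\<in>patterns \<AA> (lattice_box s). \<forall>i.
        (\<forall>u\<in>lattice_box s. u $ i < int s \<longrightarrow> c (u + axis i 1) = c' u) \<longrightarrow>
        (\<forall>u\<in>lattice_box r. u $ i < int r \<longrightarrow> \<psi> c (u + axis i 1) = \<psi> c' u))"

lemma tile_map_patterns: "tile_map \<AA> s r \<psi> \<Longrightarrow> c \<in> patterns \<AA> (lattice_box s) \<Longrightarrow> \<psi> c \<in> patterns \<AA> (lattice_box r)"
  by (simp add: tile_map_def)

lemma tile_map_faces: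
  "tile_map \<AA> s r \<psi> \<Longrightarrow> (z, c, y) \<in> tile_faces \<AA> s \<Longrightarrow> (z, \<psi> c, y) \<in> tile_faces \<AA> r"
  by (auto simp: tile_map_def tile_faces_def)

lemma tile_map_step:
  assumes "tile_map \<AA> s r \<psi>" "((z, c, y), (z', c', y')) \<in> glue_step \<AA> s"
  shows "((z, \<psi> c, y), (z', \<psi> c', y')) \<in> glue_step \<AA> r"
proof -
  have f: "(z, c, y) \<in> tile_faces \<AA> s" "(z', c', y') \<in> tile_faces \<AA> s"
    using assms(2) glue_step_faces by blast+
  then have p: "c \<in> patterns \<AA> (lattice_box s)" "c' \<in> patterns \<AA> (lattice_box s)"
    by (auto simp: tile_faces_def)
  obtain i where i: "y' = y" "z' = z + axis i 1" "fst y $ i = z $ i + 1"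
    "\<forall>u\<in>lattice_box s. u $ i < int s \<longrightarrow> c (u + axis i 1) = c' u"
    using assms(2) unfolding glue_step_def by auto
  have "\<forall>u\<in>lattice_box r. u $ i < int r \<longrightarrow> \<psi> c (u + axis i 1) = \<psi> c' u"
    using assms(1) p i(4) unfolding tile_map_def by blast
  then show ?thesis
    using f[THEN tile_map_faces[OF assms(1)]] i unfolding glue_step_def by auto
qed

lemma tile_map_comp:
  "tile_map \<AA> s r \<psi> \<Longrightarrow> tile_map \<AA> t s \<eta> \<Longrightarrow> tile_map \<AA> t r (\<lambda>c. \<psi> (\<eta> c))"
  by (simp add: tile_map_def)

lemma tile_pullback_eq:
  "tile_pullback \<AA> d s r \<psi> C = face_cochain \<AA> s d (\<lambda>(z, c, y). C (glue \<AA> r `` {(z, \<psi> c, y)}))"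
  unfolding tile_pullback_def face_cochain_def by (rule refl)

lemma tile_pullback_outside: "K \<notin> tile_cells \<AA> s d \<Longrightarrow> tile_pullback \<AA> d s r \<psi> C K = 0"
  by (simp add: tile_pullback_def)

context
  fixes \<AA> :: "('n::{finite,linorder}, 'a) config set" and s r :: nat and \<psi>
  assumes tile_map: "tile_map \<AA> s r \<psi>"
begin

lemma glue_invariant_pullback: "glue_invariant \<AA> s (\<lambda>(z, c, y). C (glue \<AA> r `` {(z, \<psi> c, y)}))"
  unfolding glue_invariant_def
  by (auto dest!: glue_class_step[OF tile_map_step[OF tile_map]])

lemma tile_pullback_value:
  assumes "(z, c, y) \<in> tile_faces \<AA> s" "y \<in> cells d"
  shows "tile_pullback \<AA> d s r \<psi> C (glue \<AA> s `` {(z, c, y)}) = C (glue \<AA> r `` {(z, \<psi> c, y)})"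
  unfolding tile_pullback_eq face_cochain_value[OF glue_invariant_pullback assms] by simp

lemma tile_pullback_inv:
  assumes "C \<in> inv_cochains \<AA> r d"
  shows "tile_pullback \<AA> d s r \<psi> C \<in> inv_cochains \<AA> s d"
  unfolding tile_pullback_eq
proof (rule face_cochain_inv[OF glue_invariant_pullback])
  fix x z c y assume "(z, c, y) \<in> tile_faces \<AA> s" "y \<in> cells d"
  then show "(case (z + x, c, translate_cell x y) of (z, c, y) \<Rightarrow> C (glue \<AA> r `` {(z, \<psi> c, y)}))
     = (case (z, c, y) of (z, c, y) \<Rightarrow> C (glue \<AA> r `` {(z, \<psi> c, y)}))"
    using inv_cochains_translate[OF assms tile_map_faces[OF tile_map]] by simp
qed

lemma tile_pullback_add:
  "tile_pullback \<AA> d s r \<psi> (\<lambda>K. C K + C' K) = (\<lambda>K. tile_pullback \<AA> d s r \<psi> C K + tile_pullback \<AA> d s r \<psi> C' K)"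
  by (rule cochain_eqI[of \<AA> s d]) (simp_all add: tile_pullback_outside tile_pullback_value)

lemma tile_pullback_zero [simp]: "tile_pullback \<AA> d s r \<psi> (\<lambda>K. 0) = (\<lambda>K. 0)"
  by (rule cochain_eqI[of \<AA> s d]) (simp_all add: tile_pullback_outside tile_pullback_value)

text \<open>A tile map keeps the position of every face, so both sides evaluate \<open>C\<close> on
  the same Euclidean boundary, read in the tile of \<open>\<psi> c\<close>.\<close>

lemma tile_coboundary_pullback:
  "tile_coboundary \<AA> s d (tile_pullback \<AA> d s r \<psi> C) = tile_pullback \<AA> (Suc d) s r \<psi> (tile_coboundary \<AA> r d C)"
proof (rule cochain_eqI[of \<AA> s "Suc d"])
  fix z c y assume *: "(z, c, y) \<in> tile_faces \<AA> s" "y \<in> cells (Suc d)"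
  have "tile_coboundary \<AA> s d (tile_pullback \<AA> d s r \<psi> C) (glue \<AA> s `` {(z, c, y)})
    = chain_eval (\<lambda>y'. C (glue \<AA> r `` {(z, \<psi> c, y')})) (cell_boundary y)"
    unfolding tile_coboundary_value[OF *]
    by (intro chain_eval_cong tile_pullback_value tile_faces_boundary[OF *(1)] cells_boundary[OF *(2)])
  also have "\<dots> = tile_pullback \<AA> (Suc d) s r \<psi> (tile_coboundary \<AA> r d C) (glue \<AA> s `` {(z, c, y)})"
    unfolding tile_pullback_value[OF *] tile_coboundary_value[OF tile_map_faces[OF tile_map *(1)] *(2)] ..
  finally show "tile_coboundary \<AA> s d (tile_pullback \<AA> d s r \<psi> C) (glue \<AA> s `` {(z, c, y)})
    = tile_pullback \<AA> (Suc d) s r \<psi> (tile_coboundary \<AA> r d C) (glue \<AA> s `` {(z, c, y)})" .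
qed (simp_all add: tile_coboundary_outside tile_pullback_outside)

lemma tile_pullback_cocycles:
  assumes "C \<in> inv_cocycles \<AA> r d"
  shows "tile_pullback \<AA> d s r \<psi> C \<in> inv_cocycles \<AA> s d"
  using assms by (simp add: inv_cocycles_def tile_pullback_inv tile_coboundary_pullback)

lemma tile_pullback_coboundaries:
  assumes "C \<in> inv_coboundaries \<AA> r d"
  shows "tile_pullback \<AA> d s r \<psi> C \<in> inv_coboundaries \<AA> s d"
proof (cases d)
  case 0 then show ?thesis using assms by (simp add: inv_coboundaries_def)
next
  case (Suc d')
  then obtain B where B: "B \<in> inv_cochains \<AA> r d'" "C = tile_coboundary \<AA> r d' B"
    using assms by (auto simp: inv_coboundaries_def)
  then have "tile_pullback \<AA> d s r \<psi> C = tile_coboundary \<AA> s d' (tile_pullback \<AA> d' s r \<psi> B)"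
    by (simp add: Suc tile_coboundary_pullback)
  then show ?thesis
    using tile_pullback_inv[OF B(1)] by (simp add: inv_coboundaries_def Suc)
qed

text \<open>Cohomologous cochains have cohomologous pullbacks, so the union that defines
  \<open>cohomology_pullback\<close> runs over a constant family.\<close>

lemma cohomology_pullback_class:
  "cohomology_pullback \<AA> d s r \<psi> (inv_cohomology_class \<AA> d r C)
     = inv_cohomology_class \<AA> d s (tile_pullback \<AA> d s r \<psi> C)"
proof -
  have *: "inv_cohomology_class \<AA> d s (tile_pullback \<AA> d s r \<psi> C') = inv_cohomology_class \<AA> d s (tile_pullback \<AA> d s r \<psi> C)"
    if C': "C' \<in> inv_cohomology_class \<AA> d r C" for C'
  proof -
    from C' obtain B where B: "B \<in> inv_coboundaries \<AA> r d" "C' = (\<lambda>K. B K + C K)"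
      unfolding inv_cohomology_class_mem_iff by blast
    show ?thesis
      by (rule inv_cohomology_class_eqI, unfold inv_cohomology_class_mem_iff B tile_pullback_add)
        (use tile_pullback_coboundaries[OF B(1)] in blast)
  qed
  have "cohomology_pullback \<AA> d s r \<psi> (inv_cohomology_class \<AA> d r C)
     = (\<Union>C'\<in>inv_cohomology_class \<AA> d r C. inv_cohomology_class \<AA> d s (tile_pullback \<AA> d s r \<psi> C))"
    unfolding cohomology_pullback_def by (rule SUP_cong[OF refl *])
  then show ?thesis using inv_cohomology_class_self[of C \<AA> d r] by auto
qed

lemma cohomology_pullback_hom:
  "cohomology_pullback \<AA> d s r \<psi> \<in> hom (tile_inv_cohomology \<AA> d r) (tile_inv_cohomology \<AA> d s)"
proof (rule homI)
  fix X :: "('n, 'a, 'g::ab_group_add) cochain set" assume "X \<in> carrier (tile_inv_cohomology \<AA> d r)"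
  then show "cohomology_pullback \<AA> d s r \<psi> X \<in> carrier (tile_inv_cohomology \<AA> d s)"
    by (auto simp: carrier_tile_inv_cohomology cohomology_pullback_class tile_pullback_cocycles)
next
  fix X Y :: "('n, 'a, 'g::ab_group_add) cochain set"
  assume "X \<in> carrier (tile_inv_cohomology \<AA> d r)" "Y \<in> carrier (tile_inv_cohomology \<AA> d r)"
  then show "cohomology_pullback \<AA> d s r \<psi> (X \<otimes>\<^bsub>tile_inv_cohomology \<AA> d r\<^esub> Y) =
    cohomology_pullback \<AA> d s r \<psi> X \<otimes>\<^bsub>tile_inv_cohomology \<AA> d s\<^esub> cohomology_pullback \<AA> d s r \<psi> Y"
    by (auto simp: carrier_tile_inv_cohomology cohomology_pullback_class inv_cohomology_class_mult
        tile_pullback_cocycles tile_pullback_add)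
qed

end

lemma tile_pullback_comp:
  fixes \<AA> :: "('n::{finite,linorder}, 'a) config set"
  assumes "tile_map \<AA> s r \<psi>" "tile_map \<AA> t s \<eta>"
  shows "tile_pullback \<AA> d t s \<eta> (tile_pullback \<AA> d s r \<psi> C) = tile_pullback \<AA> d t r (\<lambda>c. \<psi> (\<eta> c)) C"
  by (rule cochain_eqI[of \<AA> t d])
    (simp_all add: tile_pullback_outside tile_pullback_value[OF assms(2)] tile_pullback_value[OF assms(1)]
      tile_pullback_value[OF tile_map_comp[OF assms]] tile_map_faces[OF assms(2)])

subsection \<open>Restriction of patterns\<close>

abbreviation box_restrict :: "nat \<Rightarrow> ('n::finite, 'a) config \<Rightarrow> ('n, 'a) config" where
  "box_restrict r \<equiv> \<lambda>c. restrict c (lattice_box r)"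

lemma lattice_boxD: "u \<in> lattice_box r \<Longrightarrow> \<bar>u $ i\<bar> \<le> int r"
  by (simp add: lattice_box_def)

lemma lattice_boxI: "(\<And>i. \<bar>u $ i\<bar> \<le> int r) \<Longrightarrow> u \<in> lattice_box r"
  by (simp add: lattice_box_def)

lemma lattice_box_mono: "r \<le> s \<Longrightarrow> lattice_box r \<subseteq> lattice_box s"
proof (rule subsetI, rule lattice_boxI)
  fix u :: "int ^ 'a" and i assume "r \<le> s" "u \<in> lattice_box r"
  then show "\<bar>u $ i\<bar> \<le> int s" using lattice_boxD[of u r i] by linarith
qed

lemma box_restrict_restrict [simp]: "r \<le> s \<Longrightarrow> box_restrict r (box_restrict s c) = box_restrict r c"
  by (simp add: Int_absorb1 lattice_box_mono)

lemma patterns_box_restrict: "c \<in> patterns \<AA> (lattice_box r) \<Longrightarrow> box_restrict r c = c"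
  by (auto simp: patterns_def)

lemma lattice_box_add_axis: "u \<in> lattice_box r \<Longrightarrow> u $ i < int r \<Longrightarrow> u + axis i 1 \<in> lattice_box r"
proof (rule lattice_boxI)
  fix k assume "u \<in> lattice_box r" "u $ i < int r"
  then show "\<bar>(u + axis i 1) $ k\<bar> \<le> int r"
    using lattice_boxD[of u r k] by (cases "k = i") (auto simp: axis_def)
qed

lemma tile_map_restrict:
  assumes "r \<le> s"
  shows "tile_map \<AA> s r (box_restrict r)"
proof -
  have "box_restrict r c \<in> patterns \<AA> (lattice_box r)" if "c \<in> patterns \<AA> (lattice_box s)" for c
    using that assms by (auto simp: patterns_def simp del: restrict_restrict)
  moreover have "u \<in> lattice_box s" if "u \<in> lattice_box r" for u :: "int ^ 'a"
    using lattice_box_mono[OF assms] that by blast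
  ultimately show ?thesis
    using assms by (auto simp: tile_map_def lattice_box_add_axis)
qed

lemma tile_pullback_restrict_id:
  fixes \<AA> :: "('n::{finite,linorder}, 'a) config set"
  assumes "C \<in> inv_cochains \<AA> r d"
  shows "tile_pullback \<AA> d r r (box_restrict r) C = C"
  by (rule cochain_eqI[of \<AA> r d])
    (auto simp: tile_pullback_outside tile_pullback_value[OF tile_map_restrict] inv_cochains_outside[OF assms]
      tile_faces_def patterns_box_restrict)

lemma tile_pullback_restrict_comp:
  fixes \<AA> :: "('n::{finite,linorder}, 'a) config set"
  assumes "r \<le> s" "s \<le> t"
  shows "tile_pullback \<AA> d t s (box_restrict s) (tile_pullback \<AA> d s r (box_restrict r) C)
    = tile_pullback \<AA> d t r (box_restrict r) C"
  using tile_pullback_comp[OF tile_map_restrict[OF assms(1)] tile_map_restrict[OF assms(2)], where d = d and C = C] assms(1)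
  by (simp del: restrict_restrict)

lemma restriction_map_class:
  "restriction_map \<AA> d r (inv_cohomology_class \<AA> d r C)
    = inv_cohomology_class \<AA> d (Suc r) (tile_pullback \<AA> d (Suc r) r (box_restrict r) C)"
  unfolding restriction_map_def by (rule cohomology_pullback_class[OF tile_map_restrict]) simp

lemma restriction_system: "direct_system R (tile_inv_cohomology \<AA> d) (restriction_map \<AA> d)"
proof (rule direct_system.intro)
  show "comm_group (tile_inv_cohomology \<AA> d r)" for r by (rule comm_group_tile_inv_cohomology)
  show "restriction_map \<AA> d r \<in> hom (tile_inv_cohomology \<AA> d r) (tile_inv_cohomology \<AA> d (Suc r))" for r
    unfolding restriction_map_def by (rule cohomology_pullback_hom[OF tile_map_restrict]) simp
qed

text \<open>One-step restrictions compose to a single pullback, so an equality in the limit becomes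
  an equality of classes at one radius.\<close>

lemma transition_restriction_class:
  assumes "R \<le> r" "r \<le> t" "C \<in> inv_cochains \<AA> r d"
  shows "transition (restriction_map \<AA> d) r t (inv_cohomology_class \<AA> d r C)
    = inv_cohomology_class \<AA> d t (tile_pullback \<AA> d t r (box_restrict r) C)"
proof -
  interpret direct_system R "tile_inv_cohomology \<AA> d" "restriction_map \<AA> d" by (rule restriction_system)
  show ?thesis using assms(2)
  proof (induction t rule: dec_induct)
    case base show ?case by (simp only: transition_refl tile_pullback_restrict_id[OF assms(3)])
  next
    case (step t)
    then show ?case by (simp only: transition_Suc restriction_map_class tile_pullback_restrict_comp le_SucI order_refl)
  qed
qed

lemma comm_group_inv_cohomology: "comm_group (inv_cohomology T R \<AA> d)"
  unfolding inv_cohomology_def by (rule direct_system.comm_group_direct_limit[OF restriction_system])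

section \<open>Locality\<close>

lemma finite_lattice_box: "finite (lattice_box r :: (int ^ 'n::finite) set)"
proof (rule finite_subset)
  show "(lattice_box r :: (int ^ 'n) set) \<subseteq> vec_lambda ` (UNIV \<rightarrow>\<^sub>E {- int r..int r})"
  proof
    fix u :: "int ^ 'n" assume "u \<in> lattice_box r"
    then have "vec_nth u \<in> UNIV \<rightarrow>\<^sub>E {- int r..int r}"
      using lattice_boxD[of u r] by (auto simp: abs_le_iff minus_le_iff)
    then show "u \<in> vec_lambda ` (UNIV \<rightarrow>\<^sub>E {- int r..int r})"
      by (rule rev_image_eqI) simp
  qed
  show "finite (vec_lambda ` ((UNIV :: 'n set) \<rightarrow>\<^sub>E {- int r..int r}))"
    by (intro finite_imageI finite_PiE) auto
qed

lemma finite_subset_lattice_box: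
  assumes "finite (S :: (int ^ 'n::finite) set)"
  shows "\<exists>q. S \<subseteq> lattice_box q"
  using assms
proof (induction S rule: finite_induct)
  case (insert x S)
  then obtain q where q: "S \<subseteq> lattice_box q" by blast
  have "x \<in> lattice_box (nat (\<Sum>i\<in>UNIV. \<bar>x $ i\<bar>))"
  proof (rule lattice_boxI)
    fix i
    have "\<bar>x $ i\<bar> \<le> (\<Sum>i\<in>UNIV. \<bar>x $ i\<bar>)" by (rule member_le_sum) auto
    then show "\<bar>x $ i\<bar> \<le> int (nat (\<Sum>i\<in>UNIV. \<bar>x $ i\<bar>))" by simp
  qed
  then show ?case
    using q lattice_box_mono[of q "max q (nat (\<Sum>i\<in>UNIV. \<bar>x $ i\<bar>))"]
      lattice_box_mono[of "nat (\<Sum>i\<in>UNIV. \<bar>x $ i\<bar>)" "max q (nat (\<Sum>i\<in>UNIV. \<bar>x $ i\<bar>))"]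
    by (intro exI[of _ "max q (nat (\<Sum>i\<in>UNIV. \<bar>x $ i\<bar>))"]) auto
qed auto

lemma topspace_config_topology [simp]: "topspace config_topology = UNIV"
  by (simp add: config_topology_def)

lemma openin_cylinder:
  fixes a :: "('n::finite, 'a) config"
  shows "openin config_topology {b. \<forall>u\<in>lattice_box q. b u = a u}"
proof -
  have "{b. \<forall>u\<in>lattice_box q. b u = a u} = (\<Pi>\<^sub>E u\<in>UNIV. if u \<in> lattice_box q then {a u} else UNIV)"
    by (auto simp: PiE_iff split: if_splits)
  moreover have "openin config_topology (\<Pi>\<^sub>E u\<in>UNIV. if u \<in> lattice_box q then {a u} else UNIV)"
    unfolding config_topology_def
    by (rule product_topology_basis) (auto intro: finite_subset[OF _ finite_lattice_box[of q]])
  ultimately show ?thesis by simp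
qed

lemma cylinder_in_open:
  fixes a :: "('n::finite, 'a) config"
  assumes "openin config_topology U" "a \<in> U"
  shows "\<exists>q. {b. \<forall>u\<in>lattice_box q. b u = a u} \<subseteq> U"
proof -
  obtain X where X: "a \<in> (\<Pi>\<^sub>E i\<in>UNIV. X i)" "finite {i. X i \<noteq> UNIV}" "(\<Pi>\<^sub>E i\<in>UNIV. X i) \<subseteq> U"
    using product_topology_open_contains_basis[OF assms(1)[unfolded config_topology_def] assms(2)] by auto
  obtain q where q: "{i. X i \<noteq> UNIV} \<subseteq> lattice_box q"
    using finite_subset_lattice_box[OF X(2)] by blast
  have "b \<in> U" if "\<forall>u\<in>lattice_box q. b u = a u" for b
  proof -
    have "b i \<in> X i" for i
      using that q X(1) by (cases "X i = UNIV") (auto simp: PiE_iff)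
    then show ?thesis using X(3) by (auto simp: PiE_iff)
  qed
  then show ?thesis by blast
qed

lemma compact_config_topology: "compactin (config_topology :: ('n::finite, 'a::finite) config topology) UNIV"
proof -
  have "compact_space (discrete_topology (UNIV :: 'a set))"
    by (simp add: compact_space_def finite_imp_compactin)
  then have "compact_space (config_topology :: ('n, 'a) config topology)"
    by (simp add: config_topology_def compact_space_product_topology)
  then show ?thesis by (simp add: compact_space_def)
qed

text \<open>The argument of Curtis, Hedlund and Lyndon: continuity into a discrete space gives each
  point a cylinder on which \<open>f\<close> is constant, and compactness, hence finiteness of the
  alphabet, leaves finitely many of them.\<close>

lemma locally_determined:
  fixes \<AA> :: "('n::finite, 'a::finite) config set"
  assumes "closedin config_topology \<AA>"
    and "continuous_map (subtopology config_topology \<AA>) (discrete_topology UNIV) f"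
  shows "\<exists>q. \<forall>a\<in>\<AA>. \<forall>b\<in>\<AA>. (\<forall>u\<in>lattice_box q. a u = b u) \<longrightarrow> f a = f b"
proof -
  define P where "P a q \<longleftrightarrow> {b. \<forall>u\<in>lattice_box q. b u = a u} \<inter> \<AA> \<subseteq> {b. f b = f a}" for a q
  have "\<exists>q. P a q" if "a \<in> \<AA>" for a
  proof -
    have "openin (subtopology config_topology \<AA>) {x \<in> topspace (subtopology config_topology \<AA>). f x \<in> {f a}}"
      by (rule openin_continuous_map_preimage[OF assms(2)]) simp
    then obtain U where U: "openin config_topology U" "{x \<in> \<AA>. f x = f a} = U \<inter> \<AA>"
      by (auto simp: openin_subtopology)
    then have "a \<in> U" using that by auto
    from cylinder_in_open[OF U(1) this] show ?thesis using U(2) unfolding P_def by blast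
  qed
  then obtain Q where "\<And>a. a \<in> \<AA> \<Longrightarrow> P a (Q a)"
    by metis
  then have Q: "f b = f a" if "a \<in> \<AA>" "b \<in> \<AA>" "\<forall>u\<in>lattice_box (Q a). b u = a u" for a b
    using that unfolding P_def by blast
  have "compactin config_topology \<AA>"
    by (rule closed_compactin[OF compact_config_topology _ assms(1)]) simp
  then have "\<exists>\<F>. finite \<F> \<and> \<F> \<subseteq> (\<lambda>a. {b. \<forall>u\<in>lattice_box (Q a). b u = a u}) ` \<AA> \<and> \<AA> \<subseteq> \<Union>\<F>"
    by (rule compactinD) (auto simp: openin_cylinder)
  then obtain \<F> where \<F>: "finite \<F>" "\<F> \<subseteq> (\<lambda>a. {b. \<forall>u\<in>lattice_box (Q a). b u = a u}) ` \<AA>" "\<AA> \<subseteq> \<Union>\<F>"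
    by blast
  from finite_subset_image[OF \<F>(1,2)] obtain F
    where F: "F \<subseteq> \<AA>" "finite F" and \<F>_eq: "\<F> = (\<lambda>a. {b. \<forall>u\<in>lattice_box (Q a). b u = a u}) ` F"
    by blast
  \<comment> \<open>The sum is a convenient upper bound for the finitely many radii.\<close>
  define q where "q = (\<Sum>a\<in>F. Q a)"
  have "f a = f b" if ab: "a \<in> \<AA>" "b \<in> \<AA>" "\<forall>u\<in>lattice_box q. a u = b u" for a b
  proof -
    obtain c where c: "c \<in> F" "\<forall>u\<in>lattice_box (Q c). a u = c u" using \<F>(3) ab(1) unfolding \<F>_eq by blast
    have "Q c \<le> q" unfolding q_def using c(1) F(2) by (intro member_le_sum) auto
    then have "\<forall>u\<in>lattice_box (Q c). b u = c u"
      using ab(3) c(2) lattice_box_mono by (metis subsetD)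
    then have "f b = f c" using Q[of c b] c(1) F(1) ab(2) by blast
    moreover have "f a = f c" using Q[of c a] c F(1) ab(1) by blast
    ultimately show ?thesis by simp
  qed
  then show ?thesis by blast
qed

section \<open>The radius of a cellular automaton and its action on tile complexes\<close>

lemma shift_apply [simp]: "shift v a z = a (z + v)"
  by (simp add: shift_def)

lemma pattern_eq_iff: "pattern a z U = pattern b w U \<longleftrightarrow> (\<forall>u\<in>U. a (z + u) = b (w + u))"
  by (auto simp: pattern_def restrict_def fun_eq_iff)

lemma cellular_automaton_has_radius:
  fixes \<Phi> :: "('n::finite, 'a::finite) config \<Rightarrow> ('n, 'a) config"
  assumes "cellular_automaton \<Phi>"
  shows "\<exists>q. has_radius \<Phi> q"
proof -
  have cont: "continuous_map config_topology config_topology \<Phi>"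
    and comm: "\<And>v a. \<Phi> (shift v a) = shift v (\<Phi> a)"
    using assms by (auto simp: cellular_automaton_def)
  have "continuous_map config_topology (discrete_topology UNIV) (\<lambda>a :: ('n, 'a) config. a 0)"
    unfolding config_topology_def by (rule continuous_map_product_projection) simp
  from continuous_map_compose[OF cont this]
  have "continuous_map (subtopology config_topology UNIV) (discrete_topology UNIV) (\<lambda>a. \<Phi> a 0)"
    by (simp add: o_def)
  moreover have "closedin config_topology (UNIV :: ('n, 'a) config set)"
    using closedin_topspace[of "config_topology :: ('n, 'a) config topology"] by simp
  ultimately obtain q where q: "\<And>a b. (\<forall>u\<in>lattice_box q. a u = b u) \<Longrightarrow> \<Phi> a 0 = \<Phi> b 0"
    using locally_determined[of UNIV "\<lambda>a. \<Phi> a 0"] by auto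
  \<comment> \<open>A pattern is itself a configuration, with a default value outside the box, so
    \<open>\<Phi>\<close> applies to it and the local rule can be read off at 0.\<close>
  have "\<Phi> a z = \<Phi> (pattern a z (lattice_box q)) 0" for a z
  proof -
    have "\<Phi> a z = \<Phi> (shift z a) 0" by (simp add: comm)
    also have "\<dots> = \<Phi> (pattern a z (lattice_box q)) 0"
      by (rule q) (simp add: pattern_def add.commute)
    finally show ?thesis .
  qed
  then show ?thesis unfolding has_radius_def by (intro exI[of _ q] exI[of _ "\<lambda>p. \<Phi> p 0"]) auto
qed

lemma has_radius_local:
  assumes "has_radius \<Phi> q" "\<And>v. v \<in> lattice_box q \<Longrightarrow> a (z + v) = b (w + v)"
  shows "\<Phi> a z = \<Phi> b w"
proof -
  obtain \<phi> where "\<And>a z. \<Phi> a z = \<phi> (pattern a z (lattice_box q))"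
    using assms(1) unfolding has_radius_def by blast
  moreover have "pattern a z (lattice_box q) = pattern b w (lattice_box q)"
    using assms(2) by (simp add: pattern_eq_iff)
  ultimately show ?thesis by simp
qed

lemma lattice_box_add: "u \<in> lattice_box r \<Longrightarrow> v \<in> lattice_box q \<Longrightarrow> u + v \<in> lattice_box (r + q)"
proof (rule lattice_boxI)
  fix i assume "u \<in> lattice_box r" "v \<in> lattice_box q"
  then show "\<bar>(u + v) $ i\<bar> \<le> int (r + q)"
    using lattice_boxD[of u r i] lattice_boxD[of v q i] by simp
qed

lemma ca_tile_map_restrict:
  assumes "has_radius \<Phi> q"
  shows "ca_tile_map \<Phi> r (box_restrict (r + q) c) = ca_tile_map \<Phi> r c"
proof -
  have "\<Phi> (box_restrict (r + q) c) u = \<Phi> c u" if "u \<in> lattice_box r" for u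
    by (rule has_radius_local[OF assms]) (simp add: lattice_box_add that)
  then show ?thesis
    unfolding ca_tile_map_def by (auto simp: restrict_def fun_eq_iff)
qed

text \<open>The window of radius \<open>q\<close> around a point of the small box stays in the large
  one, and \<open>u $ i < int r\<close> gives \<open>(u + v) $ i < int (r + q)\<close>; so the
  overlap of two patterns determines the overlap of their images.\<close>

lemma tile_map_ca:
  fixes \<AA> :: "('n::finite, 'a) config set"
  assumes "has_radius \<Phi> q" "\<Phi> ` \<AA> \<subseteq> \<AA>"
  shows "tile_map \<AA> (r + q) r (ca_tile_map \<Phi> r)"
  unfolding tile_map_def
proof (intro conjI ballI allI impI)
  fix c assume "c \<in> patterns \<AA> (lattice_box (r + q))"
  then obtain a where "a \<in> \<AA>" "c = box_restrict (r + q) a" by (auto simp: patterns_def)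
  then have "ca_tile_map \<Phi> r c = box_restrict r (\<Phi> a)" "\<Phi> a \<in> \<AA>"
    using ca_tile_map_restrict[OF assms(1), of r a] assms(2) by (auto simp: ca_tile_map_def)
  then show "ca_tile_map \<Phi> r c \<in> patterns \<AA> (lattice_box r)"
    unfolding patterns_def by blast
next
  fix c c' :: "('n, 'a) config" and i u
  assume c: "\<forall>u\<in>lattice_box (r + q). u $ i < int (r + q) \<longrightarrow> c (u + axis i 1) = c' u"
    and u: "u \<in> lattice_box r" "u $ i < int r"
  have "\<Phi> c (u + axis i 1) = \<Phi> c' u"
  proof (rule has_radius_local[OF assms(1)])
    fix v :: "int ^ 'n" assume v: "v \<in> lattice_box q"
    have "(u + v) $ i < int (r + q)" using lattice_boxD[OF v, of i] u(2) by simp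
    then have "c (u + v + axis i 1) = c' (u + v)" using c lattice_box_add[OF u(1) v] by blast
    then show "c (u + axis i 1 + v) = c' (u + v)" by (simp add: ac_simps)
  qed
  then show "ca_tile_map \<Phi> r c (u + axis i 1) = ca_tile_map \<Phi> r c' u"
    using u lattice_box_add_axis[OF u] by (simp add: ca_tile_map_def)
qed

lemma ca_pullback_restrict:
  fixes \<AA> :: "('n::{finite,linorder}, 'a) config set"
  assumes "has_radius \<Phi> q" "\<Phi> ` \<AA> \<subseteq> \<AA>" "r + q \<le> t"
  shows "tile_pullback \<AA> d t (r + q) (box_restrict (r + q)) (tile_pullback \<AA> d (r + q) r (ca_tile_map \<Phi> r) C)
    = tile_pullback \<AA> d t r (ca_tile_map \<Phi> r) C"
proof -
  have "(\<lambda>c. ca_tile_map \<Phi> r (box_restrict (r + q) c)) = ca_tile_map \<Phi> r"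
    by (rule ext, rule ca_tile_map_restrict[OF assms(1)])
  then show ?thesis
    using tile_pullback_comp[OF tile_map_ca[OF assms(1,2)] tile_map_restrict[OF assms(3)], where d = d and C = C]
    by (simp only:)
qed

lemma ca_pullback_step:
  fixes \<AA> :: "('n::{finite,linorder}, 'a) config set"
  assumes "has_radius \<Phi> q" "\<Phi> ` \<AA> \<subseteq> \<AA>"
  shows "tile_pullback \<AA> d (Suc r + q) (Suc r) (ca_tile_map \<Phi> (Suc r)) (tile_pullback \<AA> d (Suc r) r (box_restrict r) C)
    = tile_pullback \<AA> d (Suc r + q) r (ca_tile_map \<Phi> r) C"
proof -
  have "(\<lambda>c. box_restrict r (ca_tile_map \<Phi> (Suc r) c)) = ca_tile_map \<Phi> r"
    unfolding ca_tile_map_def by (rule ext, rule box_restrict_restrict) simp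
  then show ?thesis
    using tile_pullback_comp[OF tile_map_restrict[of r "Suc r" \<AA>] tile_map_ca[OF assms, of "Suc r"], where d = d and C = C]
    by (simp only: le_SucI order_refl)
qed

text \<open>Restricting before or after the automaton gives the same pullback, namely the one along
  \<open>ca_tile_map \<Phi> r\<close> from radius \<open>r + q + 1\<close>.\<close>

lemma ca_system:
  assumes "has_radius \<Phi> q" "\<Phi> ` \<AA> \<subseteq> \<AA>"
  shows "direct_system_endo R (tile_inv_cohomology \<AA> d) (restriction_map \<AA> d) q
     (\<lambda>r. cohomology_pullback \<AA> d (r + q) r (ca_tile_map \<Phi> r))"
proof (rule direct_system_endo.intro[OF restriction_system], rule direct_system_endo_axioms.intro)
  fix r
  show "cohomology_pullback \<AA> d (r + q) r (ca_tile_map \<Phi> r) \<in> hom (tile_inv_cohomology \<AA> d r) (tile_inv_cohomology \<AA> d (r + q))"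
    by (rule cohomology_pullback_hom[OF tile_map_ca[OF assms]])
  fix X assume "X \<in> carrier (tile_inv_cohomology \<AA> d r)"
  then obtain C where X: "X = inv_cohomology_class \<AA> d r C"
    by (auto simp: carrier_tile_inv_cohomology)
  have "restriction_map \<AA> d (r + q) (cohomology_pullback \<AA> d (r + q) r (ca_tile_map \<Phi> r) X)
    = inv_cohomology_class \<AA> d (Suc (r + q)) (tile_pullback \<AA> d (Suc (r + q)) r (ca_tile_map \<Phi> r) C)"
    unfolding X cohomology_pullback_class[OF tile_map_ca[OF assms]] restriction_map_class
    by (subst ca_pullback_restrict[OF assms]) simp_all
  moreover have "cohomology_pullback \<AA> d (Suc r + q) (Suc r) (ca_tile_map \<Phi> (Suc r)) (restriction_map \<AA> d r X)
    = inv_cohomology_class \<AA> d (Suc r + q) (tile_pullback \<AA> d (Suc r + q) r (ca_tile_map \<Phi> r) C)"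
    unfolding X restriction_map_class cohomology_pullback_class[OF tile_map_ca[OF assms]] ca_pullback_step[OF assms] ..
  ultimately show "cohomology_pullback \<AA> d (Suc r + q) (Suc r) (ca_tile_map \<Phi> (Suc r)) (restriction_map \<AA> d r X)
    = restriction_map \<AA> d (r + q) (cohomology_pullback \<AA> d (r + q) r (ca_tile_map \<Phi> r) X)"
    by simp
qed

context
  fixes \<AA> :: "('n::{finite,linorder}, 'a::finite) config set"
    and \<Phi> :: "('n, 'a) config \<Rightarrow> ('n, 'a) config"
    and R :: nat
  assumes ca: "cellular_automaton \<Phi>" and stable: "\<Phi> ` \<AA> \<subseteq> \<AA>"
begin

lemma some_radius: "has_radius \<Phi> (SOME q. has_radius \<Phi> q)"
  using cellular_automaton_has_radius[OF ca] by (rule someI_ex)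

lemma inv_cohomology_map_hom:
  "inv_cohomology_map T R \<AA> d \<Phi> \<in> hom (inv_cohomology T R \<AA> d) (inv_cohomology T R \<AA> d)"
  unfolding inv_cohomology_map_def Let_def inv_cohomology_def
  by (rule direct_system_endo.limit_map_hom[OF ca_system[OF some_radius stable]])

lemma inv_limit_class_restrict:
  assumes "R \<le> r" "r \<le> t" "C \<in> inv_cocycles \<AA> r d"
  shows "inv_limit_class R \<AA> d t (tile_pullback \<AA> d t r (box_restrict r) C) = inv_limit_class R \<AA> d r C"
proof -
  have "inv_cohomology_class \<AA> d r C \<in> carrier (tile_inv_cohomology \<AA> d r)"
    using assms(3) by (simp add: carrier_tile_inv_cohomology)
  from direct_system.limit_class_transition[OF restriction_system assms(1,2) this] show ?thesis
    unfolding inv_limit_class_def transition_restriction_class[OF assms(1,2) inv_cocycles_cochains[OF assms(3)]] .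
qed

text \<open>The endomorphism is defined with one chosen radius \<open>p\<close>. The pullbacks for
  \<open>p\<close> and for any other radius \<open>q\<close> become equal when restricted to radius
  \<open>r + max p q\<close>.\<close>

lemma inv_cohomology_map_class:
  assumes "has_radius \<Phi> q" "R \<le> r" "C \<in> inv_cocycles \<AA> r d"
  shows "inv_cohomology_map T R \<AA> d \<Phi> (inv_limit_class R \<AA> d r C)
    = inv_limit_class R \<AA> d (r + q) (tile_pullback \<AA> d (r + q) r (ca_tile_map \<Phi> r) C)"
proof -
  define p where "p = (SOME q. has_radius \<Phi> q)"
  have p: "has_radius \<Phi> p" unfolding p_def by (rule some_radius)
  have cl: "inv_cohomology_class \<AA> d r C \<in> carrier (tile_inv_cohomology \<AA> d r)"
    using assms(3) by (simp add: carrier_tile_inv_cohomology)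
  let ?t = "r + max p q"
  have *: "inv_limit_class R \<AA> d (r + k) (tile_pullback \<AA> d (r + k) r (ca_tile_map \<Phi> r) C)
      = inv_limit_class R \<AA> d ?t (tile_pullback \<AA> d ?t r (ca_tile_map \<Phi> r) C)"
    if k: "has_radius \<Phi> k" "k \<le> max p q" for k
    using inv_limit_class_restrict[of "r + k" ?t "tile_pullback \<AA> d (r + k) r (ca_tile_map \<Phi> r) C" d] k(2) assms(2)
      tile_pullback_cocycles[OF tile_map_ca[OF k(1) stable] assms(3)]
      ca_pullback_restrict[OF k(1) stable, of r ?t d C]
    by simp
  have "inv_cohomology_map T R \<AA> d \<Phi> (inv_limit_class R \<AA> d r C)
    = limit_class R (tile_inv_cohomology \<AA> d) (restriction_map \<AA> d) (r + p)
       (cohomology_pullback \<AA> d (r + p) r (ca_tile_map \<Phi> r) (inv_cohomology_class \<AA> d r C))"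
    unfolding inv_cohomology_map_def Let_def inv_limit_class_def p_def[symmetric]
    by (rule direct_system_endo.limit_map_class[OF ca_system[OF p stable] assms(2) cl])
  also have "\<dots> = inv_limit_class R \<AA> d (r + p) (tile_pullback \<AA> d (r + p) r (ca_tile_map \<Phi> r) C)"
    unfolding inv_limit_class_def cohomology_pullback_class[OF tile_map_ca[OF p stable]] ..
  finally show ?thesis using *[OF p] *[OF assms(1)] by simp
qed

end

section \<open>Evaluation of invariant cochains on configurations\<close>

lemma patterns_restrict: "r \<le> s \<Longrightarrow> c \<in> patterns \<AA> (lattice_box s) \<Longrightarrow> box_restrict r c \<in> patterns \<AA> (lattice_box r)"
  by (rule tile_map_patterns[OF tile_map_restrict])

lemma box_restrict_pattern: "r \<le> s \<Longrightarrow> box_restrict r (pattern a z (lattice_box s)) = pattern a z (lattice_box r)"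
  unfolding pattern_def by (rule box_restrict_restrict)

text \<open>If no radius from \<open>r\<close> on were admissible, the supremum would be at most
  \<open>r - 1\<close>. Positivity of \<open>r\<close> matters: the empty supremum is 0, so every
  point belongs to the good set of range 0.\<close>

lemma good_set_pattern:
  assumes "z \<in> good_set \<AA> r a" "0 < r" "s \<le> r"
  shows "pattern a z (lattice_box s) \<in> patterns \<AA> (lattice_box s)"
proof -
  let ?S = "{enat r | r. pattern a z (lattice_box r) \<in> patterns \<AA> (lattice_box r)}"
  have "\<exists>r'\<ge>r. pattern a z (lattice_box r') \<in> patterns \<AA> (lattice_box r')"
  proof (rule ccontr)
    assume *: "\<not> ?thesis"
    have "x \<le> enat (r - 1)" if "x \<in> ?S" for x
    proof -
      from that obtain k where k: "x = enat k" "pattern a z (lattice_box k) \<in> patterns \<AA> (lattice_box k)"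
        by blast
      then have "\<not> r \<le> k" using * by blast
      then show ?thesis by (simp add: k(1))
    qed
    then have "Sup ?S \<le> enat (r - 1)" by (rule Sup_least)
    moreover have "enat r \<le> Sup ?S" using assms(1) by (simp add: good_set_def admissibility_radius_def)
    ultimately have "enat r \<le> enat (r - 1)" by (rule order_trans[rotated])
    then show False using assms(2) by simp
  qed
  then obtain r' where r': "r \<le> r'" "pattern a z (lattice_box r') \<in> patterns \<AA> (lattice_box r')" by blast
  have "s \<le> r'" using assms(3) r'(1) by simp
  from patterns_restrict[OF this r'(2)] show ?thesis unfolding box_restrict_pattern[OF \<open>s \<le> r'\<close>] .
qed

lemma good_setI: "pattern a z (lattice_box r) \<in> patterns \<AA> (lattice_box r) \<Longrightarrow> z \<in> good_set \<AA> r a"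
  by (auto simp: good_set_def admissibility_radius_def intro: Sup_upper)

lemma subshift_shift: "subshift \<AA> \<Longrightarrow> a \<in> \<AA> \<Longrightarrow> shift v a \<in> \<AA>"
  by (auto simp: subshift_def)

lemma pattern_eq_restrict_shift: "pattern a z U = restrict (shift z a) U"
  by (simp add: pattern_def shift_def add.commute)

lemma subshift_pattern: "subshift \<AA> \<Longrightarrow> a \<in> \<AA> \<Longrightarrow> pattern a z U \<in> patterns \<AA> U"
  unfolding patterns_def pattern_eq_restrict_shift by (intro imageI subshift_shift)

lemma pattern_realize:
  assumes "subshift \<AA>" "c \<in> patterns \<AA> U"
  obtains a where "a \<in> \<AA>" "pattern a z U = c"
proof -
  obtain b where b: "b \<in> \<AA>" "c = restrict b U" using assms(2) by (auto simp: patterns_def)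
  have "pattern (shift (- z) b) z U = c"
    unfolding pattern_eq_restrict_shift b(2) by (rule arg_cong[where f="\<lambda>x. restrict x U"]) (simp add: fun_eq_iff)
  then show thesis using that subshift_shift[OF assms(1) b(1)] by blast
qed

text \<open>The cell is read in the tile at its lowest corner \<open>w\<close>. The configuration
  need not lie in the subshift; the value is meaningful wherever its pattern at \<open>w\<close> is
  admissible.\<close>

definition cochain_eval ::
  "('n::finite, 'a) config set \<Rightarrow> nat \<Rightarrow> ('n, 'a, 'g) cochain \<Rightarrow> ('n, 'a) config \<Rightarrow> 'n cell \<Rightarrow> 'g" where
  "cochain_eval \<AA> s C a = (\<lambda>(w, J). C (glue \<AA> s `` {(w, pattern a w (lattice_box s), w, J)}))"

lemma vertex_lowest: "w \<in> vertices (w, J)"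
  by (simp add: vertices_def)

lemma vertex_axis: "j \<in> J \<Longrightarrow> w + axis j 1 \<in> vertices (w, J)"
  by (auto simp: vertices_def axis_def)

text \<open>A coboundary reads an upper face in the tile at \<open>w\<close>, but
  \<open>cochain_eval\<close> reads it in the tile at its own corner \<open>w + axis j 1\<close>.
  Both patterns come from \<open>a\<close>, so they overlap and the tiles are glued, provided that
  both are admissible.\<close>

lemma cochain_eval_face:
  fixes \<AA> :: "('n::{finite,linorder}, 'a) config set"
  assumes good: "\<And>v. v \<in> vertices (w, J) \<Longrightarrow> pattern a v (lattice_box s) \<in> patterns \<AA> (lattice_box s)"
    and y: "y \<in> Poly_Mapping.keys (cell_boundary (w, J))"
  shows "C (glue \<AA> s `` {(w, pattern a w (lattice_box s), y)}) = cochain_eval \<AA> s C a y"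
  using y
proof (rule keys_cell_boundaryE)
  fix j assume j: "j \<in> J" "y = (w + axis j 1, J - {j})"
  let ?c = "pattern a w (lattice_box s)" and ?c' = "pattern a (w + axis j 1) (lattice_box s)"
  have "(w, ?c, y) \<in> tile_faces \<AA> s"
    by (rule tile_faces_boundary[OF tile_faces_lowest[OF good[OF vertex_lowest]] y])
  moreover have "(w + axis j 1, ?c', y) \<in> tile_faces \<AA> s"
    unfolding j(2) by (rule tile_faces_lowest[OF good[OF vertex_axis[OF j(1)]]])
  moreover have "?c (u + axis j 1) = ?c' u" if "u \<in> lattice_box s" "u $ j < int s" for u
    using that lattice_box_add_axis[OF that] by (simp add: pattern_def ac_simps)
  ultimately have "((w, ?c, y), (w + axis j 1, ?c', y)) \<in> glue_step \<AA> s"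
    unfolding glue_step_def by (auto simp: j(2) axis_def)
  then show ?thesis by (simp add: glue_class_step cochain_eval_def j(2))
qed (simp add: cochain_eval_def)

lemma cochain_eval_coboundary:
  fixes \<AA> :: "('n::{finite,linorder}, 'a) config set"
  assumes "\<And>v. v \<in> vertices y \<Longrightarrow> pattern a v (lattice_box s) \<in> patterns \<AA> (lattice_box s)" "y \<in> cells (Suc d)"
  shows "cochain_eval \<AA> s (tile_coboundary \<AA> s d C) a y = chain_eval (cochain_eval \<AA> s C a) (cell_boundary y)"
proof -
  obtain w J where y: "y = (w, J)" by (cases y)
  have "(w, pattern a w (lattice_box s), y) \<in> tile_faces \<AA> s"
    using assms(1)[unfolded y, OF vertex_lowest] unfolding y by (rule tile_faces_lowest)
  then have "cochain_eval \<AA> s (tile_coboundary \<AA> s d C) a y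
      = chain_eval (\<lambda>y'. C (glue \<AA> s `` {(w, pattern a w (lattice_box s), y')})) (cell_boundary y)"
    using tile_coboundary_value[OF _ assms(2)] by (simp add: y cochain_eval_def)
  also have "\<dots> = chain_eval (cochain_eval \<AA> s C a) (cell_boundary y)"
    by (rule chain_eval_cong) (use cochain_eval_face assms(1) in \<open>unfold y, blast\<close>)
  finally show ?thesis .
qed

text \<open>Stokes' formula in the region where \<open>a\<close> is admissible at radius
  \<open>s\<close>; as a whole \<open>a\<close> may be defective.\<close>

lemma cochain_eval_coboundary_chain:
  fixes \<AA> :: "('n::{finite,linorder}, 'a) config set"
  assumes "\<And>y v. y \<in> Poly_Mapping.keys \<zeta> \<Longrightarrow> v \<in> vertices y \<Longrightarrow> pattern a v (lattice_box s) \<in> patterns \<AA> (lattice_box s)"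
    and "\<zeta> \<in> cubical_chains (Suc d)"
  shows "chain_eval (cochain_eval \<AA> s (tile_coboundary \<AA> s d C) a) \<zeta> = chain_eval (cochain_eval \<AA> s C a) (cubical_boundary \<zeta>)"
  unfolding cubical_boundary_def chain_eval_extend
  using assms by (intro chain_eval_cong cochain_eval_coboundary) (auto simp: cubical_chains_def)

text \<open>Two configurations appear so as to cover restriction, where \<open>b\<close> is
  \<open>a\<close>, and the automaton, where \<open>b\<close> is \<open>\<Phi> a\<close>.\<close>

lemma cochain_eval_pullback:
  fixes \<AA> :: "('n::{finite,linorder}, 'a) config set"
  assumes "tile_map \<AA> t s \<psi>" "pattern a w (lattice_box t) \<in> patterns \<AA> (lattice_box t)"
    and "\<psi> (pattern a w (lattice_box t)) = pattern b w (lattice_box s)" "(w, J) \<in> cells d"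
  shows "cochain_eval \<AA> t (tile_pullback \<AA> d t s \<psi> C) a (w, J) = cochain_eval \<AA> s C b (w, J)"
  using tile_pullback_value[OF assms(1) tile_faces_lowest[OF assms(2)] assms(4)] assms(3)
  by (simp add: cochain_eval_def)

lemma cochain_eval_restrict:
  fixes \<AA> :: "('n::{finite,linorder}, 'a) config set"
  assumes "s \<le> t" "pattern a w (lattice_box t) \<in> patterns \<AA> (lattice_box t)" "(w, J) \<in> cells d"
  shows "cochain_eval \<AA> t (tile_pullback \<AA> d t s (box_restrict s) C) a (w, J) = cochain_eval \<AA> s C a (w, J)"
  by (rule cochain_eval_pullback[OF tile_map_restrict[OF assms(1)] assms(2) box_restrict_pattern[OF assms(1)] assms(3)])

lemma ca_pattern:
  assumes "has_radius \<Phi> q"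
  shows "ca_tile_map \<Phi> s (pattern a w (lattice_box (s + q))) = pattern (\<Phi> a) w (lattice_box s)"
proof -
  have "\<Phi> (pattern a w (lattice_box (s + q))) u = \<Phi> a (w + u)" if "u \<in> lattice_box s" for u
    by (rule has_radius_local[OF assms]) (simp add: pattern_def lattice_box_add that add.assoc)
  then show ?thesis by (auto simp: ca_tile_map_def pattern_def restrict_def fun_eq_iff)
qed

lemma cochain_eval_ca:
  fixes \<AA> :: "('n::{finite,linorder}, 'a) config set"
  assumes "has_radius \<Phi> q" "\<Phi> ` \<AA> \<subseteq> \<AA>"
    and "pattern a w (lattice_box (s + q)) \<in> patterns \<AA> (lattice_box (s + q))" "(w, J) \<in> cells d"
  shows "cochain_eval \<AA> (s + q) (tile_pullback \<AA> d (s + q) s (ca_tile_map \<Phi> s) C) a (w, J)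
    = cochain_eval \<AA> s C (\<Phi> a) (w, J)"
  by (rule cochain_eval_pullback[OF tile_map_ca[OF assms(1,2)] assms(3) ca_pattern[OF assms(1)] assms(4)])

lemma good_set_ca:
  assumes "has_radius \<Phi> q" "\<Phi> ` \<AA> \<subseteq> \<AA>" "z \<in> good_set \<AA> r' a" "0 < r'" "r + q \<le> r'"
  shows "z \<in> good_set \<AA> r (\<Phi> a)"
proof (rule good_setI)
  have "pattern a z (lattice_box (r + q)) \<in> patterns \<AA> (lattice_box (r + q))"
    by (rule good_set_pattern[OF assms(3,4,5)])
  from tile_map_patterns[OF tile_map_ca[OF assms(1,2)] this]
  show "pattern (\<Phi> a) z (lattice_box r) \<in> patterns \<AA> (lattice_box r)"
    unfolding ca_pattern[OF assms(1)] .
qed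

text \<open>Nonemptiness at every range is the form that survives the loss of \<open>q\<close> in
  \<open>good_set_ca\<close>.\<close>

lemma tilde_iff_good_set: "a \<in> tilde \<AA> \<longleftrightarrow> (\<forall>r. good_set \<AA> r a \<noteq> {})"
proof
  assume a: "a \<in> tilde \<AA>"
  show "\<forall>r. good_set \<AA> r a \<noteq> {}"
  proof
    fix r
    have "enat r < (SUP z. admissibility_radius \<AA> a z)" using a by (simp add: tilde_def)
    then obtain z where "enat r < admissibility_radius \<AA> a z" unfolding less_SUP_iff by blast
    then have "z \<in> good_set \<AA> r a" by (simp add: good_set_def)
    then show "good_set \<AA> r a \<noteq> {}" by blast
  qed
next
  assume *: "\<forall>r. good_set \<AA> r a \<noteq> {}"
  have le: "enat r \<le> (SUP z. admissibility_radius \<AA> a z)" for r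
  proof -
    obtain z where "enat r \<le> admissibility_radius \<AA> a z"
      using *[rule_format, of r] by (auto simp: good_set_def)
    also have "\<dots> \<le> (SUP z. admissibility_radius \<AA> a z)" by (rule SUP_upper) simp
    finally show ?thesis .
  qed
  show "a \<in> tilde \<AA>"
    unfolding tilde_def
  proof (rule CollectI, cases "SUP z. admissibility_radius \<AA> a z")
    case (enat r)
    then show "(SUP z. admissibility_radius \<AA> a z) = \<infinity>" using le[of "Suc r"] by simp
  qed
qed

lemma tilde_ca:
  assumes "has_radius \<Phi> q" "\<Phi> ` \<AA> \<subseteq> \<AA>" "a \<in> tilde \<AA>"
  shows "\<Phi> a \<in> tilde \<AA>"
  unfolding tilde_iff_good_set
proof
  fix r
  obtain z where "z \<in> good_set \<AA> (Suc (r + q)) a"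
    using assms(3) unfolding tilde_iff_good_set by blast
  then have "z \<in> good_set \<AA> r (\<Phi> a)"
    by (rule good_set_ca[OF assms(1,2)]) auto
  then show "good_set \<AA> r (\<Phi> a) \<noteq> {}" by blast
qed

section \<open>Equivariant cocycles and invariant cocycles\<close>

text \<open>The inequality is strict because \<open>cell_box\<close> omits the layer at
  \<open>r\<close> in the constrained directions.\<close>

lemma lattice_box_cell_box:
  fixes J :: "'n::finite set"
  assumes "s < r"
  shows "lattice_box s \<subseteq> cell_box J r"
proof
  fix u :: "int ^ 'n" assume u: "u \<in> lattice_box s"
  have "u \<in> lattice_box r"
    using subsetD[OF lattice_box_mono u, of r] assms by simp
  moreover have "u $ i < int r" for i
    using lattice_boxD[OF u, of i] assms by simp
  ultimately show "u \<in> cell_box J r" by (simp add: cell_box_def)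
qed

lemma cell_box_lattice_box: "cell_box J r \<subseteq> lattice_box r"
  by (auto simp: cell_box_def)

lemma equivariant_cocycle_shift:
  assumes "C \<in> equivariant_cocycles \<AA> d" "a \<in> \<AA>" "card J = d"
  shows "C (frag_of (z, J)) a = C (frag_of (0, J)) (shift z a)"
proof -
  have "frag_of (0, J) \<in> cubical_chains d"
    using assms(3) by (simp add: cubical_chains_def cells_def keys_frag_of)
  then have "C (frag_of (0, J)) (shift z a) = C (translate_chain z (frag_of (0, J))) a"
    using assms(1,2) unfolding equivariant_cocycles_def by blast
  then show ?thesis by (simp add: translate_chain_def translate_cell_def)
qed

lemma equivariant_cocycle_chain_eval:
  assumes "C \<in> equivariant_cocycles \<AA> d" "a \<in> \<AA>" "\<zeta> \<in> cubical_chains d"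
  shows "C \<zeta> a = chain_eval (\<lambda>y. C (frag_of y) a) \<zeta>"
proof -
  have add: "C (x + y) a = C x a + C y a" if "x \<in> cubical_chains d" "y \<in> cubical_chains d" for x y
    using assms(1,2) that unfolding equivariant_cocycles_def by blast
  have zero: "C 0 a = 0"
    using add[of 0 0] by (simp add: cubical_chains_def)
  have "Poly_Mapping.keys \<zeta> \<subseteq> cells d" using assms(3) by (simp add: cubical_chains_def)
  \<comment> \<open>Additivity is available on d-chains only, so membership is carried through the
    induction.\<close>
  then have "\<zeta> \<in> cubical_chains d \<and> C \<zeta> a = chain_eval (\<lambda>y. C (frag_of y) a) \<zeta>"
  proof (induction \<zeta> rule: frag_induction)
    case (diff x y)
    have xy: "x - y \<in> cubical_chains d"
      using diff keys_diff[of x y] by (auto simp: cubical_chains_def)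
    then have "C x a = C (x - y) a + C y a" using add[of "x - y" y] diff by simp
    then show ?case using xy diff by (simp add: chain_eval_diff)
  qed (auto simp: zero cubical_chains_def keys_frag_of)
  then show ?thesis by blast
qed

lemma equivariant_cocycle_boundary:
  "C \<in> equivariant_cocycles \<AA> d \<Longrightarrow> a \<in> \<AA> \<Longrightarrow> \<beta> \<in> cubical_chains (Suc d) \<Longrightarrow> C (cubical_boundary \<beta>) a = 0"
  unfolding equivariant_cocycles_def by blast

text \<open>Compactness gives a radius for each of the finitely many cells at the origin, and the
  sum of these radii serves all of them. Equivariance will carry locality to the other
  cells.\<close>

lemma equivariant_cocycle_local:
  fixes \<AA> :: "('n::{finite,linorder}, 'a::finite) config set"
  assumes "C \<in> equivariant_cocycles \<AA> d" "subshift \<AA>"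
  shows "\<exists>q. \<forall>J a b. card J = d \<longrightarrow> a \<in> \<AA> \<longrightarrow> b \<in> \<AA> \<longrightarrow> (\<forall>u\<in>lattice_box q. a u = b u) \<longrightarrow>
    C (frag_of (0, J)) a = C (frag_of (0, J)) b"
proof -
  define P where "P J q \<longleftrightarrow> (\<forall>a\<in>\<AA>. \<forall>b\<in>\<AA>. (\<forall>u\<in>lattice_box q. a u = b u) \<longrightarrow> C (frag_of (0, J)) a = C (frag_of (0, J)) b)" for J q
  have "\<exists>q. P J q" if J: "card J = d" for J
    unfolding P_def
  proof (rule locally_determined)
    show "closedin config_topology \<AA>" using assms(2) by (simp add: subshift_def)
    have "frag_of (0, J) \<in> cubical_chains d"
      using J by (simp add: cubical_chains_def cells_def keys_frag_of)
    then have 1: "continuous_map (subtopology config_topology \<AA>)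
        (prod_topology (discrete_topology (cubical_chains d)) (subtopology config_topology \<AA>)) (\<lambda>a. (frag_of (0, J), a))"
      by (intro continuous_map_pairedI) auto
    have 2: "continuous_map (prod_topology (discrete_topology (cubical_chains d)) (subtopology config_topology \<AA>))
       (discrete_topology UNIV) (\<lambda>(\<zeta>, a). C \<zeta> a)"
      using assms(1) unfolding equivariant_cocycles_def by blast
    show "continuous_map (subtopology config_topology \<AA>) (discrete_topology UNIV) (\<lambda>a. C (frag_of (0, J)) a)"
      using continuous_map_compose[OF 1 2] by (simp add: o_def)
  qed
  then have "\<exists>q. card J = d \<longrightarrow> P J q" for J by blast
  then obtain Q where Q: "\<And>J. card J = d \<Longrightarrow> P J (Q J)" by metis
  have "C (frag_of (0, J)) a = C (frag_of (0, J)) b"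
    if "card J = d" "a \<in> \<AA>" "b \<in> \<AA>" "\<forall>u\<in>lattice_box (\<Sum>J\<in>UNIV. Q J). a u = b u" for J a b
  proof -
    have "Q J \<le> (\<Sum>J\<in>UNIV. Q J)" by (rule member_le_sum) auto
    then have "\<forall>u\<in>lattice_box (Q J). a u = b u" using that(4) lattice_box_mono by blast
    then show ?thesis using Q[OF that(1)] that(2,3) unfolding P_def by blast
  qed
  then show ?thesis by blast
qed

section \<open>From equivariant cocycles to invariant cocycles of a tile complex\<close>

definition tile_cocycle ::
  "('n::{finite,linorder}, 'a) config set \<Rightarrow> nat \<Rightarrow> nat \<Rightarrow>
   (('n cell \<Rightarrow>\<^sub>0 int) \<Rightarrow> ('n, 'a) config \<Rightarrow> 'g::ab_group_add) \<Rightarrow> ('n, 'a, 'g) cochain" where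
  "tile_cocycle \<AA> r d C = face_cochain \<AA> r d (\<lambda>(z, c, w, J).
     if card J = d then C (frag_of (w - z, J)) (SOME a. a \<in> \<AA> \<and> box_restrict r a = c) else 0)"

context
  fixes \<AA> :: "('n::{finite,linorder}, 'a) config set" and d q r :: nat
    and C :: "('n cell \<Rightarrow>\<^sub>0 int) \<Rightarrow> ('n, 'a) config \<Rightarrow> 'g::ab_group_add"
  assumes C: "C \<in> equivariant_cocycles \<AA> d" and shift_space: "subshift \<AA>"
    and local: "\<And>J a b. card J = d \<Longrightarrow> a \<in> \<AA> \<Longrightarrow> b \<in> \<AA> \<Longrightarrow> (\<And>u. u \<in> lattice_box q \<Longrightarrow> a u = b u) \<Longrightarrow>
       C (frag_of (0, J)) a = C (frag_of (0, J)) b"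
    and qr: "q < r"
begin

lemma equivariant_cocycle_agree:
  assumes "card J = d" "a \<in> \<AA>" "b \<in> \<AA>" "\<And>u. u \<in> lattice_box q \<Longrightarrow> a (w + u) = b (v + u)"
  shows "C (frag_of (w, J)) a = C (frag_of (v, J)) b"
  unfolding equivariant_cocycle_shift[OF C assms(2,1), of w] equivariant_cocycle_shift[OF C assms(3,1), of v]
  using assms by (intro local subshift_shift[OF shift_space]) (auto simp: add.commute)

text \<open>The choice of a configuration that realises the pattern is immaterial: relative to
  \<open>z\<close> the corner \<open>w\<close> has coordinates 0 or 1, so the window of radius
  \<open>q\<close> around it stays in the box of radius \<open>r\<close>. This spends the extra unit
  in \<open>q < r\<close>.\<close>

lemma tile_cocycle_face:
  assumes "a \<in> \<AA>" "(z, pattern a z (lattice_box r), w, J) \<in> tile_faces \<AA> r" "card J = d"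
  shows "C (frag_of (w - z, J)) (SOME b. b \<in> \<AA> \<and> box_restrict r b = pattern a z (lattice_box r)) = C (frag_of (w, J)) a"
proof -
  let ?b = "SOME b. b \<in> \<AA> \<and> box_restrict r b = pattern a z (lattice_box r)"
  have "shift z a \<in> \<AA> \<and> box_restrict r (shift z a) = pattern a z (lattice_box r)"
    using subshift_shift[OF shift_space assms(1)] by (simp only: pattern_eq_restrict_shift)
  then have b: "?b \<in> \<AA> \<and> box_restrict r ?b = pattern a z (lattice_box r)"
    by (rule someI[where P = "\<lambda>b. b \<in> \<AA> \<and> box_restrict r b = pattern a z (lattice_box r)"])
  show ?thesis
  proof (rule equivariant_cocycle_agree[OF assms(3) conjunct1[OF b] assms(1)])
    fix u :: "(int, 'n) vec" assume u: "u \<in> lattice_box q"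
    have "w - z + u \<in> lattice_box r"
    proof (rule lattice_boxI)
      fix i
      have "w $ i \<in> {z $ i, z $ i + 1}" using assms(2) unfolding tile_faces_iff by blast
      then show "\<bar>(w - z + u) $ i\<bar> \<le> int r" using lattice_boxD[OF u, of i] qr by auto
    qed
    then have "?b (w - z + u) = box_restrict r ?b (w - z + u)" by simp
    also have "\<dots> = a (w + u)"
      using \<open>w - z + u \<in> lattice_box r\<close> unfolding conjunct2[OF b] by (simp add: pattern_def algebra_simps)
    finally show "?b (w - z + u) = a (w + u)" .
  qed
qed

text \<open>Glued tiles meet in a face with \<open>w $ i = z $ i + 1\<close>. The window of radius
  \<open>q\<close> around its corner lies in the overlap of the two boxes, where realisations of the
  two patterns agree.\<close>

lemma glue_invariant_tile_cocycle:
  "glue_invariant \<AA> r (\<lambda>(z, c, w, J).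
     if card J = d then C (frag_of (w - z, J)) (SOME a. a \<in> \<AA> \<and> box_restrict r a = c) else 0)"
proof (rule glue_invariantI, goal_cases)
  case (1 z c y i c')
  obtain w J where y: "y = (w, J)" by (cases y)
  show ?case
  proof (cases "card J = d")
    case True
    have "c \<in> patterns \<AA> (lattice_box r)" "c' \<in> patterns \<AA> (lattice_box r)"
      using 1 by (auto simp: tile_faces_def)
    obtain a where a: "a \<in> \<AA>" "pattern a z (lattice_box r) = c"
      using pattern_realize[OF shift_space \<open>c \<in> _\<close>] .
    obtain a' where a': "a' \<in> \<AA>" "pattern a' (z + axis i 1) (lattice_box r) = c'"
      using pattern_realize[OF shift_space \<open>c' \<in> _\<close>] .
    have "C (frag_of (w, J)) a = C (frag_of (w, J)) a'"
    proof (rule equivariant_cocycle_agree[OF True a(1) a'(1)])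
      fix u :: "(int, 'n) vec" assume u: "u \<in> lattice_box q"
      \<comment> \<open>The position of \<open>w + u\<close> relative to the second tile; relative
        to the first it is \<open>?v + axis i 1\<close>.\<close>
      let ?v = "w + u - z - axis i 1"
      have wi: "w $ i = z $ i + 1" using 1(3) by (simp add: y)
      have v: "?v \<in> lattice_box r"
      proof (rule lattice_boxI)
        fix k
        have "w $ k \<in> {z $ k, z $ k + 1}" using 1(1) unfolding y tile_faces_iff by blast
        then show "\<bar>?v $ k\<bar> \<le> int r"
          using lattice_boxD[OF u, of k] qr wi by (cases "k = i") (auto simp: axis_def)
      qed
      have vi: "?v $ i < int r"
        using lattice_boxD[OF u, of i] qr wi by (simp add: axis_def)
      have "c (?v + axis i 1) = c' ?v" by (rule 1(4)[OF v vi])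
      then show "a (w + u) = a' (w + u)"
        using v lattice_box_add_axis[OF v vi] unfolding a(2)[symmetric] a'(2)[symmetric]
        by (simp add: pattern_def algebra_simps)
    qed
    then show ?thesis
      using tile_cocycle_face[OF a(1), of z w J] tile_cocycle_face[OF a'(1), of "z + axis i 1" w J] 1(1,2) True
      by (simp add: y a(2) a'(2))
  qed (simp add: y)
qed

lemma tile_cocycle_value:
  assumes "a \<in> \<AA>" "(z, pattern a z (lattice_box r), w, J) \<in> tile_faces \<AA> r" "card J = d"
  shows "tile_cocycle \<AA> r d C (glue \<AA> r `` {(z, pattern a z (lattice_box r), w, J)}) = C (frag_of (w, J)) a"
  unfolding tile_cocycle_def
  using face_cochain_value[OF glue_invariant_tile_cocycle assms(2), of d] assms(3) tile_cocycle_face[OF assms]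
  by (simp add: cells_def)

text \<open>A single configuration of the subshift realises the whole tile, so the coboundary at a
  cell of the tile is \<open>C\<close> on the boundary of that cell.\<close>

lemma tile_cocycle_cocycle: "tile_cocycle \<AA> r d C \<in> inv_cocycles \<AA> r d"
proof -
  have "tile_cocycle \<AA> r d C \<in> inv_cochains \<AA> r d"
    unfolding tile_cocycle_def
    by (rule face_cochain_inv[OF glue_invariant_tile_cocycle]) (auto simp: translate_cell_def split: prod.splits)
  moreover have "tile_coboundary \<AA> r d (tile_cocycle \<AA> r d C) = (\<lambda>K. 0)"
  proof (rule cochain_eqI[of \<AA> r "Suc d"])
    fix z c y assume y: "(z, c, y) \<in> tile_faces \<AA> r" "y \<in> cells (Suc d)"
    then have "c \<in> patterns \<AA> (lattice_box r)" by (simp add: tile_faces_def)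
    then obtain a where a: "a \<in> \<AA>" "pattern a z (lattice_box r) = c"
      using pattern_realize[OF shift_space] by blast
    have "tile_cocycle \<AA> r d C (glue \<AA> r `` {(z, c, y')}) = C (frag_of y') a"
      if "y' \<in> Poly_Mapping.keys (cell_boundary y)" for y'
      using tile_faces_boundary[OF y(1) that] cells_boundary[OF y(2) that] tile_cocycle_value[OF a(1), of z "fst y'" "snd y'"]
      by (cases y') (simp add: a(2) cells_def)
    then have "tile_coboundary \<AA> r d (tile_cocycle \<AA> r d C) (glue \<AA> r `` {(z, c, y)})
      = chain_eval (\<lambda>y'. C (frag_of y') a) (cell_boundary y)"
      unfolding tile_coboundary_value[OF y] by (rule chain_eval_cong)
    also have "\<dots> = C (cell_boundary y) a"
      using cell_boundary_cubical_chains[of "snd y" d "fst y"] y(2)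
      by (intro equivariant_cocycle_chain_eval[symmetric, OF C a(1)]) (auto simp: cells_def)
    also have "\<dots> = 0"
      using equivariant_cocycle_boundary[OF C a(1), of "frag_of y"] y(2)
      by (simp add: cubical_chains_def keys_frag_of)
    finally show "tile_coboundary \<AA> r d (tile_cocycle \<AA> r d C) (glue \<AA> r `` {(z, c, y)}) = 0" .
  qed (simp_all add: tile_coboundary_outside)
  ultimately show ?thesis by (simp add: inv_cocycles_def)
qed

text \<open>This also holds for configurations outside the subshift, where the left hand side is the value of a local rule.\<close>

lemma local_rule_eq_cochain_eval:
  assumes "is_local_rule \<AA> d r' C c" "r \<le> r'" "card J = d"
    and "pattern a w (lattice_box r') \<in> patterns \<AA> (lattice_box r')"
  shows "c J (pattern a w (cell_box J r')) = cochain_eval \<AA> r (tile_cocycle \<AA> r d C) a (w, J)"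
proof -
  obtain b where b: "b \<in> \<AA>" "pattern b w (lattice_box r') = pattern a w (lattice_box r')"
    using pattern_realize[OF shift_space assms(4)] .
  have 1: "pattern b w (cell_box J r') = pattern a w (cell_box J r')"
    using b(2) cell_box_lattice_box[of J r'] by (auto simp: pattern_eq_iff)
  have 2: "pattern b w (lattice_box r) = pattern a w (lattice_box r)"
    using b(2) lattice_box_mono[OF assms(2)] by (auto simp: pattern_eq_iff)
  have "c J (pattern a w (cell_box J r')) = C (frag_of (w, J)) b"
    using assms(1,3) b(1) 1 by (auto simp: is_local_rule_def)
  also have "\<dots> = tile_cocycle \<AA> r d C (glue \<AA> r `` {(w, pattern b w (lattice_box r), w, J)})"
    by (rule tile_cocycle_value[symmetric, OF b(1) tile_faces_lowest[OF subshift_pattern[OF shift_space b(1)]] assms(3)])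
  finally show ?thesis by (simp add: cochain_eval_def 2)
qed

end

section \<open>From invariant cocycles of a tile complex back to equivariant cocycles\<close>

definition cocycle_extension ::
  "('n::finite, 'a) config set \<Rightarrow> nat \<Rightarrow> ('n, 'a, 'g::ab_group_add) cochain \<Rightarrow>
   ('n cell \<Rightarrow>\<^sub>0 int) \<Rightarrow> ('n, 'a) config \<Rightarrow> 'g" where
  "cocycle_extension \<AA> s C \<zeta> a = chain_eval (cochain_eval \<AA> s C a) \<zeta>"

lemma cochain_eval_shift:
  fixes \<AA> :: "('n::{finite,linorder}, 'a) config set"
  assumes "C \<in> inv_cochains \<AA> s d" "card J = d"
    and "pattern a (w + z) (lattice_box s) \<in> patterns \<AA> (lattice_box s)"
  shows "cochain_eval \<AA> s C (shift z a) (w, J) = cochain_eval \<AA> s C a (w + z, J)"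
proof -
  have "pattern (shift z a) w (lattice_box s) = pattern a (w + z) (lattice_box s)"
    by (simp add: pattern_def ac_simps)
  then show ?thesis
    using inv_cochains_translate[OF assms(1) tile_faces_lowest[OF assms(3)], of w J z] assms(2)
    by (simp add: cochain_eval_def cells_def translate_cell_def)
qed

text \<open>A local rule must not refer to a position, so the pattern is cut down to radius
  \<open>s\<close> and read in the tile at the origin; invariance under translation identifies this
  with the reading at any \<open>w\<close>.\<close>

definition extension_rule ::
  "('n::finite, 'a) config set \<Rightarrow> nat \<Rightarrow> ('n, 'a, 'g) cochain \<Rightarrow> 'n set \<Rightarrow> ('n, 'a) config \<Rightarrow> 'g" where
  "extension_rule \<AA> s C J p = C (glue \<AA> s `` {(0, box_restrict s p, 0, J)})"

lemma extension_rule_value: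
  fixes \<AA> :: "('n::{finite,linorder}, 'a) config set"
  assumes "C \<in> inv_cochains \<AA> s d" "card J = d" "s < r"
    and "pattern a w (lattice_box s) \<in> patterns \<AA> (lattice_box s)"
  shows "extension_rule \<AA> s C J (pattern a w (cell_box J r)) = cochain_eval \<AA> s C a (w, J)"
proof -
  have "box_restrict s (pattern a w (cell_box J r)) = pattern a w (lattice_box s)"
    using lattice_box_cell_box[OF assms(3), of J] by (auto simp: pattern_def restrict_def fun_eq_iff)
  then show ?thesis
    using inv_cochains_translate[OF assms(1) tile_faces_lowest[OF assms(4)], of 0 J w] assms(2)
    by (simp add: extension_rule_def cochain_eval_def cells_def translate_cell_def)
qed

text \<open>A chain has finitely many cells, each of which sees a finite window. This local
  constancy yields the continuity demanded of an equivariant cocycle.\<close>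

lemma cocycle_extension_local:
  fixes \<zeta> :: "'n::finite cell \<Rightarrow>\<^sub>0 int"
  shows "\<exists>q. \<forall>a b. (\<forall>u\<in>lattice_box q. a u = b u) \<longrightarrow> cocycle_extension \<AA> s C \<zeta> a = cocycle_extension \<AA> s C \<zeta> b"
proof -
  have "finite (\<Union>(w, J)\<in>Poly_Mapping.keys \<zeta>. (+) w ` lattice_box s)"
    by (auto simp: finite_lattice_box)
  then obtain q where q: "(\<Union>(w, J)\<in>Poly_Mapping.keys \<zeta>. (+) w ` lattice_box s) \<subseteq> lattice_box q"
    using finite_subset_lattice_box by blast
  have "cocycle_extension \<AA> s C \<zeta> a = cocycle_extension \<AA> s C \<zeta> b" if ab: "\<forall>u\<in>lattice_box q. a u = b u" for a b
    unfolding cocycle_extension_def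
  proof (rule chain_eval_cong)
    fix y assume y: "y \<in> Poly_Mapping.keys \<zeta>"
    obtain w J where w: "y = (w, J)" by (cases y)
    have "pattern a w (lattice_box s) = pattern b w (lattice_box s)"
      using ab q y unfolding pattern_eq_iff w by blast
    then show "cochain_eval \<AA> s C a y = cochain_eval \<AA> s C b y"
      by (simp add: w cochain_eval_def)
  qed
  then show ?thesis by blast
qed

lemma cocycle_extension_equivariant:
  fixes \<AA> :: "('n::{finite,linorder}, 'a) config set"
  assumes "subshift \<AA>" "C \<in> inv_cocycles \<AA> s d"
  shows "cocycle_extension \<AA> s C \<in> equivariant_cocycles \<AA> d"
  unfolding equivariant_cocycles_def
proof (intro CollectI conjI ballI allI)
  let ?f = "\<lambda>(\<zeta>, a). cocycle_extension \<AA> s C \<zeta> a"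
  let ?X = "prod_topology (discrete_topology (cubical_chains d)) (subtopology config_topology \<AA>)"
  have "openin ?X {x \<in> topspace ?X. ?f x \<in> U}" for U
    unfolding openin_prod_topology_alt
  proof (intro allI impI)
    fix \<zeta> a assume "(\<zeta>, a) \<in> {x \<in> topspace ?X. ?f x \<in> U}"
    then have \<zeta>: "\<zeta> \<in> cubical_chains d" "a \<in> \<AA>" "cocycle_extension \<AA> s C \<zeta> a \<in> U" by auto
    obtain q where q: "\<And>a b. (\<forall>u\<in>lattice_box q. a u = b u) \<Longrightarrow> cocycle_extension \<AA> s C \<zeta> a = cocycle_extension \<AA> s C \<zeta> b"
      using cocycle_extension_local by metis
    let ?V = "{b. \<forall>u\<in>lattice_box q. b u = a u}"
    have "openin (subtopology config_topology \<AA>) (?V \<inter> \<AA>)"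
      by (intro openin_subtopology_Int openin_cylinder)
    moreover have "openin (discrete_topology (cubical_chains d)) {\<zeta>}" using \<zeta>(1) by simp
    moreover have "{\<zeta>} \<times> (?V \<inter> \<AA>) \<subseteq> {x \<in> topspace ?X. ?f x \<in> U}"
    proof
      fix x assume "x \<in> {\<zeta>} \<times> (?V \<inter> \<AA>)"
      then obtain b where b: "x = (\<zeta>, b)" "b \<in> \<AA>" "\<forall>u\<in>lattice_box q. b u = a u" by blast
      show "x \<in> {x \<in> topspace ?X. ?f x \<in> U}"
        using \<zeta>(1,3) b(2) q[OF b(3)] by (simp add: b(1))
    qed
    moreover have "a \<in> ?V \<inter> \<AA>" using \<zeta>(2) by simp
    ultimately show "\<exists>W V. openin (discrete_topology (cubical_chains d)) W \<and> openin (subtopology config_topology \<AA>) V \<and>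
        \<zeta> \<in> W \<and> a \<in> V \<and> W \<times> V \<subseteq> {x \<in> topspace ?X. ?f x \<in> U}"
      by (intro exI[of _ "{\<zeta>}"] exI[of _ "?V \<inter> \<AA>"]) blast
  qed
  then show "continuous_map ?X (discrete_topology UNIV) ?f"
    by (simp add: continuous_map_def)
next
  fix \<zeta> \<xi> :: "'n cell \<Rightarrow>\<^sub>0 int" and a
  show "cocycle_extension \<AA> s C (\<zeta> + \<xi>) a = cocycle_extension \<AA> s C \<zeta> a + cocycle_extension \<AA> s C \<xi> a"
    by (simp add: cocycle_extension_def chain_eval_add)
next
  fix \<zeta> :: "'n cell \<Rightarrow>\<^sub>0 int" and a z assume \<zeta>: "\<zeta> \<in> cubical_chains d" and a: "a \<in> \<AA>"
  show "cocycle_extension \<AA> s C \<zeta> (shift z a) = cocycle_extension \<AA> s C (translate_chain z \<zeta>) a"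
    unfolding cocycle_extension_def translate_chain_def chain_eval_extend
  proof (rule chain_eval_cong)
    fix y assume "y \<in> Poly_Mapping.keys \<zeta>"
    then have "y \<in> cells d" using \<zeta> by (auto simp: cubical_chains_def)
    then show "cochain_eval \<AA> s C (shift z a) y = chain_eval (cochain_eval \<AA> s C a) (frag_of (translate_cell z y))"
      using cochain_eval_shift[OF inv_cocycles_cochains[OF assms(2)] _ subshift_pattern[OF assms(1) a]]
      by (auto simp: cells_def translate_cell_def)
  qed
next
  fix \<beta> :: "'n cell \<Rightarrow>\<^sub>0 int" and a assume \<beta>: "\<beta> \<in> cubical_chains (Suc d)" and a: "a \<in> \<AA>"
  have "cocycle_extension \<AA> s C (cubical_boundary \<beta>) a
    = chain_eval (cochain_eval \<AA> s (tile_coboundary \<AA> s d C) a) \<beta>"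
    unfolding cocycle_extension_def
    by (rule cochain_eval_coboundary_chain[symmetric, OF subshift_pattern[OF assms(1) a] \<beta>])
  also have "cochain_eval \<AA> s (tile_coboundary \<AA> s d C) a = (\<lambda>y. 0)"
    using assms(2) by (auto simp: inv_cocycles_def cochain_eval_def fun_eq_iff)
  finally show "cocycle_extension \<AA> s C (cubical_boundary \<beta>) a = 0" by simp
qed

lemma cocycle_extension_rule:
  fixes \<AA> :: "('n::{finite,linorder}, 'a) config set"
  assumes "subshift \<AA>" "C \<in> inv_cocycles \<AA> s d" "s < r"
  shows "is_local_rule \<AA> d r (cocycle_extension \<AA> s C) (extension_rule \<AA> s C)"
  unfolding is_local_rule_def
  by (simp add: cocycle_extension_def extension_rule_value[OF inv_cocycles_cochains[OF assms(2)] _ assms(3)]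
      subshift_pattern[OF assms(1)])

section \<open>Persistence of poles\<close>

context
  fixes \<AA> :: "('n::{finite,linorder}, 'a::finite) config set"
    and \<Phi> :: "('n, 'a) config \<Rightarrow> ('n, 'a) config"
    and R :: nat
  assumes shift_space: "subshift \<AA>" and ca: "cellular_automaton \<Phi>" and stable: "\<Phi> ` \<AA> \<subseteq> \<AA>"
begin

text \<open>Surjectivity in the limit, made finite: the preimage of the class of \<open>C\<close> is
  represented by some \<open>C'\<close> at a radius \<open>s\<close>, equality in the limit holds at
  a radius \<open>t\<close>, and equality of classes there means equality up to a coboundary
  \<open>B\<close>.\<close>

lemma epi_cocycle_preimage:
  assumes epi: "inv_cohomology_map TYPE('g) R \<AA> d \<Phi> \<in> epi (inv_cohomology TYPE('g) R \<AA> d) (inv_cohomology TYPE('g::ab_group_add) R \<AA> d)"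
    and q: "has_radius \<Phi> q" and r: "R \<le> r"
    and C: "(C :: ('n, 'a, 'g) cochain) \<in> inv_cocycles \<AA> r d"
  obtains s t C' B where "C' \<in> inv_cocycles \<AA> s d" "B \<in> inv_coboundaries \<AA> t d" "r \<le> t" "s + q \<le> t"
    "tile_pullback \<AA> d t r (box_restrict r) C = (\<lambda>K. B K +
       tile_pullback \<AA> d t (s + q) (box_restrict (s + q)) (tile_pullback \<AA> d (s + q) s (ca_tile_map \<Phi> s) C') K)"
proof -
  interpret direct_system R "tile_inv_cohomology \<AA> d" "restriction_map \<AA> d :: nat \<Rightarrow> ('n, 'a, 'g) cochain set \<Rightarrow> _"
    by (rule restriction_system)
  have mem: "inv_cohomology_class \<AA> d k D \<in> carrier (tile_inv_cohomology \<AA> d k)" if "D \<in> inv_cocycles \<AA> k d"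
    for k and D :: "('n, 'a, 'g) cochain"
    using that by (simp add: carrier_tile_inv_cohomology)
  have "inv_limit_class R \<AA> d r C \<in> carrier (inv_cohomology TYPE('g) R \<AA> d)"
    unfolding inv_cohomology_def inv_limit_class_def by (rule limit_class_closed[OF r mem[OF C]])
  moreover have "inv_cohomology_map TYPE('g) R \<AA> d \<Phi> ` carrier (inv_cohomology TYPE('g) R \<AA> d)
      = carrier (inv_cohomology TYPE('g) R \<AA> d)"
    using epi by (simp add: epi_def)
  ultimately have "inv_limit_class R \<AA> d r C
      \<in> inv_cohomology_map TYPE('g) R \<AA> d \<Phi> ` carrier (inv_cohomology TYPE('g) R \<AA> d)"
    by simp
  then obtain X where X: "X \<in> carrier (inv_cohomology TYPE('g) R \<AA> d)"
    "inv_cohomology_map TYPE('g) R \<AA> d \<Phi> X = inv_limit_class R \<AA> d r C"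
    by (elim imageE) simp
  obtain s x where s: "R \<le> s" "x \<in> carrier (tile_inv_cohomology \<AA> d s)"
    "X = limit_class R (tile_inv_cohomology \<AA> d) (restriction_map \<AA> d) s x"
    using X(1) unfolding inv_cohomology_def by (rule limit_carrierE)
  then obtain C' where C': "C' \<in> inv_cocycles \<AA> s d" "X = inv_limit_class R \<AA> d s C'"
    by (auto simp: carrier_tile_inv_cohomology inv_limit_class_def)
  let ?D = "tile_pullback \<AA> d (s + q) s (ca_tile_map \<Phi> s) C'"
  have D: "?D \<in> inv_cocycles \<AA> (s + q) d"
    by (rule tile_pullback_cocycles[OF tile_map_ca[OF q stable] C'(1)])
  have "inv_limit_class R \<AA> d r C = inv_limit_class R \<AA> d (s + q) ?D"
    using X(2) inv_cohomology_map_class[OF ca stable q s(1) C'(1)] C'(2) by metis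
  then obtain t where t: "max r (s + q) \<le> t"
    "transition (restriction_map \<AA> d) r t (inv_cohomology_class \<AA> d r C)
      = transition (restriction_map \<AA> d) (s + q) t (inv_cohomology_class \<AA> d (s + q) ?D)"
    unfolding inv_limit_class_def using limit_class_eq_iff[OF r trans_le_add1[OF s(1)] mem[OF C] mem[OF D]] by blast
  have le: "r \<le> t" "s + q \<le> t" using t(1) by auto
  have "inv_cohomology_class \<AA> d t (tile_pullback \<AA> d t r (box_restrict r) C)
     = inv_cohomology_class \<AA> d t (tile_pullback \<AA> d t (s + q) (box_restrict (s + q)) ?D)"
    using t(2) unfolding transition_restriction_class[OF r le(1) inv_cocycles_cochains[OF C]]
      transition_restriction_class[OF trans_le_add1[OF s(1)] le(2) inv_cocycles_cochains[OF D]] .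
  then have "tile_pullback \<AA> d t r (box_restrict r) C
      \<in> inv_cohomology_class \<AA> d t (tile_pullback \<AA> d t (s + q) (box_restrict (s + q)) ?D)"
    using inv_cohomology_class_self by metis
  then obtain B where "B \<in> inv_coboundaries \<AA> t d" "tile_pullback \<AA> d t r (box_restrict r) C
    = (\<lambda>K. B K + tile_pullback \<AA> d t (s + q) (box_restrict (s + q)) ?D K)"
    unfolding inv_cohomology_class_mem_iff by blast
  then show thesis using that C'(1) le by blast
qed

text \<open>Cell by cell, the local rule of \<open>C\<close> at \<open>a\<close> is the value of the
  coboundary \<open>B\<close> at \<open>a\<close> plus the local rule of the new cocycle at
  \<open>\<Phi> a\<close>; summing over the cycle removes \<open>B\<close>. The quantifiers matter:
  \<open>C'\<close> and \<open>k\<close> depend on \<open>C\<close> alone.\<close>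

lemma pole_cycle_transfer:
  assumes epi: "inv_cohomology_map TYPE('g) R \<AA> d \<Phi> \<in> epi (inv_cohomology TYPE('g) R \<AA> d) (inv_cohomology TYPE('g::ab_group_add) R \<AA> d)"
    and C: "(C :: ('n cell \<Rightarrow>\<^sub>0 int) \<Rightarrow> ('n, 'a) config \<Rightarrow> 'g) \<in> equivariant_cocycles \<AA> d"
  shows "\<exists>C' :: ('n cell \<Rightarrow>\<^sub>0 int) \<Rightarrow> ('n, 'a) config \<Rightarrow> 'g. C' \<in> equivariant_cocycles \<AA> d \<and>
    (\<exists>k. \<forall>r\<ge>k. \<forall>a \<zeta>. pole_cycle \<AA> d C (r + k) a \<zeta> \<longrightarrow> pole_cycle \<AA> d C' r (\<Phi> a) \<zeta>)"
proof -
  obtain q where q: "has_radius \<Phi> q" using cellular_automaton_has_radius[OF ca] by blast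
  obtain p where "\<forall>J a b. card J = d \<longrightarrow> a \<in> \<AA> \<longrightarrow> b \<in> \<AA> \<longrightarrow> (\<forall>u\<in>lattice_box p. a u = b u) \<longrightarrow>
    C (frag_of (0, J)) a = C (frag_of (0, J)) b"
    using equivariant_cocycle_local[OF C shift_space] by blast
  then have p: "C (frag_of (0, J)) a = C (frag_of (0, J)) b"
    if "card J = d" "a \<in> \<AA>" "b \<in> \<AA>" "\<And>u. u \<in> lattice_box p \<Longrightarrow> a u = b u" for J a b
    using that by blast
  \<comment> \<open>At least \<open>R\<close>, so that the class belongs to the direct system, and
    above \<open>p\<close>, so that the tile cocycle does not depend on choices.\<close>
  define m where "m = max R (Suc p)"
  have m: "R \<le> m" "p < m" by (auto simp: m_def)
  let ?C0 = "tile_cocycle \<AA> m d C"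
  have C0: "?C0 \<in> inv_cocycles \<AA> m d"
    by (rule tile_cocycle_cocycle[OF C shift_space p m(2)])
  obtain s t C1 B where C1: "C1 \<in> inv_cocycles \<AA> s d" and B: "B \<in> inv_coboundaries \<AA> t d"
    and le: "m \<le> t" "s + q \<le> t" and
    eq: "tile_pullback \<AA> d t m (box_restrict m) ?C0 = (\<lambda>K. B K +
       tile_pullback \<AA> d t (s + q) (box_restrict (s + q)) (tile_pullback \<AA> d (s + q) s (ca_tile_map \<Phi> s) C1) K)"
    by (rule epi_cocycle_preimage[OF epi q m(1) C0])
  \<comment> \<open>Puts \<open>m\<close>, \<open>s + q\<close> and \<open>t\<close> below
    \<open>r + k\<close>, so that \<open>a\<close> is admissible at every radius that occurs.
    Moreover \<open>k \<le> r\<close> gives \<open>s < r\<close> for the new local rule, and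
    \<open>q \<le> k\<close> pays for the passage to \<open>\<Phi> a\<close>.\<close>
  define k where "k = Suc (s + q + t)"
  have "pole_cycle \<AA> d (cocycle_extension \<AA> s C1) r (\<Phi> a) \<zeta>"
    if r: "k \<le> r" and pole: "pole_cycle \<AA> d C (r + k) a \<zeta>" for r a \<zeta>
  proof -
    from pole obtain c where \<zeta>: "\<zeta> \<in> cubical_chains d" "cubical_boundary \<zeta> = 0"
      and good: "\<And>y. y \<in> Poly_Mapping.keys \<zeta> \<Longrightarrow> vertices y \<subseteq> good_set \<AA> (r + k) a"
      and c: "is_local_rule \<AA> d (r + k) C c"
      and nz: "chain_eval (\<lambda>(z, J). c J (pattern a z (cell_box J (r + k)))) \<zeta> \<noteq> 0"
      unfolding pole_cycle_def by blast
    have pat: "pattern a v (lattice_box l) \<in> patterns \<AA> (lattice_box l)"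
      if "y \<in> Poly_Mapping.keys \<zeta>" "v \<in> vertices y" "l \<le> r + k" for y v l
      using good_set_pattern[of v \<AA> "r + k" a l] good[OF that(1)] that(2,3) by (auto simp: k_def)
    have good': "vertices y \<subseteq> good_set \<AA> r (\<Phi> a)" if "y \<in> Poly_Mapping.keys \<zeta>" for y
      using good_set_ca[OF q stable, of _ "r + k" a r] good[OF that] by (auto simp: k_def)
    have keys: "y \<in> cells d" if "y \<in> Poly_Mapping.keys \<zeta>" for y
      using \<zeta>(1) that by (auto simp: cubical_chains_def)
    \<comment> \<open>In positive degree by Stokes' formula, since the boundary of the cycle is
      zero; in degree 0 the only coboundary is 0.\<close>
    have B0: "chain_eval (cochain_eval \<AA> t B a) \<zeta> = 0"
    proof (cases d)
      case 0
      then have "cochain_eval \<AA> t B a = (\<lambda>y. 0)"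
        using B by (auto simp: inv_coboundaries_def cochain_eval_def)
      then show ?thesis by simp
    next
      case (Suc d')
      then obtain b where b: "B = tile_coboundary \<AA> t d' b" using B by (auto simp: inv_coboundaries_def)
      show ?thesis
        unfolding b using cochain_eval_coboundary_chain[of \<zeta> a t \<AA> d' b] pat \<zeta> Suc by (simp add: k_def)
    qed
    have step: "c J (pattern a w (cell_box J (r + k))) = cochain_eval \<AA> t B a (w, J)
        + extension_rule \<AA> s C1 J (pattern (\<Phi> a) w (cell_box J r))"
      if y: "(w, J) \<in> Poly_Mapping.keys \<zeta>" for w J
    proof -
      have P: "pattern a w (lattice_box l) \<in> patterns \<AA> (lattice_box l)" if "l \<le> r + k" for l
        using pat[OF y vertex_lowest that] .
      have J: "card J = d" using keys[OF y] by (simp add: cells_def)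
      have "c J (pattern a w (cell_box J (r + k))) = cochain_eval \<AA> m ?C0 a (w, J)"
        using le by (intro local_rule_eq_cochain_eval[OF C shift_space p m(2) c _ J P]) (auto simp: k_def)
      also have "\<dots> = cochain_eval \<AA> t (tile_pullback \<AA> d t m (box_restrict m) ?C0) a (w, J)"
        by (rule cochain_eval_restrict[symmetric, OF le(1) P keys[OF y]]) (simp add: k_def)
      also have "\<dots> = cochain_eval \<AA> t B a (w, J) + cochain_eval \<AA> t
          (tile_pullback \<AA> d t (s + q) (box_restrict (s + q)) (tile_pullback \<AA> d (s + q) s (ca_tile_map \<Phi> s) C1)) a (w, J)"
        unfolding eq by (simp add: cochain_eval_def)
      also have "cochain_eval \<AA> t
          (tile_pullback \<AA> d t (s + q) (box_restrict (s + q)) (tile_pullback \<AA> d (s + q) s (ca_tile_map \<Phi> s) C1)) a (w, J)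
        = cochain_eval \<AA> (s + q) (tile_pullback \<AA> d (s + q) s (ca_tile_map \<Phi> s) C1) a (w, J)"
        by (rule cochain_eval_restrict[OF le(2) P keys[OF y]]) (simp add: k_def)
      also have "\<dots> = cochain_eval \<AA> s C1 (\<Phi> a) (w, J)"
        by (rule cochain_eval_ca[OF q stable P keys[OF y]]) (simp add: k_def)
      also have "\<dots> = extension_rule \<AA> s C1 J (pattern (\<Phi> a) w (cell_box J r))"
      proof (rule extension_rule_value[symmetric, OF inv_cocycles_cochains[OF C1] J])
        show "s < r" using r by (simp add: k_def)
        then show "pattern (\<Phi> a) w (lattice_box s) \<in> patterns \<AA> (lattice_box s)"
          using good'[OF y] vertex_lowest[of w J] by (intro good_set_pattern[of w \<AA> r]) auto
      qed
      finally show ?thesis .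
    qed
    have "chain_eval (\<lambda>(z, J). c J (pattern a z (cell_box J (r + k)))) \<zeta>
      = chain_eval (\<lambda>y. cochain_eval \<AA> t B a y + (case y of (z, J) \<Rightarrow> extension_rule \<AA> s C1 J (pattern (\<Phi> a) z (cell_box J r)))) \<zeta>"
      by (rule chain_eval_cong) (auto simp: step)
    then have "chain_eval (\<lambda>(z, J). extension_rule \<AA> s C1 J (pattern (\<Phi> a) z (cell_box J r))) \<zeta> \<noteq> 0"
      using nz by (simp add: chain_eval_fun_add B0)
    moreover have "is_local_rule \<AA> d r (cocycle_extension \<AA> s C1) (extension_rule \<AA> s C1)"
      using r by (intro cocycle_extension_rule[OF shift_space C1]) (simp add: k_def)
    ultimately show ?thesis
      unfolding pole_cycle_def using \<zeta> good' by blast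
  qed
  then show ?thesis
    using cocycle_extension_equivariant[OF shift_space C1] by blast
qed

section \<open>Poles as obstructions to lying in the subshift, and their persistence\<close>

lemma pole_cycle_not_in_subshift:
  assumes "C \<in> equivariant_cocycles \<AA> d" "pole_cycle \<AA> d C r a \<zeta>"
    and "d = 0 \<Longrightarrow> (\<Sum>y\<in>Poly_Mapping.keys \<zeta>. Poly_Mapping.lookup \<zeta> y) = 0"
  shows "a \<notin> \<AA>"
proof
  assume a: "a \<in> \<AA>"
  from assms(2) obtain c where \<zeta>: "\<zeta> \<in> cubical_chains d" "cubical_boundary \<zeta> = 0"
    and c: "is_local_rule \<AA> d r C c" "chain_eval (\<lambda>(z, J). c J (pattern a z (cell_box J r))) \<zeta> \<noteq> 0"
    unfolding pole_cycle_def by blast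
  obtain \<beta> where \<beta>: "\<beta> \<in> cubical_chains (Suc d)" "cubical_boundary \<beta> = \<zeta>"
    using cubical_cycle_is_boundary[OF \<zeta> assms(3)] by blast
  \<comment> \<open>Inside the subshift the local rule returns \<open>C\<close> itself, so the
    cocycle condition becomes applicable.\<close>
  have "chain_eval (\<lambda>(z, J). c J (pattern a z (cell_box J r))) \<zeta> = chain_eval (\<lambda>y. C (frag_of y) a) \<zeta>"
    using \<zeta>(1) c(1) a by (intro chain_eval_cong) (auto simp: cubical_chains_def cells_def is_local_rule_def)
  also have "\<dots> = C \<zeta> a" by (rule equivariant_cocycle_chain_eval[symmetric, OF assms(1) a \<zeta>(1)])
  also have "\<dots> = 0" using equivariant_cocycle_boundary[OF assms(1) a \<beta>(1)] \<beta>(2) by simp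
  finally show False using c(2) by simp
qed

context
  fixes d :: nat
  assumes epi: "inv_cohomology_map TYPE('g::ab_group_add) R \<AA> d \<Phi> \<in> epi (inv_cohomology TYPE('g) R \<AA> d) (inv_cohomology TYPE('g) R \<AA> d)"
begin

lemma tilde_stable: "a \<in> tilde \<AA> \<Longrightarrow> \<Phi> a \<in> tilde \<AA>"
  using cellular_automaton_has_radius[OF ca] tilde_ca[OF _ stable] by blast

lemma projective_pole_transfer:
  assumes "has_projective_pole TYPE('g) \<AA> d a"
  shows "has_projective_pole TYPE('g) \<AA> d (\<Phi> a)"
proof -
  from assms obtain C :: "('n cell \<Rightarrow>\<^sub>0 int) \<Rightarrow> ('n, 'a) config \<Rightarrow> 'g" and N
    where C: "C \<in> equivariant_cocycles \<AA> d" and N: "\<And>r. N \<le> r \<Longrightarrow> has_pole \<AA> d C r a"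
    unfolding has_projective_pole_def eventually_sequentially by blast
  obtain C' :: "('n cell \<Rightarrow>\<^sub>0 int) \<Rightarrow> ('n, 'a) config \<Rightarrow> 'g" and k where C': "C' \<in> equivariant_cocycles \<AA> d"
    and k: "\<And>r a \<zeta>. k \<le> r \<Longrightarrow> pole_cycle \<AA> d C (r + k) a \<zeta> \<Longrightarrow> pole_cycle \<AA> d C' r (\<Phi> a) \<zeta>"
    using pole_cycle_transfer[OF epi C] by blast
  have "has_pole \<AA> d C' r (\<Phi> a)" if "max N k \<le> r" for r
    using N[of "r + k"] k[of r a] that tilde_stable unfolding has_pole_def by auto
  then show ?thesis
    using C' unfolding has_projective_pole_def eventually_sequentially by blast
qed

text \<open>The transferred cycle is the old one, so its augmentation is still zero.\<close>

lemma reduced_projective_0_pole_transfer: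
  assumes "has_reduced_projective_0_pole TYPE('g) \<AA> a" "d = 0"
  shows "has_reduced_projective_0_pole TYPE('g) \<AA> (\<Phi> a)"
proof -
  let ?aug = "\<lambda>\<zeta> :: 'n cell \<Rightarrow>\<^sub>0 int. \<Sum>y\<in>Poly_Mapping.keys \<zeta>. Poly_Mapping.lookup \<zeta> y"
  from assms obtain C :: "('n cell \<Rightarrow>\<^sub>0 int) \<Rightarrow> ('n, 'a) config \<Rightarrow> 'g" and N
    where C: "C \<in> equivariant_cocycles \<AA> 0"
      and N: "\<And>r. N \<le> r \<Longrightarrow> a \<in> tilde \<AA> \<and> (\<exists>\<zeta>. pole_cycle \<AA> 0 C r a \<zeta> \<and> ?aug \<zeta> = 0)"
    unfolding has_reduced_projective_0_pole_def eventually_sequentially by blast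
  obtain C' :: "('n cell \<Rightarrow>\<^sub>0 int) \<Rightarrow> ('n, 'a) config \<Rightarrow> 'g" and k where C': "C' \<in> equivariant_cocycles \<AA> 0"
    and k: "\<And>r a \<zeta>. k \<le> r \<Longrightarrow> pole_cycle \<AA> 0 C (r + k) a \<zeta> \<Longrightarrow> pole_cycle \<AA> 0 C' r (\<Phi> a) \<zeta>"
    using pole_cycle_transfer[OF epi[unfolded assms(2)] C] by blast
  have "\<Phi> a \<in> tilde \<AA> \<and> (\<exists>\<zeta>. pole_cycle \<AA> 0 C' r (\<Phi> a) \<zeta> \<and> ?aug \<zeta> = 0)" if r: "max N k \<le> r" for r
  proof -
    have "N \<le> r + k" "k \<le> r" using r by auto
    then show ?thesis using N[of "r + k"] k[of r a] tilde_stable by blast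
  qed
  then show ?thesis
    using C' unfolding has_reduced_projective_0_pole_def eventually_sequentially by blast
qed

text \<open>A pole of one range \<open>N\<close> is enough, and \<open>1 \<le> d\<close> makes the
  condition on the augmentation vacuous.\<close>

lemma projective_pole_defective:
  assumes "has_projective_pole TYPE('g) \<AA> d a" "1 \<le> d"
  shows "defective \<AA> a"
proof -
  from assms(1) obtain C :: "('n cell \<Rightarrow>\<^sub>0 int) \<Rightarrow> ('n, 'a) config \<Rightarrow> 'g" and N
    where C: "C \<in> equivariant_cocycles \<AA> d" and N: "has_pole \<AA> d C N a"
    unfolding has_projective_pole_def eventually_sequentially by blast
  then show ?thesis
    using pole_cycle_not_in_subshift[OF C] assms(2) unfolding has_pole_def defective_def by auto
qed

lemma reduced_projective_0_pole_defective:
  assumes "has_reduced_projective_0_pole TYPE('g) \<AA> a"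
  shows "defective \<AA> a"
proof -
  from assms obtain C :: "('n cell \<Rightarrow>\<^sub>0 int) \<Rightarrow> ('n, 'a) config \<Rightarrow> 'g" and N
    where C: "C \<in> equivariant_cocycles \<AA> 0" and N: "a \<in> tilde \<AA>"
      "\<exists>\<zeta>. pole_cycle \<AA> 0 C N a \<zeta> \<and> (\<Sum>y\<in>Poly_Mapping.keys \<zeta>. Poly_Mapping.lookup \<zeta> y) = 0"
    unfolding has_reduced_projective_0_pole_def eventually_sequentially by blast
  then show ?thesis
    using pole_cycle_not_in_subshift[OF C] unfolding defective_def by blast
qed

text \<open>Surjectivity on cohomology concerns \<open>\<Phi>\<close> and not the configuration, so
  the transfer can be repeated along the whole orbit.\<close>

lemma projective_pole_persistent:
  assumes "has_projective_pole TYPE('g) \<AA> d a" "1 \<le> d"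
  shows "persistent_defect \<Phi> \<AA> a"
proof -
  have "has_projective_pole TYPE('g) \<AA> d ((\<Phi> ^^ t) a)" for t
    by (induction t) (use assms(1) projective_pole_transfer in auto)
  then show ?thesis
    using projective_pole_defective assms(2) unfolding persistent_defect_def by blast
qed

lemma reduced_projective_0_pole_persistent:
  assumes "has_reduced_projective_0_pole TYPE('g) \<AA> a" "d = 0"
  shows "persistent_defect \<Phi> \<AA> a"
proof -
  have "has_reduced_projective_0_pole TYPE('g) \<AA> ((\<Phi> ^^ t) a)" for t
    by (induction t) (use assms(1) reduced_projective_0_pole_transfer[OF _ assms(2)] in auto)
  then show ?thesis
    using reduced_projective_0_pole_defective unfolding persistent_defect_def by blast
qed

end

end

text \<open>The endomorphism is built from one chosen radius of \<open>\<Phi>\<close>; the formula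
  on representatives is asserted for every radius, which shows that the choice has no
  influence.\<close>

theorem theorem4p10:
  fixes \<AA> :: "('n::{finite,linorder}, 'a::finite) config set"
    and \<Phi> :: "('n, 'a) config \<Rightarrow> ('n, 'a) config"
    and R :: nat
  assumes "subshift_of_finite_type R \<AA>"
    and "cellular_automaton \<Phi>"
    and "\<Phi> ` \<AA> \<subseteq> \<AA>"
  shows
    "(\<forall>d \<le> CARD('n).
        comm_group (inv_cohomology TYPE('g::ab_group_add) R \<AA> d) \<and>
        inv_cohomology_map TYPE('g) R \<AA> d \<Phi>
          \<in> hom (inv_cohomology TYPE('g) R \<AA> d) (inv_cohomology TYPE('g) R \<AA> d) \<and>
        (\<forall>q r. \<forall>C :: ('n, 'a, 'g) cochain.
           has_radius \<Phi> q \<and> R \<le> r \<and> C \<in> inv_cocycles \<AA> r d \<longrightarrow>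
             tile_pullback \<AA> d (r + q) r (ca_tile_map \<Phi> r) C \<in> inv_cocycles \<AA> (r + q) d \<and>
             inv_cohomology_map TYPE('g) R \<AA> d \<Phi> (inv_limit_class R \<AA> d r C)
               = inv_limit_class R \<AA> d (r + q) (tile_pullback \<AA> d (r + q) r (ca_tile_map \<Phi> r) C))) \<and>
     (\<forall>d \<le> CARD('n).
        inv_cohomology_map TYPE('g) R \<AA> d \<Phi>
          \<in> epi (inv_cohomology TYPE('g) R \<AA> d) (inv_cohomology TYPE('g) R \<AA> d) \<longrightarrow>
        (\<forall>a \<in> tilde \<AA>.
           has_projective_pole TYPE('g) \<AA> d a \<and>
           (\<forall>\<^sub>F r in sequentially.
              trivial_group
                (Ext (homology_group (int d - 1) (top_of_set (cubical_hull (good_set \<AA> r (\<Phi> a)))))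
                     (additive_group :: 'g monoid)))
           \<longrightarrow> has_projective_pole TYPE('g) \<AA> d (\<Phi> a)) \<and>
        (d = 1 \<or> d = CARD('n) \<longrightarrow>
           (\<forall>a. has_projective_pole TYPE('g) \<AA> d a \<longrightarrow> persistent_defect \<Phi> \<AA> a)) \<and>
        ((\<exists>F :: 'g ring. field F \<and> add_monoid F = additive_group) \<longrightarrow>
           (d \<ge> 1 \<longrightarrow> (\<forall>a. has_projective_pole TYPE('g) \<AA> d a \<longrightarrow> persistent_defect \<Phi> \<AA> a)) \<and>
           (d = 0 \<longrightarrow> (\<forall>a. has_reduced_projective_0_pole TYPE('g) \<AA> a \<longrightarrow> persistent_defect \<Phi> \<AA> a))))"
proof -
  have shift_space: "subshift \<AA>"
    using assms(1) by (simp add: subshift_of_finite_type_def)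
  note transfer = projective_pole_transfer[OF shift_space assms(2,3)]
    and persistent = projective_pole_persistent[OF shift_space assms(2,3)]
    and persistent_0 = reduced_projective_0_pole_persistent[OF shift_space assms(2,3)]
  \<comment> \<open>The index type is nonempty, so top-dimensional poles also have positive
    degree.\<close>
  have D: "1 \<le> CARD('n)" by (simp add: Suc_leI)
  show ?thesis
  proof (intro conjI allI impI, goal_cases)
    case 1 show ?case by (rule comm_group_inv_cohomology)
  next
    case 2 show ?case by (rule inv_cohomology_map_hom[OF assms(2,3)])
  next
    case (3 d q r C)
    then show ?case by (intro tile_pullback_cocycles[OF tile_map_ca[OF _ assms(3)]]) auto
  next
    case (4 d q r C)
    then show ?case by (intro inv_cohomology_map_class[OF assms(2,3)]) auto
  next
    case (5 d)
    then show ?case using transfer by blast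
  next
    case (6 d a)
    then have "1 \<le> d" using D by auto
    with 6 show ?case by (intro persistent)
  next
    case (7 d a)
    then show ?case using persistent by blast
  next
    case (8 d a)
    then show ?case using persistent_0 by blast
  qed
qed

end
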